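(* The category $\mathbf{Hom}_{st\otimes}(\mathbf A,\mathbf{Cat})$ of strict tensor 2-functors $\mathbf A\to\mathbf{Cat}$ and strict 2-natural transformations between them is equivalent to the category $\mathbf{Assoc\text{-}Cat}_{st}$ of associative categories and strict tensor functors.
   Context: Associative category: a category $\mathbf B$ with a bifunctor $\otimes:\mathbf B\times\mathbf B\to\mathbf B$ and a natural isomorphism $\beta_{A,B,C}:A\otimes(B\otimes C)\to(A\otimes B)\otimes C$ (no pentagon condition, no unit). A strict tensor functor $F:(\mathbf B,\otimes,\beta)\to(\mathbf B',\otimes',\beta')$ is a functor with $F(A\otimes B)=F(A)\otimes' F(B)$ (on objects and morphisms) and $F(\beta_{A,B,C})=\beta'_{FA,FB,FC}$. Catalan groupoids: let $\mathbf I$ (resp. $\dot{\mathbf I}$) be the indiscrete (resp. discrete) category with two objects $0,1$, and $\iota:0\to1$ the nontrivial isomorphism. Groupoids $\mathbf A_n$ ($n\ge1$) and functors $U_{a,b}:\mathbf A_a\times\mathbf A_b\to\mathbf A_{a+b}$, $V_{i,j,k}:\mathbf A_i\times\mathbf A_j\times\mathbf A_k\times\mathbf I\to\mathbf A_{i+j+k}$ are defined inductively (indices positive). $\mathbf A_1=\mathbf 1$ with one object $*$. For $n\ge2$, $\mathbf A_n$ is the pushout of categories of $$\coprod_{i+j+k=n}\mathbf A_i\times\mathbf A_j\times\mathbf A_k\times\mathbf I\ \hookleftarrow\ \coprod_{i+j+k=n}\mathbf A_i\times\mathbf A_j\times\mathbf A_k\times\dot{\mathbf I}\ \xrightarrow{W_{i,j,k}}\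 \coprod_{a+b=n}\mathbf A_a\times\mathbf A_b,$$ $W_{i,j,k}(f,g,h,0)=(f,U_{j,k}(g,h))$, $W_{i,j,k}(f,g,h,1)=(U_{i,j}(f,g),h)$ (similarly on morphisms); $V_{i,j,k},U_{a,b}$ are the structure maps. Substitution functors: for an order-preserving surjection $\pi:\{1,\dots,t\}\to\{1,\dots,n\}$ with $m_i=|\pi^{-1}(i)|$, the functor $Q=Q_{n,t,\pi}:\mathbf A_n\times\mathbf A_{m_1}\times\cdots\times\mathbf A_{m_n}\to\mathbf A_t$ is defined by induction on $n$: $Q_{1,t,\pi}$ is the projection $\mathbf A_1\times\mathbf A_t\to\mathbf A_t$; on objects (for $n\geq 2$), writing $f\in\mathbf A_n$ uniquely as $U_{a,b}(f_1,f_2)$ with $a+b=n$, $Q(f,g_1,\dots,g_n)=U(Q(f_1,g_1,\dots,g_a),Q(f_2,g_{a+1},\dots,g_n))$; on morphisms it is determined by functoriality from the same formula for $\phi=U_{a,b}(\phi_1,\phi_2)$, and, for $\phi=V_{i,j,k}(\phi_1,\phi_2,\phi_3,\iota)$, $Q(\phi,\gamma_1,\dots,\gamma_n)=V(Q(\phi_1,\gamma_1,\dots,\gamma_i),Q(\phi_2,\gamma_{i+1},\dots,\gamma_{i+j}),Q(\phi_3,\gamma_{i+j+1},\dots,\gamma_n),\iota)$, with the evident indices on $U,V,Q$. The strict tensor 2-category $\mathbf A$: 0-cells are the positive integers; $\mathbf{Hom}_{\mathbf A}(n,k)=\coprod_{\pi:n\to k}\prod_{i=1}^k\mathbf A_{|\pi^{-1}(i)|}$,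 with $\pi$ ranging over order-preserving surjections $\{1,\dots,n\}\to\{1,\dots,k\}$. So a 1-cell is $f=(f_1,\dots,f_k)$ with its partition $\pi_f$, and a 2-cell is $\phi=(\phi_1,\dots,\phi_k)$ between 1-cells of the same partition. Vertical composition $\circ_V$ is componentwise composition in the $\mathbf A_m$'s. Horizontal composition $\circ_H$ of $f:n\to k$ followed by $g:k\to l$ is $g\circ_H f=(h_1,\dots,h_l)$ with partition $\pi_g\circ\pi_f$ and $h_i=Q(g_i,f_{i_1},\dots,f_{i_s})$, where $\{i_1<\dots<i_s\}=\pi_g^{-1}(i)$; the same formula is used on 2-cells. The strict tensor is $n\otimes_{\mathbf A}m=n+m$ on 0-cells and concatenation of sequences on 1-cells and 2-cells. $\mathbf{Cat}$ is regarded as a strict tensor 2-category under the product $\times$ (product is treated as strictly associative, as is customary). Objects of $\mathbf{Hom}_{st\otimes}(\mathbf A,\mathbf{Cat})$ are 2-functors $R:\mathbf A\to\mathbf{Cat}$ with $R(x\otimes_{\mathbf A}y)=R(x)\times R(y)$ for 0-cells, 1-cells and 2-cells $x,y$. Morphisms $F:R\Rightarrow S$ assign to every 0-cell $n$ a functor $F(n):R(n)\to S(n)$ such that $F(n\otimes_{\mathbf A}m)=F(n)\times F(m)$, $S(f)\circ F(n)=F(m)\circ R(f)$ for every 1-cell $f:n\to m$, and $S(\phi)\,F(n)=F(m)\,R(\phi)$ (whiskerings) for every 2-cell $\phi$. Higher structure on $\mathbf{Hom}_{st\otimes}(\mathbf A,\mathbf{Cat})$ is ignored. *)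

theory Defs
  imports "HOL-Library.FuncSet"
begin

section \<open>Categories, functors, natural transformations\<close>

text \<open>
  All operations are required to be \<^const>\<open>undefined\<close> outside their domain, so that equality of
  categories, functors and transformations is ordinary equality of records and functions.
\<close>

record ('o, 'm) category =
  Obj :: "'o set"
  Arr :: "'m set"
  Dom :: "'m \<Rightarrow> 'o"
  Cod :: "'m \<Rightarrow> 'o"
  Id :: "'o \<Rightarrow> 'm"
  Comp :: "'m \<Rightarrow> 'm \<Rightarrow> 'm"

definition composable :: "('o, 'm, 'z) category_scheme \<Rightarrow> 'm \<Rightarrow> 'm \<Rightarrow> bool" where
  "composable C g f \<longleftrightarrow> g \<in> Arr C \<and> f \<in> Arr C \<and> Dom C g = Cod C f"

definition hom :: "('o, 'm, 'z) category_scheme \<Rightarrow> 'o \<Rightarrow> 'o \<Rightarrow> 'm set" where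
  "hom C x y = {f \<in> Arr C. Dom C f = x \<and> Cod C f = y}"

definition category :: "('o, 'm, 'z) category_scheme \<Rightarrow> bool" where
  "category C \<longleftrightarrow>
     Dom C \<in> Arr C \<rightarrow>\<^sub>E Obj C \<and> Cod C \<in> Arr C \<rightarrow>\<^sub>E Obj C \<and>
     Id C \<in> Obj C \<rightarrow>\<^sub>E Arr C \<and> (\<forall>x \<in> Obj C. Id C x \<in> hom C x x) \<and>
     (\<forall>g f. \<not> composable C g f \<longrightarrow> Comp C g f = undefined) \<and>
     (\<forall>g f. composable C g f \<longrightarrow> Comp C g f \<in> hom C (Dom C f) (Cod C g)) \<and>
     (\<forall>f \<in> Arr C. Comp C f (Id C (Dom C f)) = f \<and> Comp C (Id C (Cod C f)) f = f) \<and>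
     (\<forall>h g f. composable C h g \<and> composable C g f \<longrightarrow>
        Comp C h (Comp C g f) = Comp C (Comp C h g) f)"

definition iso :: "('o, 'm, 'z) category_scheme \<Rightarrow> 'm \<Rightarrow> bool" where
  "iso C f \<longleftrightarrow> f \<in> Arr C \<and>
     (\<exists>g \<in> hom C (Cod C f) (Dom C f).
        Comp C g f = Id C (Dom C f) \<and> Comp C f g = Id C (Cod C f))"

record ('o, 'm, 'p, 'q) functor_maps =
  OMap :: "'o \<Rightarrow> 'p"
  AMap :: "'m \<Rightarrow> 'q"

definition is_functor ::
  "('o, 'm, 'y) category_scheme \<Rightarrow> ('p, 'q, 'z) category_scheme \<Rightarrow>
   ('o, 'm, 'p, 'q, 'w) functor_maps_scheme \<Rightarrow> bool" where
  "is_functor C D F \<longleftrightarrow>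
     category C \<and> category D \<and>
     OMap F \<in> Obj C \<rightarrow>\<^sub>E Obj D \<and> AMap F \<in> Arr C \<rightarrow>\<^sub>E Arr D \<and>
     (\<forall>f \<in> Arr C. Dom D (AMap F f) = OMap F (Dom C f) \<and> Cod D (AMap F f) = OMap F (Cod C f)) \<and>
     (\<forall>x \<in> Obj C. AMap F (Id C x) = Id D (OMap F x)) \<and>
     (\<forall>g f. composable C g f \<longrightarrow> AMap F (Comp C g f) = Comp D (AMap F g) (AMap F f))"

definition id_functor :: "('o, 'm, 'z) category_scheme \<Rightarrow> ('o, 'm, 'o, 'm) functor_maps" where
  "id_functor C = \<lparr>OMap = restrict (\<lambda>x. x) (Obj C), AMap = restrict (\<lambda>f. f) (Arr C)\<rparr>"

definition comp_functor ::
  "('o, 'm, 'z) category_scheme \<Rightarrow> ('p, 'q, 'r, 's, 'v) functor_maps_scheme \<Rightarrow>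
   ('o, 'm, 'p, 'q, 'w) functor_maps_scheme \<Rightarrow> ('o, 'm, 'r, 's) functor_maps" where
  "comp_functor C G F =
     \<lparr>OMap = compose (Obj C) (OMap G) (OMap F), AMap = compose (Arr C) (AMap G) (AMap F)\<rparr>"

definition is_nat_trans ::
  "('o, 'm, 'y) category_scheme \<Rightarrow> ('p, 'q, 'z) category_scheme \<Rightarrow>
   ('o, 'm, 'p, 'q, 'v) functor_maps_scheme \<Rightarrow> ('o, 'm, 'p, 'q, 'w) functor_maps_scheme \<Rightarrow>
   ('o \<Rightarrow> 'q) \<Rightarrow> bool" where
  "is_nat_trans C D F G \<tau> \<longleftrightarrow>
     is_functor C D F \<and> is_functor C D G \<and>
     \<tau> \<in> Obj C \<rightarrow>\<^sub>E Arr D \<and> (\<forall>x \<in> Obj C. \<tau> x \<in> hom D (OMap F x) (OMap G x)) \<and>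
     (\<forall>f \<in> Arr C. Comp D (\<tau> (Cod C f)) (AMap F f) = Comp D (AMap G f) (\<tau> (Dom C f)))"

definition is_nat_iso ::
  "('o, 'm, 'y) category_scheme \<Rightarrow> ('p, 'q, 'z) category_scheme \<Rightarrow>
   ('o, 'm, 'p, 'q, 'v) functor_maps_scheme \<Rightarrow> ('o, 'm, 'p, 'q, 'w) functor_maps_scheme \<Rightarrow>
   ('o \<Rightarrow> 'q) \<Rightarrow> bool" where
  "is_nat_iso C D F G \<tau> \<longleftrightarrow> is_nat_trans C D F G \<tau> \<and> (\<forall>x \<in> Obj C. iso D (\<tau> x))"

definition equivalent_categories ::
  "('o, 'm, 'y) category_scheme \<Rightarrow> ('p, 'q, 'z) category_scheme \<Rightarrow> bool" where
  "equivalent_categories C D \<longleftrightarrow>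
     category C \<and> category D \<and>
     (\<exists>(F :: ('o, 'm, 'p, 'q) functor_maps) (G :: ('p, 'q, 'o, 'm) functor_maps) \<eta> \<epsilon>.
        is_functor C D F \<and> is_functor D C G \<and>
        is_nat_iso C C (id_functor C) (comp_functor C G F) \<eta> \<and>
        is_nat_iso D D (comp_functor D F G) (id_functor D) \<epsilon>)"

definition prod_cat ::
  "('o, 'm, 'y) category_scheme \<Rightarrow> ('p, 'q, 'z) category_scheme \<Rightarrow> ('o \<times> 'p, 'm \<times> 'q) category"
  (infixr "\<times>\<^sub>C" 80) where
  "prod_cat C D =
     \<lparr>Obj = Obj C \<times> Obj D, Arr = Arr C \<times> Arr D,
      Dom = restrict (map_prod (Dom C) (Dom D)) (Arr C \<times> Arr D),
      Cod = restrict (map_prod (Cod C) (Cod D)) (Arr C \<times> Arr D),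
      Id = restrict (map_prod (Id C) (Id D)) (Obj C \<times> Obj D),
      Comp = (\<lambda>g f. if composable C (fst g) (fst f) \<and> composable D (snd g) (snd f)
                    then (Comp C (fst g) (fst f), Comp D (snd g) (snd f)) else undefined)\<rparr>"

definition list_prod_cat :: "('o, 'm) category list \<Rightarrow> ('o list, 'm list) category" where
  "list_prod_cat Cs =
    (let A = {fs. list_all2 (\<lambda>C f. f \<in> Arr C) Cs fs}; B = {xs. list_all2 (\<lambda>C x. x \<in> Obj C) Cs xs} in
     \<lparr>Obj = B, Arr = A,
      Dom = restrict (map2 Dom Cs) A, Cod = restrict (map2 Cod Cs) A, Id = restrict (map2 Id Cs) B,
      Comp = (\<lambda>gs fs. if gs \<in> A \<and> fs \<in> A \<and> map2 Dom Cs gs = map2 Cod Cs fs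
                      then map2 (\<lambda>C (g, f). Comp C g f) Cs (zip gs fs) else undefined)\<rparr>)"

definition coprod_cat :: "'i set \<Rightarrow> ('i \<Rightarrow> ('o, 'm) category) \<Rightarrow> ('i \<times> 'o, 'i \<times> 'm) category" where
  "coprod_cat I C =
     \<lparr>Obj = (SIGMA i:I. Obj (C i)), Arr = (SIGMA i:I. Arr (C i)),
      Dom = restrict (\<lambda>(i, f). (i, Dom (C i) f)) (SIGMA i:I. Arr (C i)),
      Cod = restrict (\<lambda>(i, f). (i, Cod (C i) f)) (SIGMA i:I. Arr (C i)),
      Id = restrict (\<lambda>(i, x). (i, Id (C i) x)) (SIGMA i:I. Obj (C i)),
      Comp = (\<lambda>g f. if fst g \<in> I \<and> fst f = fst g \<and> composable (C (fst g)) (snd g) (snd f)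
                    then (fst g, Comp (C (fst g)) (snd g) (snd f)) else undefined)\<rparr>"

text \<open>\<open>indisc S\<close> and \<open>disc S\<close>: the arrow \<open>x \<rightarrow> y\<close> is the pair \<open>(x, y)\<close>.\<close>

definition indisc :: "'a set \<Rightarrow> ('a, 'a \<times> 'a) category" where
  "indisc S =
     \<lparr>Obj = S, Arr = S \<times> S, Dom = restrict fst (S \<times> S), Cod = restrict snd (S \<times> S),
      Id = restrict (\<lambda>x. (x, x)) S,
      Comp = (\<lambda>g f. if g \<in> S \<times> S \<and> f \<in> S \<times> S \<and> fst g = snd f then (fst f, snd g) else undefined)\<rparr>"

definition disc :: "'a set \<Rightarrow> ('a, 'a \<times> 'a) category" where
  "disc S =
     \<lparr>Obj = S, Arr = Id_on S, Dom = restrict fst (Id_on S), Cod = restrict snd (Id_on S),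
      Id = restrict (\<lambda>x. (x, x)) S,
      Comp = (\<lambda>g f. if g \<in> Id_on S \<and> f \<in> Id_on S \<and> fst g = snd f then (fst f, snd g) else undefined)\<rparr>"

text \<open>
  \<open>pushout_at T L M N P j w p q\<close>: the square \<open>p \<circ> j = q \<circ> w\<close> on the span
  \<open>L \<leftarrow>j\<midarrow> M \<midarrow>w\<rightarrow> N\<close> has the universal property of a pushout with respect to the test category \<open>T\<close>.
\<close>

definition pushout_at ::
  "('t, 'u) category \<Rightarrow> ('a, 'b) category \<Rightarrow> ('x, 'y) category \<Rightarrow> ('c, 'd) category \<Rightarrow> ('e, 'f) category \<Rightarrow>
   ('x, 'y, 'a, 'b) functor_maps \<Rightarrow> ('x, 'y, 'c, 'd) functor_maps \<Rightarrow>
   ('a, 'b, 'e, 'f) functor_maps \<Rightarrow> ('c, 'd, 'e, 'f) functor_maps \<Rightarrow> bool" where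
  "pushout_at T L M N P j w p q \<longleftrightarrow>
     is_functor M L j \<and> is_functor M N w \<and> is_functor L P p \<and> is_functor N P q \<and>
     comp_functor M p j = comp_functor M q w \<and>
     (\<forall>(p' :: ('a, 'b, 't, 'u) functor_maps) (q' :: ('c, 'd, 't, 'u) functor_maps).
        is_functor L T p' \<and> is_functor N T q' \<and> comp_functor M p' j = comp_functor M q' w \<longrightarrow>
        (\<exists>!h :: ('e, 'f, 't, 'u) functor_maps. is_functor P T h \<and> comp_functor L h p = p' \<and> comp_functor N h q = q'))"


section \<open>The Catalan groupoids\<close>

text \<open>
  The objects of \<open>\<^bold>A\<^sub>n\<close> are the binary trees with \<open>n\<close> leaves: \<open>Leaf\<close> is the
  object \<open>*\<close> of \<open>\<^bold>A\<^sub>1\<close>, and \<open>Node f g\<close> is \<open>U(f, g)\<close>.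
\<close>

datatype tree = Leaf | Node tree tree

fun leaves :: "tree \<Rightarrow> nat" where
  "leaves Leaf = 1"
| "leaves (Node f g) = leaves f + leaves g"

text \<open>
  The arrows of the iterated pushouts are presented by formal composites of the images of
  \<open>U\<close> and \<open>V\<close>, modulo the congruence which makes composition a category structure,
  \<open>U\<close> and \<open>V\<close> functors, and the pushout square commute. The theorem \<open>catalan_pushout\<close> below
  shows that this does yield the pushout, with respect to test categories over arbitrary types.
  The last argument of \<open>TV\<close> is an arrow of the indiscrete category on
  \<open>False = 0\<close>, \<open>True = 1\<close>; the arrow \<open>\<iota> : 0 \<rightarrow> 1\<close> is \<open>(False, True)\<close>.
\<close>

datatype arrow_term =
    TOne
  | TU arrow_term arrow_term
  | TV arrow_term arrow_term arrow_term "bool \<times> bool"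
  | TComp arrow_term arrow_term

fun bracket :: "bool \<Rightarrow> tree \<Rightarrow> tree \<Rightarrow> tree \<Rightarrow> tree" where
  "bracket False f g h = Node f (Node g h)"
| "bracket True f g h = Node (Node f g) h"

fun tdom :: "arrow_term \<Rightarrow> tree" where
  "tdom TOne = Leaf"
| "tdom (TU s t) = Node (tdom s) (tdom t)"
| "tdom (TV r s t e) = bracket (fst e) (tdom r) (tdom s) (tdom t)"
| "tdom (TComp s t) = tdom t"

fun tcod :: "arrow_term \<Rightarrow> tree" where
  "tcod TOne = Leaf"
| "tcod (TU s t) = Node (tcod s) (tcod t)"
| "tcod (TV r s t e) = bracket (snd e) (tcod r) (tcod s) (tcod t)"
| "tcod (TComp s t) = tcod s"

fun tvalid :: "arrow_term \<Rightarrow> bool" where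
  "tvalid TOne \<longleftrightarrow> True"
| "tvalid (TU s t) \<longleftrightarrow> tvalid s \<and> tvalid t"
| "tvalid (TV r s t e) \<longleftrightarrow> tvalid r \<and> tvalid s \<and> tvalid t"
| "tvalid (TComp s t) \<longleftrightarrow> tvalid s \<and> tvalid t \<and> tdom s = tcod t"

fun tid :: "tree \<Rightarrow> arrow_term" where
  "tid Leaf = TOne"
| "tid (Node f g) = TU (tid f) (tid g)"

inductive teq :: "arrow_term \<Rightarrow> arrow_term \<Rightarrow> bool" (infix "\<approx>" 50) where
  teq_refl: "t \<approx> t"
| teq_sym: "s \<approx> t \<Longrightarrow> t \<approx> s"
| teq_trans: "r \<approx> s \<Longrightarrow> s \<approx> t \<Longrightarrow> r \<approx> t"
| cong_U: "s \<approx> s' \<Longrightarrow> t \<approx> t' \<Longrightarrow> TU s t \<approx> TU s' t'"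
| cong_V: "r \<approx> r' \<Longrightarrow> s \<approx> s' \<Longrightarrow> t \<approx> t' \<Longrightarrow> TV r s t e \<approx> TV r' s' t' e"
| cong_Comp: "s \<approx> s' \<Longrightarrow> t \<approx> t' \<Longrightarrow> TComp s t \<approx> TComp s' t'"
| id_left: "tvalid t \<Longrightarrow> TComp (tid (tcod t)) t \<approx> t"
| id_right: "tvalid t \<Longrightarrow> TComp t (tid (tdom t)) \<approx> t"
| comp_assoc: "tvalid (TComp r (TComp s t)) \<Longrightarrow> TComp r (TComp s t) \<approx> TComp (TComp r s) t"
| funct_U: "tvalid (TComp s s') \<Longrightarrow> tvalid (TComp t t') \<Longrightarrow>
    TComp (TU s t) (TU s' t') \<approx> TU (TComp s s') (TComp t t')"
| funct_V: "tvalid (TComp r r') \<Longrightarrow> tvalid (TComp s s') \<Longrightarrow> tvalid (TComp t t') \<Longrightarrow>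
    TComp (TV r s t (y, z)) (TV r' s' t' (x, y)) \<approx> TV (TComp r r') (TComp s s') (TComp t t') (x, z)"
| V_id0: "tvalid r \<Longrightarrow> tvalid s \<Longrightarrow> tvalid t \<Longrightarrow> TV r s t (False, False) \<approx> TU r (TU s t)"
| V_id1: "tvalid r \<Longrightarrow> tvalid s \<Longrightarrow> tvalid t \<Longrightarrow> TV r s t (True, True) \<approx> TU (TU r s) t"

lemma tid_simps [simp]: "tdom (tid f) = f" "tcod (tid f) = f" "tvalid (tid f)"
  by (induction f) auto

lemma leaves_pos [simp]: "leaves f > 0"
  by (induction f) auto

lemma leaves_neq0 [simp]: "leaves f \<noteq> 0"
  using leaves_pos by blast

lemma leaves_bracket [simp]: "leaves (bracket b f g h) = leaves f + leaves g + leaves h"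
  by (cases b) auto

lemma leaves_tcod: "tvalid t \<Longrightarrow> leaves (tcod t) = leaves (tdom t)"
  by (induction t) auto

lemma teq_invariants: "s \<approx> t \<Longrightarrow> tdom s = tdom t \<and> tcod s = tcod t \<and> (tvalid s \<longleftrightarrow> tvalid t)"
  by (induction rule: teq.induct) auto

quotient_type catalan_arrow = arrow_term / teq
  by (intro equivpI reflpI sympI transpI) (fact teq_refl, erule teq_sym, erule (1) teq_trans)

lift_definition adom :: "catalan_arrow \<Rightarrow> tree" is tdom using teq_invariants by blast
lift_definition acod :: "catalan_arrow \<Rightarrow> tree" is tcod using teq_invariants by blast
lift_definition avalid :: "catalan_arrow \<Rightarrow> bool" is tvalid using teq_invariants by blast
lift_definition aid :: "tree \<Rightarrow> catalan_arrow" is tid .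
lift_definition acomp :: "catalan_arrow \<Rightarrow> catalan_arrow \<Rightarrow> catalan_arrow" is TComp by (rule cong_Comp)
lift_definition aU :: "catalan_arrow \<Rightarrow> catalan_arrow \<Rightarrow> catalan_arrow" is TU by (rule cong_U)
lift_definition aV ::
  "catalan_arrow \<Rightarrow> catalan_arrow \<Rightarrow> catalan_arrow \<Rightarrow> bool \<times> bool \<Rightarrow> catalan_arrow" is TV
  using cong_V by blast

lemma leaves_acod: "avalid \<phi> \<Longrightarrow> leaves (acod \<phi>) = leaves (adom \<phi>)"
  by transfer (rule leaves_tcod)

definition catalan :: "nat \<Rightarrow> (tree, catalan_arrow) category" where
  "catalan n =
    (let A = {\<phi>. avalid \<phi> \<and> leaves (adom \<phi>) = n}; B = {f. leaves f = n} in
     \<lparr>Obj = B, Arr = A, Dom = restrict adom A, Cod = restrict acod A, Id = restrict aid B,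
      Comp = (\<lambda>\<psi> \<phi>. if \<psi> \<in> A \<and> \<phi> \<in> A \<and> adom \<psi> = acod \<phi> then acomp \<psi> \<phi> else undefined)\<rparr>)"

lemma catalan_simps [simp]:
  "Obj (catalan n) = {f. leaves f = n}"
  "Arr (catalan n) = {\<phi>. avalid \<phi> \<and> leaves (adom \<phi>) = n}"
  "avalid \<phi> \<Longrightarrow> leaves (adom \<phi>) = n \<Longrightarrow> Dom (catalan n) \<phi> = adom \<phi>"
  "avalid \<phi> \<Longrightarrow> leaves (adom \<phi>) = n \<Longrightarrow> Cod (catalan n) \<phi> = acod \<phi>"
  "leaves f = n \<Longrightarrow> Id (catalan n) f = aid f"
  "avalid \<psi> \<Longrightarrow> avalid \<phi> \<Longrightarrow> leaves (adom \<phi>) = n \<Longrightarrow> adom \<psi> = acod \<phi> \<Longrightarrow>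
     Comp (catalan n) \<psi> \<phi> = acomp \<psi> \<phi>"
  by (simp_all add: catalan_def Let_def leaves_acod)

lemma arrow_simps [simp]:
  "adom (aid f) = f" "acod (aid f) = f" "avalid (aid f)"
  "adom (acomp \<psi> \<phi>) = adom \<phi>" "acod (acomp \<psi> \<phi>) = acod \<psi>"
  "avalid (acomp \<psi> \<phi>) \<longleftrightarrow> avalid \<psi> \<and> avalid \<phi> \<and> adom \<psi> = acod \<phi>"
  "adom (aU \<phi> \<psi>) = Node (adom \<phi>) (adom \<psi>)" "acod (aU \<phi> \<psi>) = Node (acod \<phi>) (acod \<psi>)"
  "avalid (aU \<phi> \<psi>) \<longleftrightarrow> avalid \<phi> \<and> avalid \<psi>"
  "adom (aV \<phi> \<psi> \<chi> e) = bracket (fst e) (adom \<phi>) (adom \<psi>) (adom \<chi>)"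
  "acod (aV \<phi> \<psi> \<chi> e) = bracket (snd e) (acod \<phi>) (acod \<psi>) (acod \<chi>)"
  "avalid (aV \<phi> \<psi> \<chi> e) \<longleftrightarrow> avalid \<phi> \<and> avalid \<psi> \<and> avalid \<chi>"
  "aid (Node f g) = aU (aid f) (aid g)"
  by (transfer; simp add: teq_refl)+

lemma arrow_eqs:
  "avalid \<phi> \<Longrightarrow> acomp (aid (acod \<phi>)) \<phi> = \<phi>"
  "avalid \<phi> \<Longrightarrow> acomp \<phi> (aid (adom \<phi>)) = \<phi>"
  "avalid (acomp \<chi> (acomp \<psi> \<phi>)) \<Longrightarrow> acomp \<chi> (acomp \<psi> \<phi>) = acomp (acomp \<chi> \<psi>) \<phi>"
  "avalid (acomp \<phi> \<phi>') \<Longrightarrow> avalid (acomp \<psi> \<psi>') \<Longrightarrow>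
     acomp (aU \<phi> \<psi>) (aU \<phi>' \<psi>') = aU (acomp \<phi> \<phi>') (acomp \<psi> \<psi>')"
  "avalid (acomp \<phi> \<phi>') \<Longrightarrow> avalid (acomp \<psi> \<psi>') \<Longrightarrow> avalid (acomp \<chi> \<chi>') \<Longrightarrow>
     acomp (aV \<phi> \<psi> \<chi> (y, z)) (aV \<phi>' \<psi>' \<chi>' (x, y)) = aV (acomp \<phi> \<phi>') (acomp \<psi> \<psi>') (acomp \<chi> \<chi>') (x, z)"
  "avalid \<phi> \<Longrightarrow> avalid \<psi> \<Longrightarrow> avalid \<chi> \<Longrightarrow> aV \<phi> \<psi> \<chi> (False, False) = aU \<phi> (aU \<psi> \<chi>)"
  "avalid \<phi> \<Longrightarrow> avalid \<psi> \<Longrightarrow> avalid \<chi> \<Longrightarrow> aV \<phi> \<psi> \<chi> (True, True) = aU (aU \<phi> \<psi>) \<chi>"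
  by (transfer, erule id_left id_right comp_assoc funct_U funct_V V_id0 V_id1; assumption)+

lemma composable_catalan [simp]:
  "composable (catalan n) \<psi> \<phi> \<longleftrightarrow>
     avalid \<psi> \<and> avalid \<phi> \<and> leaves (adom \<phi>) = n \<and> adom \<psi> = acod \<phi>"
proof
  assume "composable (catalan n) \<psi> \<phi>"
  then have "avalid \<psi>" "leaves (adom \<psi>) = n" "avalid \<phi>" "leaves (adom \<phi>) = n"
    "Dom (catalan n) \<psi> = Cod (catalan n) \<phi>"
    by (simp_all add: composable_def)
  then show "avalid \<psi> \<and> avalid \<phi> \<and> leaves (adom \<phi>) = n \<and> adom \<psi> = acod \<phi>"
    by simp
next
  assume a: "avalid \<psi> \<and> avalid \<phi> \<and> leaves (adom \<phi>) = n \<and> adom \<psi> = acod \<phi>"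
  then have "leaves (adom \<psi>) = n" by (simp add: leaves_acod)
  with a show "composable (catalan n) \<psi> \<phi>" by (simp add: composable_def)
qed

lemma category_catalan: "category (catalan n)"
  unfolding category_def
proof (intro conjI)
  show "\<forall>g f. \<not> composable (catalan n) g f \<longrightarrow> Comp (catalan n) g f = undefined"
    by (auto simp: catalan_def Let_def composable_def)
  show "\<forall>h g f. composable (catalan n) h g \<and> composable (catalan n) g f \<longrightarrow>
      Comp (catalan n) h (Comp (catalan n) g f) = Comp (catalan n) (Comp (catalan n) h g) f"
    by (simp add: arrow_eqs(3) leaves_acod)
  show "Dom (catalan n) \<in> Arr (catalan n) \<rightarrow>\<^sub>E Obj (catalan n)"
    by (simp add: PiE_iff leaves_acod) (simp add: catalan_def Let_def)
  show "Cod (catalan n) \<in> Arr (catalan n) \<rightarrow>\<^sub>E Obj (catalan n)"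
    by (simp add: PiE_iff leaves_acod) (simp add: catalan_def Let_def)
  show "Id (catalan n) \<in> Obj (catalan n) \<rightarrow>\<^sub>E Arr (catalan n)"
    by (simp add: PiE_iff leaves_acod) (simp add: catalan_def Let_def)
  show "\<forall>x\<in>Obj (catalan n). Id (catalan n) x \<in> hom (catalan n) x x"
    by (simp add: hom_def leaves_acod)
  show "\<forall>g f. composable (catalan n) g f \<longrightarrow>
      Comp (catalan n) g f \<in> hom (catalan n) (Dom (catalan n) f) (Cod (catalan n) g)"
    by (simp add: hom_def leaves_acod)
  show "\<forall>f\<in>Arr (catalan n).
       Comp (catalan n) f (Id (catalan n) (Dom (catalan n) f)) = f \<and>
       Comp (catalan n) (Id (catalan n) (Cod (catalan n) f)) f = f"
    by (simp add: arrow_eqs(1,2) leaves_acod)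
qed

lemma arrow_induct [consumes 1, case_names One U V Comp]:
  assumes "avalid \<phi>"
    and "P (aid Leaf)"
    and "\<And>\<phi> \<psi>. avalid \<phi> \<Longrightarrow> avalid \<psi> \<Longrightarrow> P \<phi> \<Longrightarrow> P \<psi> \<Longrightarrow> P (aU \<phi> \<psi>)"
    and "\<And>\<phi> \<psi> \<chi> e. avalid \<phi> \<Longrightarrow> avalid \<psi> \<Longrightarrow> avalid \<chi> \<Longrightarrow> P \<phi> \<Longrightarrow> P \<psi> \<Longrightarrow> P \<chi> \<Longrightarrow> P (aV \<phi> \<psi> \<chi> e)"
    and "\<And>\<psi> \<phi>. avalid \<psi> \<Longrightarrow> avalid \<phi> \<Longrightarrow> adom \<psi> = acod \<phi> \<Longrightarrow> P \<psi> \<Longrightarrow> P \<phi> \<Longrightarrow> P (acomp \<psi> \<phi>)"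
  shows "P \<phi>"
proof -
  have "tvalid t \<Longrightarrow> P (abs_catalan_arrow t)" for t
  proof (induction t)
    case TOne
    then show ?case using assms(2) by (simp add: aid.abs_eq)
  next
    case (TU s t)
    then show ?case using assms(3)[of "abs_catalan_arrow s" "abs_catalan_arrow t"]
      by (simp add: avalid.abs_eq aU.abs_eq)
  next
    case (TV r s t e)
    then show ?case
      using assms(4)[of "abs_catalan_arrow r" "abs_catalan_arrow s" "abs_catalan_arrow t" e]
      by (simp add: avalid.abs_eq aV.abs_eq)
  next
    case (TComp s t)
    then show ?case using assms(5)[of "abs_catalan_arrow s" "abs_catalan_arrow t"]
      by (simp add: avalid.abs_eq acomp.abs_eq adom.abs_eq acod.abs_eq)
  qed
  then show ?thesis using assms(1)
    by (metis Quotient_abs_rep Quotient_catalan_arrow avalid.rep_eq)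
qed

text \<open>\<open>\<^bold>A\<^sub>1 = \<^bold>1\<close>.\<close>

lemma catalan_1: "Obj (catalan 1) = {Leaf}" "Arr (catalan 1) = {aid Leaf}"
proof -
  have *: "leaves f = 1 \<longleftrightarrow> f = Leaf" for f
    by (cases f) (auto simp: add_is_1)
  then show "Obj (catalan 1) = {Leaf}" by auto
  have "adom \<phi> = Leaf \<longrightarrow> \<phi> = aid Leaf" if "avalid \<phi>" for \<phi>
    using that
  proof (induction rule: arrow_induct)
    case (V \<phi> \<psi> \<chi> e)
    then show ?case by (cases "fst e") auto
  next
    case (Comp \<psi> \<phi>)
    then show ?case using arrow_eqs(1)[of "aid Leaf"] by auto
  qed auto
  then show "Arr (catalan 1) = {aid Leaf}" using * by auto
qed

definition U_functor ::
  "nat \<Rightarrow> nat \<Rightarrow> (tree \<times> tree, catalan_arrow \<times> catalan_arrow, tree, catalan_arrow) functor_maps" where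
  "U_functor a b =
     \<lparr>OMap = restrict (\<lambda>(f, g). Node f g) (Obj (catalan a \<times>\<^sub>C catalan b)),
      AMap = restrict (\<lambda>(\<phi>, \<psi>). aU \<phi> \<psi>) (Arr (catalan a \<times>\<^sub>C catalan b))\<rparr>"

definition V_functor ::
  "nat \<Rightarrow> nat \<Rightarrow> nat \<Rightarrow>
   (tree \<times> tree \<times> tree \<times> bool,
    catalan_arrow \<times> catalan_arrow \<times> catalan_arrow \<times> bool \<times> bool, tree, catalan_arrow) functor_maps" where
  "V_functor i j k =
    (let C = catalan i \<times>\<^sub>C catalan j \<times>\<^sub>C catalan k \<times>\<^sub>C indisc UNIV in
     \<lparr>OMap = restrict (\<lambda>(f, g, h, x). bracket x f g h) (Obj C),
      AMap = restrict (\<lambda>(\<phi>, \<psi>, \<chi>, e). aV \<phi> \<psi> \<chi> e) (Arr C)\<rparr>)"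

definition pairs :: "nat \<Rightarrow> (nat \<times> nat) set" where
  "pairs n = {(a, b). 1 \<le> a \<and> 1 \<le> b \<and> a + b = n}"

definition triples :: "nat \<Rightarrow> (nat \<times> nat \<times> nat) set" where
  "triples n = {(i, j, k). 1 \<le> i \<and> 1 \<le> j \<and> 1 \<le> k \<and> i + j + k = n}"

definition coprod_U where
  "coprod_U n = coprod_cat (pairs n) (\<lambda>(a, b). catalan a \<times>\<^sub>C catalan b)"

text \<open>In the span of \<open>catalan_pushout\<close>, the middle corner is \<open>E = disc UNIV\<close>, the left corner \<open>E = indisc UNIV\<close>.\<close>

definition coprod_V where
  "coprod_V E n = coprod_cat (triples n) (\<lambda>(i, j, k). catalan i \<times>\<^sub>C catalan j \<times>\<^sub>C catalan k \<times>\<^sub>C E)"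

definition incl_functor where
  "incl_functor n = id_functor (coprod_V (disc (UNIV :: bool set)) n)"

definition W_functor where
  "W_functor n =
    (let C = coprod_V (disc (UNIV :: bool set)) n in
     \<lparr>OMap = restrict (\<lambda>((i, j, k), (f, g, h, x)).
        if x then ((i + j, k), (Node f g, h)) else ((i, j + k), (f, Node g h))) (Obj C),
      AMap = restrict (\<lambda>((i, j, k), (\<phi>, \<psi>, \<chi>, e)).
        if fst e then ((i + j, k), (aU \<phi> \<psi>, \<chi>)) else ((i, j + k), (\<phi>, aU \<psi> \<chi>))) (Arr C)\<rparr>)"

definition copair where
  "copair D F = \<lparr>OMap = restrict (\<lambda>(i, x). OMap (F i) x) (Obj D),
                 AMap = restrict (\<lambda>(i, f). AMap (F i) f) (Arr D)\<rparr>"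

lemma categoryI:
  assumes "Dom C \<in> Arr C \<rightarrow>\<^sub>E Obj C" "Cod C \<in> Arr C \<rightarrow>\<^sub>E Obj C" "Id C \<in> Obj C \<rightarrow>\<^sub>E Arr C"
    and "\<And>x. x \<in> Obj C \<Longrightarrow> Dom C (Id C x) = x"
    and "\<And>x. x \<in> Obj C \<Longrightarrow> Cod C (Id C x) = x"
    and "\<And>g f. \<not> composable C g f \<Longrightarrow> Comp C g f = undefined"
    and "\<And>g f. composable C g f \<Longrightarrow> Comp C g f \<in> hom C (Dom C f) (Cod C g)"
    and "\<And>f. f \<in> Arr C \<Longrightarrow> Comp C f (Id C (Dom C f)) = f"
    and "\<And>f. f \<in> Arr C \<Longrightarrow> Comp C (Id C (Cod C f)) f = f"
    and "\<And>h g f. composable C h g \<Longrightarrow> composable C g f \<Longrightarrow>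
      Comp C h (Comp C g f) = Comp C (Comp C h g) f"
  shows "category C"
  using assms unfolding category_def hom_def by (auto simp: PiE_mem)

lemma categoryD:
  assumes "category C"
  shows "f \<in> Arr C \<Longrightarrow> Dom C f \<in> Obj C" "f \<in> Arr C \<Longrightarrow> Cod C f \<in> Obj C"
    and "x \<in> Obj C \<Longrightarrow> Id C x \<in> Arr C"
    and "x \<in> Obj C \<Longrightarrow> Dom C (Id C x) = x" "x \<in> Obj C \<Longrightarrow> Cod C (Id C x) = x"
    and "composable C g f \<Longrightarrow> Comp C g f \<in> Arr C"
    and "composable C g f \<Longrightarrow> Dom C (Comp C g f) = Dom C f"
    and "composable C g f \<Longrightarrow> Cod C (Comp C g f) = Cod C g"
    and "f \<in> Arr C \<Longrightarrow> Comp C f (Id C (Dom C f)) = f"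
    and "f \<in> Arr C \<Longrightarrow> Comp C (Id C (Cod C f)) f = f"
    and "composable C h g \<Longrightarrow> composable C g f \<Longrightarrow> Comp C h (Comp C g f) = Comp C (Comp C h g) f"
  using assms unfolding category_def hom_def by (auto simp: PiE_mem)

lemma category_prod:
  assumes C: "category C" and D: "category D"
  shows "category (C \<times>\<^sub>C D)"
proof -
  have comp: "composable (C \<times>\<^sub>C D) g f \<longleftrightarrow> composable C (fst g) (fst f) \<and> composable D (snd g) (snd f)"
    for g f by (cases g; cases f) (auto simp: composable_def prod_cat_def)
  show ?thesis
  proof (rule categoryI)
    fix g f assume "composable (C \<times>\<^sub>C D) g f"
    then show "Comp (C \<times>\<^sub>C D) g f \<in> hom (C \<times>\<^sub>C D) (Dom (C \<times>\<^sub>C D) f) (Cod (C \<times>\<^sub>C D) g)"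
      using categoryD[OF C] categoryD[OF D]
      by (cases g; cases f) (auto simp: comp hom_def, auto simp: prod_cat_def composable_def)
  next
    fix h g f assume "composable (C \<times>\<^sub>C D) h g" "composable (C \<times>\<^sub>C D) g f"
    then show "Comp (C \<times>\<^sub>C D) h (Comp (C \<times>\<^sub>C D) g f) = Comp (C \<times>\<^sub>C D) (Comp (C \<times>\<^sub>C D) h g) f"
      using categoryD[OF C] categoryD[OF D]
      unfolding comp by (cases h; cases g; cases f) (simp add: prod_cat_def composable_def)
  qed (use categoryD[OF C] categoryD[OF D] in
      \<open>auto simp: prod_cat_def composable_def PiE_iff\<close>)
qed

lemma category_coprod:
  assumes C: "\<And>i. i \<in> I \<Longrightarrow> category (C i)"
  shows "category (coprod_cat I C)"
proof -
  have comp: "composable (coprod_cat I C) g f \<longleftrightarrow>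
      fst g \<in> I \<and> fst f = fst g \<and> composable (C (fst g)) (snd g) (snd f)"
    for g f by (cases g; cases f) (auto simp: composable_def coprod_cat_def)
  show ?thesis
  proof (rule categoryI)
    fix g f assume "composable (coprod_cat I C) g f"
    then show "Comp (coprod_cat I C) g f \<in>
        hom (coprod_cat I C) (Dom (coprod_cat I C) f) (Cod (coprod_cat I C) g)"
      using categoryD[OF C]
      by (cases g; cases f) (auto simp: comp hom_def, auto simp: coprod_cat_def composable_def)
  next
    fix h g f assume "composable (coprod_cat I C) h g" "composable (coprod_cat I C) g f"
    then show "Comp (coprod_cat I C) h (Comp (coprod_cat I C) g f) =
        Comp (coprod_cat I C) (Comp (coprod_cat I C) h g) f"
      using categoryD[OF C]
      unfolding comp by (cases h; cases g; cases f) (simp add: coprod_cat_def composable_def)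
  qed (use categoryD[OF C] in \<open>auto simp: coprod_cat_def composable_def PiE_iff\<close>)
qed

lemma category_indisc: "category (indisc S)"
  by (rule categoryI) (auto simp: indisc_def composable_def hom_def PiE_iff)

lemma category_disc: "category (disc S)"
proof -
  have comp: "composable (disc S) g f \<longleftrightarrow> g \<in> Id_on S \<and> f = g" for g f
    by (cases g; cases f) (auto simp: composable_def disc_def Id_on_iff)
  show ?thesis
  proof (rule categoryI)
    fix g f assume "\<not> composable (disc S) g f"
    then have "\<not> (g \<in> Id_on S \<and> f = g)" using comp by blast
    then show "Comp (disc S) g f = undefined"
      by (cases g; cases f) (auto simp: disc_def Id_on_iff)
  qed (auto simp: comp hom_def, auto simp: disc_def PiE_iff Id_on_iff)
qed

lemma is_functorI:
  assumes "category C" "category D"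
    and "OMap F \<in> extensional (Obj C)" "AMap F \<in> extensional (Arr C)"
    and "\<And>x. x \<in> Obj C \<Longrightarrow> OMap F x \<in> Obj D" "\<And>f. f \<in> Arr C \<Longrightarrow> AMap F f \<in> Arr D"
    and "\<And>f. f \<in> Arr C \<Longrightarrow> Dom D (AMap F f) = OMap F (Dom C f)"
    and "\<And>f. f \<in> Arr C \<Longrightarrow> Cod D (AMap F f) = OMap F (Cod C f)"
    and "\<And>x. x \<in> Obj C \<Longrightarrow> AMap F (Id C x) = Id D (OMap F x)"
    and "\<And>g f. composable C g f \<Longrightarrow> AMap F (Comp C g f) = Comp D (AMap F g) (AMap F f)"
  shows "is_functor C D F"
  using assms unfolding is_functor_def by (auto simp: PiE_iff)

lemma is_functorD:
  assumes "is_functor C D F"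
  shows "category C" "category D" "OMap F \<in> extensional (Obj C)" "AMap F \<in> extensional (Arr C)"
    and "x \<in> Obj C \<Longrightarrow> OMap F x \<in> Obj D" "f \<in> Arr C \<Longrightarrow> AMap F f \<in> Arr D"
    and "f \<in> Arr C \<Longrightarrow> Dom D (AMap F f) = OMap F (Dom C f)"
    and "f \<in> Arr C \<Longrightarrow> Cod D (AMap F f) = OMap F (Cod C f)"
    and "x \<in> Obj C \<Longrightarrow> AMap F (Id C x) = Id D (OMap F x)"
    and "composable C g f \<Longrightarrow> AMap F (Comp C g f) = Comp D (AMap F g) (AMap F f)"
  using assms unfolding is_functor_def by (auto simp: PiE_iff)

lemma is_functor_id: "category C \<Longrightarrow> is_functor C C (id_functor C)"
  by (rule is_functorI) (auto simp: id_functor_def categoryD composable_def)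

lemma prod_cat_simps [simp]:
  "Obj (C \<times>\<^sub>C D) = Obj C \<times> Obj D" "Arr (C \<times>\<^sub>C D) = Arr C \<times> Arr D"
  "f \<in> Arr C \<Longrightarrow> f' \<in> Arr D \<Longrightarrow> Dom (C \<times>\<^sub>C D) (f, f') = (Dom C f, Dom D f')"
  "f \<in> Arr C \<Longrightarrow> f' \<in> Arr D \<Longrightarrow> Cod (C \<times>\<^sub>C D) (f, f') = (Cod C f, Cod D f')"
  "x \<in> Obj C \<Longrightarrow> y \<in> Obj D \<Longrightarrow> Id (C \<times>\<^sub>C D) (x, y) = (Id C x, Id D y)"
  "composable (C \<times>\<^sub>C D) (g, g') (f, f') \<longleftrightarrow> composable C g f \<and> composable D g' f'"
  "composable C g f \<Longrightarrow> composable D g' f' \<Longrightarrow>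
     Comp (C \<times>\<^sub>C D) (g, g') (f, f') = (Comp C g f, Comp D g' f')"
  by (auto simp: prod_cat_def composable_def)

lemma coprod_cat_simps [simp]:
  "Obj (coprod_cat I C) = (SIGMA i:I. Obj (C i))" "Arr (coprod_cat I C) = (SIGMA i:I. Arr (C i))"
  "i \<in> I \<Longrightarrow> f \<in> Arr (C i) \<Longrightarrow> Dom (coprod_cat I C) (i, f) = (i, Dom (C i) f)"
  "i \<in> I \<Longrightarrow> f \<in> Arr (C i) \<Longrightarrow> Cod (coprod_cat I C) (i, f) = (i, Cod (C i) f)"
  "i \<in> I \<Longrightarrow> x \<in> Obj (C i) \<Longrightarrow> Id (coprod_cat I C) (i, x) = (i, Id (C i) x)"
  "composable (coprod_cat I C) (i, g) (j, f) \<longleftrightarrow> i \<in> I \<and> j = i \<and> composable (C i) g f"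
  "i \<in> I \<Longrightarrow> composable (C i) g f \<Longrightarrow> Comp (coprod_cat I C) (i, g) (i, f) = (i, Comp (C i) g f)"
  by (auto simp: coprod_cat_def composable_def)

lemma indisc_simps [simp]:
  "Obj (indisc S) = S" "Arr (indisc S) = S \<times> S"
  "x \<in> S \<Longrightarrow> y \<in> S \<Longrightarrow> Dom (indisc S) (x, y) = x" "x \<in> S \<Longrightarrow> y \<in> S \<Longrightarrow> Cod (indisc S) (x, y) = y"
  "x \<in> S \<Longrightarrow> Id (indisc S) x = (x, x)"
  "composable (indisc S) (y, z) (x, y') \<longleftrightarrow> x \<in> S \<and> y \<in> S \<and> z \<in> S \<and> y' = y"
  "x \<in> S \<Longrightarrow> y \<in> S \<Longrightarrow> z \<in> S \<Longrightarrow> Comp (indisc S) (y, z) (x, y) = (x, z)"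
  by (auto simp: indisc_def composable_def)

lemma disc_simps [simp]:
  "Obj (disc S) = S" "Arr (disc S) = Id_on S"
  "x \<in> S \<Longrightarrow> Dom (disc S) (x, x) = x" "x \<in> S \<Longrightarrow> Cod (disc S) (x, x) = x"
  "x \<in> S \<Longrightarrow> Id (disc S) x = (x, x)"
  "composable (disc S) (y, z) (x, y') \<longleftrightarrow> x \<in> S \<and> x = y \<and> y' = y \<and> z = y"
  "x \<in> S \<Longrightarrow> Comp (disc S) (x, x) (x, x) = (x, x)"
  by (auto simp: disc_def composable_def)

lemma is_functor_U: "is_functor (catalan a \<times>\<^sub>C catalan b) (catalan (a + b)) (U_functor a b)"
  by (rule is_functorI)
    (simp_all add: split_paired_all category_prod category_catalan U_functor_def leaves_acod arrow_eqs)

lemma is_functor_V: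
  "is_functor (catalan i \<times>\<^sub>C catalan j \<times>\<^sub>C catalan k \<times>\<^sub>C indisc UNIV) (catalan (i + j + k))
     (V_functor i j k)"
proof (rule is_functorI, goal_cases)
  case (9 x)
  obtain f g h b where "x = (f, g, h, b)" by (cases x)
  with 9 show ?case by (cases b) (simp_all add: V_functor_def Let_def arrow_eqs)
qed (simp_all add: split_paired_all category_prod category_catalan category_indisc V_functor_def Let_def
  leaves_acod arrow_eqs)

lemma is_functor_incl: "is_functor (coprod_V (disc UNIV) n) (coprod_V (indisc UNIV) n) (incl_functor n)"
  unfolding coprod_V_def incl_functor_def
proof (rule is_functorI, goal_cases)
  case 1 then show ?case
    by (auto intro!: category_coprod category_prod category_catalan category_disc)
next
  case 2 then show ?case
    by (auto intro!: category_coprod category_prod category_catalan category_indisc)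
qed (simp_all add: split_paired_all Id_on_iff id_functor_def leaves_acod)

lemma is_functor_W: "is_functor (coprod_V (disc UNIV) n) (coprod_U n) (W_functor n)"
  unfolding coprod_V_def coprod_U_def
proof (rule is_functorI, goal_cases)
  case 1 then show ?case
    by (auto intro!: category_coprod category_prod category_catalan category_disc)
next
  case 2 then show ?case
    by (auto intro!: category_coprod category_prod category_catalan)
qed (simp_all add: split_paired_all Id_on_iff W_functor_def coprod_V_def Let_def triples_def pairs_def
  leaves_acod arrow_eqs)

lemma is_functor_copair:
  assumes "\<And>i. i \<in> I \<Longrightarrow> is_functor (C i) D (F i)" "category D"
  shows "is_functor (coprod_cat I C) D (copair (coprod_cat I C) F)"
proof (rule is_functorI, goal_cases)
  case 1
  then show ?case using is_functorD[OF assms(1)] by (auto intro!: category_coprod)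
next
  case (10 g f)
  moreover obtain i g' j f' where "g = (i, g')" "f = (j, f')" by (cases g; cases f)
  ultimately have *: "g = (i, g')" "f = (i, f')" "i \<in> I" "composable (C i) g' f'" by auto
  then have "g' \<in> Arr (C i)" "f' \<in> Arr (C i)" by (auto simp: composable_def)
  with * show ?case
    using is_functorD(10)[OF assms(1) *(4)] is_functorD(1)[OF assms(1)]
    by (simp add: copair_def categoryD)
qed (use is_functorD[OF assms(1)] assms(2) in \<open>auto simp: copair_def categoryD\<close>)

definition coprod_U_functor where
  "coprod_U_functor n = copair (coprod_U n) (\<lambda>(a, b). U_functor a b)"

definition coprod_V_functor where
  "coprod_V_functor n = copair (coprod_V (indisc UNIV) n) (\<lambda>(i, j, k). V_functor i j k)"

lemma is_functor_coprod_U: "is_functor (coprod_U n) (catalan n) (coprod_U_functor n)"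
  unfolding coprod_U_def coprod_U_functor_def
  using is_functor_U by (intro is_functor_copair category_catalan) (auto simp: pairs_def)

lemma is_functor_coprod_V: "is_functor (coprod_V (indisc UNIV) n) (catalan n) (coprod_V_functor n)"
  unfolding coprod_V_def coprod_V_functor_def
  using is_functor_V by (intro is_functor_copair category_catalan) (auto simp: triples_def)

lemma coprod_UV_simps [simp]:
  "Obj (coprod_U n) = {((a, b), (f, g)). 1 \<le> a \<and> 1 \<le> b \<and> a + b = n \<and> leaves f = a \<and> leaves g = b}"
  "Arr (coprod_U n) = {((a, b), (\<phi>, \<psi>)). 1 \<le> a \<and> 1 \<le> b \<and> a + b = n \<and>
     avalid \<phi> \<and> leaves (adom \<phi>) = a \<and> avalid \<psi> \<and> leaves (adom \<psi>) = b}"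
  "Obj (coprod_V E n) = {((i, j, k), (f, g, h, x)). 1 \<le> i \<and> 1 \<le> j \<and> 1 \<le> k \<and> i + j + k = n \<and>
     leaves f = i \<and> leaves g = j \<and> leaves h = k \<and> x \<in> Obj E}"
  "Arr (coprod_V E n) = {((i, j, k), (\<phi>, \<psi>, \<chi>, e)). 1 \<le> i \<and> 1 \<le> j \<and> 1 \<le> k \<and> i + j + k = n \<and>
     avalid \<phi> \<and> leaves (adom \<phi>) = i \<and> avalid \<psi> \<and> leaves (adom \<psi>) = j \<and>
     avalid \<chi> \<and> leaves (adom \<chi>) = k \<and> e \<in> Arr E}"
  by (auto simp: coprod_U_def coprod_V_def pairs_def triples_def)

lemma abs_simps:
  "adom (abs_catalan_arrow t) = tdom t" "acod (abs_catalan_arrow t) = tcod t"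
  "avalid (abs_catalan_arrow t) = tvalid t"
  "abs_catalan_arrow (tid f) = aid f"
  "abs_catalan_arrow (TU s t) = aU (abs_catalan_arrow s) (abs_catalan_arrow t)"
  "abs_catalan_arrow (TV r s t e) = aV (abs_catalan_arrow r) (abs_catalan_arrow s) (abs_catalan_arrow t) e"
  "abs_catalan_arrow (TComp s t) = acomp (abs_catalan_arrow s) (abs_catalan_arrow t)"
  by (simp_all add: adom.abs_eq acod.abs_eq avalid.abs_eq aid.abs_eq aU.abs_eq aV.abs_eq acomp.abs_eq)

lemma rep_arrow: "rep_catalan_arrow (abs_catalan_arrow t) \<approx> t"
  by (simp add: catalan_arrow.abs_eq_iff[symmetric] Quotient_abs_rep[OF Quotient_catalan_arrow])

lemma arrow_absE:
  obtains t where "\<phi> = abs_catalan_arrow t"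
  by (metis Quotient_abs_rep[OF Quotient_catalan_arrow])

fun induced_obj where
  "induced_obj q Leaf = undefined"
| "induced_obj q (Node f g) = OMap q ((leaves f, leaves g), (f, g))"

fun induced_arr where
  "induced_arr T p q TOne = undefined"
| "induced_arr T p q (TU s t) =
     AMap q ((leaves (tdom s), leaves (tdom t)), (abs_catalan_arrow s, abs_catalan_arrow t))"
| "induced_arr T p q (TV r s t e) =
     AMap p ((leaves (tdom r), leaves (tdom s), leaves (tdom t)),
             (abs_catalan_arrow r, abs_catalan_arrow s, abs_catalan_arrow t, e))"
| "induced_arr T p q (TComp s t) = Comp T (induced_arr T p q s) (induced_arr T p q t)"

context
  fixes n :: nat and T :: "('t, 'u) category"
    and p :: "((nat \<times> nat \<times> nat) \<times> tree \<times> tree \<times> tree \<times> bool,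
      (nat \<times> nat \<times> nat) \<times> catalan_arrow \<times> catalan_arrow \<times> catalan_arrow \<times> bool \<times> bool, 't, 'u) functor_maps"
    and q :: "((nat \<times> nat) \<times> tree \<times> tree, (nat \<times> nat) \<times> catalan_arrow \<times> catalan_arrow, 't, 'u) functor_maps"
  assumes n: "2 \<le> n"
    and p: "is_functor (coprod_V (indisc UNIV) n) T p"
    and q: "is_functor (coprod_U n) T q"
    and pq: "comp_functor (coprod_V (disc UNIV) n) p (incl_functor n) =
      comp_functor (coprod_V (disc UNIV) n) q (W_functor n)"
begin

lemma leaves_neq_Leaf: "leaves f = n \<Longrightarrow> f \<noteq> Leaf"
  using n by auto

lemma p_bracket_obj:
  assumes "leaves f + leaves g + leaves h = n"
  shows "OMap p ((leaves f, leaves g, leaves h), (f, g, h, x)) = induced_obj q (bracket x f g h)"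
proof -
  let ?v = "((leaves f, leaves g, leaves h), (f, g, h, x))"
  have "?v \<in> Obj (coprod_V (disc UNIV) n)" using assms by (simp add: Suc_le_eq)
  moreover have "OMap (comp_functor (coprod_V (disc UNIV) n) p (incl_functor n)) ?v =
      OMap (comp_functor (coprod_V (disc UNIV) n) q (W_functor n)) ?v"
    by (simp only: pq)
  ultimately show ?thesis
    by (cases x) (simp_all add: comp_functor_def incl_functor_def id_functor_def W_functor_def Let_def compose_def)
qed

lemma p_bracket_arr:
  assumes "leaves (adom \<phi>) + leaves (adom \<psi>) + leaves (adom \<chi>) = n" "avalid \<phi>" "avalid \<psi>" "avalid \<chi>"
  shows "AMap p ((leaves (adom \<phi>), leaves (adom \<psi>), leaves (adom \<chi>)), (\<phi>, \<psi>, \<chi>, (False, False))) =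
      AMap q ((leaves (adom \<phi>), leaves (adom \<psi>) + leaves (adom \<chi>)), (\<phi>, aU \<psi> \<chi>))"
    and "AMap p ((leaves (adom \<phi>), leaves (adom \<psi>), leaves (adom \<chi>)), (\<phi>, \<psi>, \<chi>, (True, True))) =
      AMap q ((leaves (adom \<phi>) + leaves (adom \<psi>), leaves (adom \<chi>)), (aU \<phi> \<psi>, \<chi>))"
proof -
  let ?v = "\<lambda>x. ((leaves (adom \<phi>), leaves (adom \<psi>), leaves (adom \<chi>)), (\<phi>, \<psi>, \<chi>, (x, x)))"
  have v: "?v x \<in> Arr (coprod_V (disc UNIV) n)" for x
    using assms by (simp add: Suc_le_eq Id_on_iff)
  have "AMap (comp_functor (coprod_V (disc UNIV) n) p (incl_functor n)) (?v x) =
      AMap (comp_functor (coprod_V (disc UNIV) n) q (W_functor n)) (?v x)" for x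
    by (simp only: pq)
  from this[of False] this[of True] v[of False] v[of True]
  show "AMap p (?v False) = AMap q ((leaves (adom \<phi>), leaves (adom \<psi>) + leaves (adom \<chi>)), (\<phi>, aU \<psi> \<chi>))"
    and "AMap p (?v True) = AMap q ((leaves (adom \<phi>) + leaves (adom \<psi>), leaves (adom \<chi>)), (aU \<phi> \<psi>, \<chi>))"
    by (simp_all only: comp_functor_def incl_functor_def id_functor_def W_functor_def Let_def compose_def
        functor_maps.simps restrict_apply prod.case fst_conv if_True if_False)
qed

lemma q_arr:
  assumes "avalid \<phi>" "avalid \<psi>" "leaves (adom \<phi>) = a" "leaves (adom \<psi>) = b" "a + b = n"
  shows "AMap q ((a, b), (\<phi>, \<psi>)) \<in> Arr T"
    and "Dom T (AMap q ((a, b), (\<phi>, \<psi>))) = induced_obj q (Node (adom \<phi>) (adom \<psi>))"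
    and "Cod T (AMap q ((a, b), (\<phi>, \<psi>))) = induced_obj q (Node (acod \<phi>) (acod \<psi>))"
proof -
  have v: "((a, b), (\<phi>, \<psi>)) \<in> Arr (coprod_U n)"
    using assms by (auto simp: Suc_le_eq)
  then show "AMap q ((a, b), (\<phi>, \<psi>)) \<in> Arr T"
    by (rule is_functorD(6)[OF q])
  have ab: "(a, b) \<in> pairs n" using assms by (auto simp: pairs_def Suc_le_eq)
  have "Dom (coprod_U n) ((a, b), (\<phi>, \<psi>)) = ((a, b), (adom \<phi>, adom \<psi>))"
    "Cod (coprod_U n) ((a, b), (\<phi>, \<psi>)) = ((a, b), (acod \<phi>, acod \<psi>))"
    using assms(1-4) ab by (simp_all add: coprod_U_def)
  then show "Dom T (AMap q ((a, b), (\<phi>, \<psi>))) = induced_obj q (Node (adom \<phi>) (adom \<psi>))"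
    and "Cod T (AMap q ((a, b), (\<phi>, \<psi>))) = induced_obj q (Node (acod \<phi>) (acod \<psi>))"
    using is_functorD(7,8)[OF q v] assms(1-4) by (simp_all add: leaves_acod)
qed

lemma p_arr:
  assumes "avalid \<phi>" "avalid \<psi>" "avalid \<chi>"
    and "leaves (adom \<phi>) = i" "leaves (adom \<psi>) = j" "leaves (adom \<chi>) = k" "i + j + k = n"
  shows "AMap p ((i, j, k), (\<phi>, \<psi>, \<chi>, e)) \<in> Arr T"
    and "Dom T (AMap p ((i, j, k), (\<phi>, \<psi>, \<chi>, e))) =
      induced_obj q (bracket (fst e) (adom \<phi>) (adom \<psi>) (adom \<chi>))"
    and "Cod T (AMap p ((i, j, k), (\<phi>, \<psi>, \<chi>, e))) =
      induced_obj q (bracket (snd e) (acod \<phi>) (acod \<psi>) (acod \<chi>))"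
proof -
  have v: "((i, j, k), (\<phi>, \<psi>, \<chi>, e)) \<in> Arr (coprod_V (indisc UNIV) n)"
    using assms by (auto simp: Suc_le_eq)
  then show "AMap p ((i, j, k), (\<phi>, \<psi>, \<chi>, e)) \<in> Arr T"
    by (rule is_functorD(6)[OF p])
  have ijk: "(i, j, k) \<in> triples n" using assms by (auto simp: triples_def Suc_le_eq)
  have "Dom (coprod_V (indisc UNIV) n) ((i, j, k), (\<phi>, \<psi>, \<chi>, e)) =
      ((i, j, k), (adom \<phi>, adom \<psi>, adom \<chi>, fst e))"
    "Cod (coprod_V (indisc UNIV) n) ((i, j, k), (\<phi>, \<psi>, \<chi>, e)) =
      ((i, j, k), (acod \<phi>, acod \<psi>, acod \<chi>, snd e))"
    using assms(1-6) ijk by (cases e; simp add: coprod_V_def)+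
  then show "Dom T (AMap p ((i, j, k), (\<phi>, \<psi>, \<chi>, e))) =
      induced_obj q (bracket (fst e) (adom \<phi>) (adom \<psi>) (adom \<chi>))"
    and "Cod T (AMap p ((i, j, k), (\<phi>, \<psi>, \<chi>, e))) =
      induced_obj q (bracket (snd e) (acod \<phi>) (acod \<psi>) (acod \<chi>))"
    using is_functorD(7,8)[OF p v] assms
      p_bracket_obj[of "adom \<phi>" "adom \<psi>" "adom \<chi>"] p_bracket_obj[of "acod \<phi>" "acod \<psi>" "acod \<chi>"]
    by (simp_all add: leaves_acod)
qed

lemma q_comp:
  assumes "avalid (acomp \<phi> \<phi>')" "avalid (acomp \<psi> \<psi>')"
    and "leaves (adom \<phi>') = a" "leaves (adom \<psi>') = b" "a + b = n"
  shows "AMap q ((a, b), (acomp \<phi> \<phi>', acomp \<psi> \<psi>')) =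
    Comp T (AMap q ((a, b), (\<phi>, \<psi>))) (AMap q ((a, b), (\<phi>', \<psi>')))"
proof -
  have ab: "(a, b) \<in> pairs n" using assms by (auto simp: pairs_def Suc_le_eq)
  then have "composable (coprod_U n) ((a, b), (\<phi>, \<psi>)) ((a, b), (\<phi>', \<psi>'))"
    using assms(1-4) by (simp add: coprod_U_def)
  from is_functorD(10)[OF q this] show ?thesis
    using assms(1-4) ab by (simp add: coprod_U_def)
qed

lemma p_comp:
  assumes "avalid (acomp \<phi> \<phi>')" "avalid (acomp \<psi> \<psi>')" "avalid (acomp \<chi> \<chi>')"
    and "leaves (adom \<phi>') = i" "leaves (adom \<psi>') = j" "leaves (adom \<chi>') = k" "i + j + k = n"
  shows "AMap p ((i, j, k), (acomp \<phi> \<phi>', acomp \<psi> \<psi>', acomp \<chi> \<chi>', (x, z))) =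
    Comp T (AMap p ((i, j, k), (\<phi>, \<psi>, \<chi>, (y, z)))) (AMap p ((i, j, k), (\<phi>', \<psi>', \<chi>', (x, y))))"
proof -
  have ijk: "(i, j, k) \<in> triples n" using assms by (auto simp: triples_def Suc_le_eq)
  then have "composable (coprod_V (indisc UNIV) n)
      ((i, j, k), (\<phi>, \<psi>, \<chi>, (y, z))) ((i, j, k), (\<phi>', \<psi>', \<chi>', (x, y)))"
    using assms(1-6) by (simp add: coprod_V_def)
  from is_functorD(10)[OF p this] show ?thesis
    using assms(1-6) ijk by (simp add: coprod_V_def)
qed

lemma induced_arr_hom:
  assumes "tvalid t" "leaves (tdom t) = n"
  shows "induced_arr T p q t \<in> Arr T \<and> Dom T (induced_arr T p q t) = induced_obj q (tdom t) \<and>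
    Cod T (induced_arr T p q t) = induced_obj q (tcod t)"
  using assms
proof (induction t)
  case TOne
  then show ?case using n by simp
next
  case (TU s t)
  then show ?case
    using q_arr[of "abs_catalan_arrow s" "abs_catalan_arrow t"] by (simp add: abs_simps)
next
  case (TV r s t e)
  then show ?case
    using p_arr[of "abs_catalan_arrow r" "abs_catalan_arrow s" "abs_catalan_arrow t"]
    by (simp add: abs_simps)
next
  case (TComp s t)
  then have "leaves (tdom s) = n" by (simp add: leaves_tcod)
  with TComp have "composable T (induced_arr T p q s) (induced_arr T p q t)"
    by (simp add: composable_def)
  with TComp \<open>leaves (tdom s) = n\<close> show ?case
    using categoryD[OF is_functorD(2)[OF q]] by simp
qed

lemma induced_arr_tid: "leaves f = n \<Longrightarrow> induced_arr T p q (tid f) = Id T (induced_obj q f)"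
proof (cases f)
  case Leaf
  then show "leaves f = n \<Longrightarrow> ?thesis" using n by simp
next
  case (Node g h)
  assume f: "leaves f = n"
  with Node have ab: "(leaves g, leaves h) \<in> pairs n" by (auto simp: pairs_def Suc_le_eq)
  then have "((leaves g, leaves h), (g, h)) \<in> Obj (coprod_U n)"
    using Node f by (simp add: coprod_U_def)
  from is_functorD(9)[OF q this] show ?thesis
    using Node ab by (simp add: abs_simps) (simp add: coprod_U_def)
qed

lemma composable_induced:
  assumes "tvalid (TComp s t)" "leaves (tdom t) = n"
  shows "composable T (induced_arr T p q s) (induced_arr T p q t)"
  using assms induced_arr_hom[of s] induced_arr_hom[of t] leaves_tcod[of t]
  by (auto simp: composable_def)

lemma induced_arr_teq:
  assumes "s \<approx> t" "tvalid s" "leaves (tdom s) = n"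
  shows "induced_arr T p q s = induced_arr T p q t"
  using assms
proof (induction rule: teq.induct)
  case (teq_sym s t)
  then show ?case using teq_invariants[OF teq_sym(1)] by simp
next
  case (teq_trans r s t)
  then show ?case using teq_invariants[OF teq_trans(1)] by simp
next
  case (cong_U s s' t t')
  then have "abs_catalan_arrow s = abs_catalan_arrow s'" "abs_catalan_arrow t = abs_catalan_arrow t'"
    by (simp_all add: catalan_arrow.abs_eq_iff)
  with cong_U show ?case
    using teq_invariants[OF cong_U(1)] teq_invariants[OF cong_U(2)] by simp
next
  case (cong_V r r' s s' t t' e)
  then have "abs_catalan_arrow r = abs_catalan_arrow r'" "abs_catalan_arrow s = abs_catalan_arrow s'"
    "abs_catalan_arrow t = abs_catalan_arrow t'"
    by (simp_all add: catalan_arrow.abs_eq_iff)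
  with cong_V show ?case
    using teq_invariants[OF cong_V(1)] teq_invariants[OF cong_V(2)] teq_invariants[OF cong_V(3)] by simp
next
  case (cong_Comp s s' t t')
  then show ?case by (simp add: leaves_tcod)
next
  case (id_left t)
  then have "leaves (tcod t) = n" by (simp add: leaves_tcod)
  then show ?case
    using id_left induced_arr_hom[of t] categoryD(10)[OF is_functorD(2)[OF q], of "induced_arr T p q t"]
    by (simp add: induced_arr_tid)
next
  case (id_right t)
  then show ?case
    using induced_arr_hom[of t] categoryD(9)[OF is_functorD(2)[OF q], of "induced_arr T p q t"]
    by (simp add: induced_arr_tid)
next
  case (comp_assoc r s t)
  then show ?case
    using composable_induced[of r s] composable_induced[of s t] leaves_tcod[of t]
      categoryD(11)[OF is_functorD(2)[OF q]] by simp
next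
  case (funct_U s s' t t')
  then show ?case
    using q_comp[of "abs_catalan_arrow s" "abs_catalan_arrow s'" "abs_catalan_arrow t" "abs_catalan_arrow t'"]
    by (simp add: abs_simps leaves_tcod)
next
  case (funct_V r r' s s' t t' y z x)
  then show ?case
    using p_comp[of "abs_catalan_arrow r" "abs_catalan_arrow r'" "abs_catalan_arrow s" "abs_catalan_arrow s'"
      "abs_catalan_arrow t" "abs_catalan_arrow t'"]
    by (simp add: abs_simps leaves_tcod)
next
  case (V_id0 r s t)
  then show ?case
    using p_bracket_arr(1)[of "abs_catalan_arrow r" "abs_catalan_arrow s" "abs_catalan_arrow t"]
    by (simp add: abs_simps)
next
  case (V_id1 r s t)
  then show ?case
    using p_bracket_arr(2)[of "abs_catalan_arrow r" "abs_catalan_arrow s" "abs_catalan_arrow t"]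
    by (simp add: abs_simps)
qed simp_all

lemma induced_arr_rep_abs:
  assumes "tvalid t" "leaves (tdom t) = n"
  shows "induced_arr T p q (rep_catalan_arrow (abs_catalan_arrow t)) = induced_arr T p q t"
proof -
  show ?thesis
    using assms rep_arrow[of t] teq_invariants[OF rep_arrow[of t]] by (intro induced_arr_teq) simp_all
qed

lemma valid_arrowE:
  assumes "avalid \<phi>" "leaves (adom \<phi>) = n"
  obtains t where "\<phi> = abs_catalan_arrow t" "tvalid t" "leaves (tdom t) = n"
  using assms by (metis Quotient_abs_rep[OF Quotient_catalan_arrow] abs_simps(1,3))

definition induced :: "(tree, catalan_arrow, 't, 'u) functor_maps" where
  "induced = \<lparr>OMap = restrict (induced_obj q) (Obj (catalan n)),
     AMap = restrict (\<lambda>\<phi>. induced_arr T p q (rep_catalan_arrow \<phi>)) (Arr (catalan n))\<rparr>"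

lemma AMap_induced:
  "tvalid t \<Longrightarrow> leaves (tdom t) = n \<Longrightarrow> AMap induced (abs_catalan_arrow t) = induced_arr T p q t"
  by (simp add: induced_def induced_arr_rep_abs abs_simps)

lemma OMap_induced: "leaves f = n \<Longrightarrow> OMap induced f = induced_obj q f"
  by (simp add: induced_def)

lemma is_functor_induced: "is_functor (catalan n) T induced"
proof (rule is_functorI)
  show "category (catalan n)" by (rule category_catalan)
  show "category T" by (rule is_functorD(2)[OF q])
  show "OMap induced \<in> extensional (Obj (catalan n))" "AMap induced \<in> extensional (Arr (catalan n))"
    by (simp_all add: induced_def)
next
  fix f assume "f \<in> Obj (catalan n)"
  then have f: "leaves f = n" by simp
  then obtain g h where gh: "f = Node g h" using n by (cases f) auto
  with f have "((leaves g, leaves h), (g, h)) \<in> Obj (coprod_U n)"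
    by (simp add: Suc_le_eq)
  from is_functorD(5)[OF q this] show "OMap induced f \<in> Obj T"
    using f gh by (simp add: OMap_induced)
  have "AMap induced (abs_catalan_arrow (tid f)) = Id T (OMap induced f)"
    using f by (subst AMap_induced) (simp_all add: induced_arr_tid OMap_induced)
  then show "AMap induced (Id (catalan n) f) = Id T (OMap induced f)"
    using f by (simp add: abs_simps)
next
  fix \<phi> assume "\<phi> \<in> Arr (catalan n)"
  then have "avalid \<phi>" "leaves (adom \<phi>) = n" by simp_all
  then obtain t where t: "\<phi> = abs_catalan_arrow t" "tvalid t" "leaves (tdom t) = n"
    by (rule valid_arrowE)
  then show "AMap induced \<phi> \<in> Arr T" "Dom T (AMap induced \<phi>) = OMap induced (Dom (catalan n) \<phi>)"
    "Cod T (AMap induced \<phi>) = OMap induced (Cod (catalan n) \<phi>)"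
    using induced_arr_hom[of t]
    by (simp_all add: AMap_induced OMap_induced abs_simps leaves_tcod)
next
  fix \<psi> \<phi> assume *: "composable (catalan n) \<psi> \<phi>"
  then have "avalid \<phi>" "leaves (adom \<phi>) = n" "avalid \<psi>" "leaves (adom \<psi>) = n"
    by (simp_all add: leaves_acod)
  obtain t where t: "\<phi> = abs_catalan_arrow t" "tvalid t" "leaves (tdom t) = n"
    using \<open>avalid \<phi>\<close> \<open>leaves (adom \<phi>) = n\<close> by (rule valid_arrowE)
  obtain s where s: "\<psi> = abs_catalan_arrow s" "tvalid s" "leaves (tdom s) = n"
    using \<open>avalid \<psi>\<close> \<open>leaves (adom \<psi>) = n\<close> by (rule valid_arrowE)
  note st = s t
  with * have "tvalid (TComp s t)" "leaves (tdom (TComp s t)) = n" by (simp_all add: abs_simps)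
  from AMap_induced[OF this] st *
  show "AMap induced (Comp (catalan n) \<psi> \<phi>) = Comp T (AMap induced \<psi>) (AMap induced \<phi>)"
    by (simp add: AMap_induced) (simp add: abs_simps)
qed

lemma induced_U: "comp_functor (coprod_U n) induced (coprod_U_functor n) = q"
proof -
  have "compose (Obj (coprod_U n)) (OMap induced) (OMap (coprod_U_functor n)) = OMap q"
  proof (rule extensionalityI[of _ "Obj (coprod_U n)"])
    show "OMap q \<in> extensional (Obj (coprod_U n))" by (rule is_functorD(3)[OF q])
  next
    fix v assume v: "v \<in> Obj (coprod_U n)"
    then obtain f g where "v = ((leaves f, leaves g), (f, g))" "leaves f + leaves g = n" by auto
    with v show "compose (Obj (coprod_U n)) (OMap induced) (OMap (coprod_U_functor n)) v = OMap q v"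
      by (simp add: compose_def coprod_U_functor_def copair_def U_functor_def OMap_induced)
  qed (rule compose_extensional)
  moreover have "compose (Arr (coprod_U n)) (AMap induced) (AMap (coprod_U_functor n)) = AMap q"
  proof (rule extensionalityI[of _ "Arr (coprod_U n)"])
    show "AMap q \<in> extensional (Arr (coprod_U n))" by (rule is_functorD(4)[OF q])
  next
    fix v assume v: "v \<in> Arr (coprod_U n)"
    then obtain a b \<phi> \<psi> where ab: "v = ((a, b), (\<phi>, \<psi>))" "leaves (adom \<phi>) = a" "leaves (adom \<psi>) = b"
      "avalid \<phi>" "avalid \<psi>" "a + b = n" by auto
    obtain s t where st: "\<phi> = abs_catalan_arrow s" "\<psi> = abs_catalan_arrow t"
      by (metis Quotient_abs_rep[OF Quotient_catalan_arrow])
    have "AMap induced (aU \<phi> \<psi>) = AMap q v"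
      using AMap_induced[of "TU s t"] ab st by (simp add: abs_simps)
    then show "compose (Arr (coprod_U n)) (AMap induced) (AMap (coprod_U_functor n)) v = AMap q v"
      using v ab by (simp add: compose_def coprod_U_functor_def copair_def U_functor_def)
  qed (rule compose_extensional)
  ultimately show ?thesis by (simp add: comp_functor_def)
qed

lemma induced_V: "comp_functor (coprod_V (indisc UNIV) n) induced (coprod_V_functor n) = p"
proof -
  let ?L = "coprod_V (indisc (UNIV :: bool set)) n"
  have "compose (Obj ?L) (OMap induced) (OMap (coprod_V_functor n)) = OMap p"
  proof (rule extensionalityI[of _ "Obj ?L"])
    show "OMap p \<in> extensional (Obj ?L)" by (rule is_functorD(3)[OF p])
  next
    fix v assume v: "v \<in> Obj ?L"
    then obtain f g h x where *: "v = ((leaves f, leaves g, leaves h), (f, g, h, x))"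
      "leaves f + leaves g + leaves h = n" by auto
    with v show "compose (Obj ?L) (OMap induced) (OMap (coprod_V_functor n)) v = OMap p v"
      using p_bracket_obj[of f g h x]
      by (simp add: compose_def coprod_V_functor_def copair_def V_functor_def OMap_induced Let_def)
  qed (rule compose_extensional)
  moreover have "compose (Arr ?L) (AMap induced) (AMap (coprod_V_functor n)) = AMap p"
  proof (rule extensionalityI[of _ "Arr ?L"])
    show "AMap p \<in> extensional (Arr ?L)" by (rule is_functorD(4)[OF p])
  next
    fix v assume v: "v \<in> Arr ?L"
    then obtain i j k \<phi> \<psi> \<chi> e where ijk: "v = ((i, j, k), (\<phi>, \<psi>, \<chi>, e))"
      "leaves (adom \<phi>) = i" "leaves (adom \<psi>) = j" "leaves (adom \<chi>) = k"
      "avalid \<phi>" "avalid \<psi>" "avalid \<chi>" "i + j + k = n" by auto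
    obtain r s t where rst: "\<phi> = abs_catalan_arrow r" "\<psi> = abs_catalan_arrow s" "\<chi> = abs_catalan_arrow t"
      by (metis Quotient_abs_rep[OF Quotient_catalan_arrow])
    have "AMap induced (aV \<phi> \<psi> \<chi> e) = AMap p v"
      using AMap_induced[of "TV r s t e"] ijk rst by (simp add: abs_simps)
    then show "compose (Arr ?L) (AMap induced) (AMap (coprod_V_functor n)) v = AMap p v"
      using v ijk by (cases e) (simp add: compose_def coprod_V_functor_def copair_def V_functor_def Let_def)
  qed (rule compose_extensional)
  ultimately show ?thesis by (simp add: comp_functor_def)
qed

lemma induced_unique:
  assumes h: "is_functor (catalan n) T h"
    and hV: "comp_functor (coprod_V (indisc UNIV) n) h (coprod_V_functor n) = p"
    and hU: "comp_functor (coprod_U n) h (coprod_U_functor n) = q"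
  shows "h = (induced :: (tree, catalan_arrow, 't, 'u) functor_maps)"
proof -
  have "OMap h f = OMap induced f" if "leaves f = n" for f
  proof -
    obtain g k where gk: "f = Node g k" using n \<open>leaves f = n\<close> by (cases f) auto
    then have v: "((leaves g, leaves k), (g, k)) \<in> Obj (coprod_U n)"
      using that by (simp add: Suc_le_eq)
    have "OMap q ((leaves g, leaves k), (g, k)) = OMap h (Node g k)"
      using v unfolding hU[symmetric]
      by (simp add: comp_functor_def compose_def coprod_U_functor_def copair_def U_functor_def)
    then show ?thesis using gk that by (simp add: OMap_induced)
  qed
  then have O: "OMap h = OMap induced"
    using is_functorD(3)[OF h] is_functorD(3)[OF is_functor_induced]
    by (intro extensionalityI[of _ "Obj (catalan n)"]) auto
  have "AMap h (abs_catalan_arrow t) = induced_arr T p q t" if "tvalid t" "leaves (tdom t) = n" for t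
    using that
  proof (induction t)
    case TOne
    then show ?case using n by simp
  next
    case (TU s t)
    let ?v = "((leaves (tdom s), leaves (tdom t)), (abs_catalan_arrow s, abs_catalan_arrow t))"
    have v: "?v \<in> Arr (coprod_U n)"
      using TU.prems by (simp add: abs_simps Suc_le_eq)
    have "AMap q ?v = AMap h (aU (abs_catalan_arrow s) (abs_catalan_arrow t))"
      using v unfolding hU[symmetric]
      by (simp add: comp_functor_def compose_def coprod_U_functor_def copair_def U_functor_def)
    then show ?case by (simp add: abs_simps)
  next
    case (TV r s t e)
    let ?v = "((leaves (tdom r), leaves (tdom s), leaves (tdom t)),
      (abs_catalan_arrow r, abs_catalan_arrow s, abs_catalan_arrow t, e))"
    have v: "?v \<in> Arr (coprod_V (indisc UNIV) n)"
      using TV.prems by (simp add: abs_simps Suc_le_eq)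
    have "AMap p ?v = AMap h (aV (abs_catalan_arrow r) (abs_catalan_arrow s) (abs_catalan_arrow t) e)"
      using v unfolding hV[symmetric]
      by (cases e) (simp add: comp_functor_def compose_def coprod_V_functor_def copair_def V_functor_def Let_def)
    then show ?case by (simp add: abs_simps)
  next
    case (TComp s t)
    then have "leaves (tdom s) = n" by (simp add: leaves_tcod)
    moreover have "composable (catalan n) (abs_catalan_arrow s) (abs_catalan_arrow t)"
      using TComp.prems by (simp add: abs_simps)
    from is_functorD(10)[OF h this] have
      "AMap h (abs_catalan_arrow (TComp s t)) = Comp T (AMap h (abs_catalan_arrow s)) (AMap h (abs_catalan_arrow t))"
      using TComp.prems by (simp add: abs_simps)
    ultimately show ?case using TComp by simp
  qed
  note h_abs = this
  have "AMap h \<phi> = AMap induced \<phi>" if "\<phi> \<in> Arr (catalan n)" for \<phi>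
  proof -
    have "avalid \<phi>" "leaves (adom \<phi>) = n" using that by simp_all
    then obtain t where "\<phi> = abs_catalan_arrow t" "tvalid t" "leaves (tdom t) = n"
      by (rule valid_arrowE)
    then show ?thesis using h_abs AMap_induced by simp
  qed
  then have "AMap h = AMap induced"
    using is_functorD(4)[OF h] is_functorD(4)[OF is_functor_induced]
    by (intro extensionalityI[of _ "Arr (catalan n)"]) auto
  with O show ?thesis by simp
qed

end

theorem catalan_pushout:
  assumes "2 \<le> n"
  shows "pushout_at T (coprod_V (indisc UNIV) n) (coprod_V (disc UNIV) n) (coprod_U n) (catalan n)
    (incl_functor n) (W_functor n) (coprod_V_functor n) (coprod_U_functor n)"
proof -
  let ?M = "coprod_V (disc (UNIV :: bool set)) n"
  have "OMap (comp_functor ?M (coprod_V_functor n) (incl_functor n)) =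
      OMap (comp_functor ?M (coprod_U_functor n) (W_functor n))"
  proof (rule extensionalityI[of _ "Obj ?M"])
    fix v assume v: "v \<in> Obj ?M"
    then obtain i j k f g h x where "v = ((i, j, k), (f, g, h, x))" by (cases v) auto
    with v show "OMap (comp_functor ?M (coprod_V_functor n) (incl_functor n)) v =
        OMap (comp_functor ?M (coprod_U_functor n) (W_functor n)) v"
      by (cases x) (auto simp: comp_functor_def compose_def coprod_V_functor_def coprod_U_functor_def
        copair_def V_functor_def U_functor_def incl_functor_def id_functor_def W_functor_def Let_def)
  qed (simp_all add: comp_functor_def)
  moreover have "AMap (comp_functor ?M (coprod_V_functor n) (incl_functor n)) =
      AMap (comp_functor ?M (coprod_U_functor n) (W_functor n))"
  proof (rule extensionalityI[of _ "Arr ?M"])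
    fix v assume v: "v \<in> Arr ?M"
    then obtain i j k \<phi> \<psi> \<chi> x where "v = ((i, j, k), (\<phi>, \<psi>, \<chi>, (x, x)))" by (cases v) auto
    with v show "AMap (comp_functor ?M (coprod_V_functor n) (incl_functor n)) v =
        AMap (comp_functor ?M (coprod_U_functor n) (W_functor n)) v"
      by (cases x) (simp_all add: comp_functor_def compose_def coprod_V_functor_def coprod_U_functor_def
        copair_def V_functor_def U_functor_def incl_functor_def id_functor_def W_functor_def Let_def
        arrow_eqs Id_on_iff)
  qed (simp_all add: comp_functor_def)
  ultimately have "comp_functor ?M (coprod_V_functor n) (incl_functor n) =
      comp_functor ?M (coprod_U_functor n) (W_functor n)"
    by simp
  moreover have "\<exists>!h :: (tree, catalan_arrow, 'a, 'b) functor_maps. is_functor (catalan n) T h \<and>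
      comp_functor (coprod_V (indisc UNIV) n) h (coprod_V_functor n) = p \<and>
      comp_functor (coprod_U n) h (coprod_U_functor n) = q"
    if "is_functor (coprod_V (indisc UNIV) n) T p" "is_functor (coprod_U n) T q"
      "comp_functor ?M p (incl_functor n) = comp_functor ?M q (W_functor n)" for p q
    using is_functor_induced[OF assms that] induced_U[OF assms that] induced_V[OF assms that]
      induced_unique[OF assms that] by (intro ex1I[of _ "induced n T p q"]) blast+
  ultimately show ?thesis
    unfolding pushout_at_def
    by (intro conjI allI impI is_functor_incl is_functor_W is_functor_coprod_V is_functor_coprod_U) blast+
qed


section \<open>The substitution functors\<close>

text \<open>
  The indices \<open>n\<close>, \<open>t\<close>, \<open>\<pi>\<close> of \<open>Q\<close> are determined by the number of leaves of the arguments.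
\<close>

fun subst_obj :: "tree \<Rightarrow> tree list \<Rightarrow> tree" where
  "subst_obj Leaf gs = hd gs"
| "subst_obj (Node f1 f2) gs =
     Node (subst_obj f1 (take (leaves f1) gs)) (subst_obj f2 (drop (leaves f1) gs))"

fun subst_term :: "arrow_term \<Rightarrow> catalan_arrow list \<Rightarrow> catalan_arrow" where
  "subst_term TOne \<gamma>s = hd \<gamma>s"
| "subst_term (TU s t) \<gamma>s =
     aU (subst_term s (take (leaves (tdom s)) \<gamma>s)) (subst_term t (drop (leaves (tdom s)) \<gamma>s))"
| "subst_term (TV r s t e) \<gamma>s =
     aV (subst_term r (take (leaves (tdom r)) \<gamma>s))
        (subst_term s (take (leaves (tdom s)) (drop (leaves (tdom r)) \<gamma>s)))
        (subst_term t (drop (leaves (tdom r) + leaves (tdom s)) \<gamma>s)) e"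
| "subst_term (TComp s t) \<gamma>s = acomp (subst_term s \<gamma>s) (subst_term t (map (\<lambda>\<gamma>. aid (adom \<gamma>)) \<gamma>s))"

text \<open>
  By \<open>subst_term_teq\<close> below, the chosen representative does not matter; \<open>is_functor_Q\<close>
  and \<open>subst_arr_simps\<close> are the properties which determine \<open>Q\<close>.
\<close>

definition subst_arr :: "catalan_arrow \<Rightarrow> catalan_arrow list \<Rightarrow> catalan_arrow" where
  "subst_arr \<phi> \<gamma>s = subst_term (rep_catalan_arrow \<phi>) \<gamma>s"

definition Q_functor ::
  "nat \<Rightarrow> nat list \<Rightarrow> (tree \<times> tree list, catalan_arrow \<times> catalan_arrow list, tree, catalan_arrow) functor_maps" where
  "Q_functor n ms =
    (let C = catalan n \<times>\<^sub>C list_prod_cat (map catalan ms) in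
     \<lparr>OMap = restrict (\<lambda>(f, gs). subst_obj f gs) (Obj C),
      AMap = restrict (\<lambda>(\<phi>, \<gamma>s). subst_arr \<phi> \<gamma>s) (Arr C)\<rparr>)"

lemma subst_obj_bracket:
  "subst_obj (bracket b f g h) gs =
     bracket b (subst_obj f (take (leaves f) gs))
       (subst_obj g (take (leaves g) (drop (leaves f) gs)))
       (subst_obj h (drop (leaves f + leaves g) gs))"
  by (cases b) (simp_all add: drop_take add.commute min_absorb1)

abbreviation valid_args :: "tree \<Rightarrow> catalan_arrow list \<Rightarrow> bool" where
  "valid_args f \<gamma>s \<equiv> length \<gamma>s = leaves f \<and> list_all avalid \<gamma>s"

lemma list_all_take_drop:
  "list_all P xs \<Longrightarrow> list_all P (take k xs)" "list_all P xs \<Longrightarrow> list_all P (drop k xs)"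
  by (auto simp: list_all_iff dest: in_set_takeD in_set_dropD)

lemma list_all_aid [simp]: "list_all avalid (map (\<lambda>\<gamma>. aid (h \<gamma>)) \<gamma>s)"
  by (simp add: list_all_iff)

lemma length_oneE:
  assumes "length xs = Suc 0" obtains x where "xs = [x]"
  using assms by (auto simp: length_Suc_conv)

lemma subst_term_type:
  assumes "tvalid t" "valid_args (tdom t) \<gamma>s"
  shows "avalid (subst_term t \<gamma>s) \<and> adom (subst_term t \<gamma>s) = subst_obj (tdom t) (map adom \<gamma>s) \<and>
    acod (subst_term t \<gamma>s) = subst_obj (tcod t) (map acod \<gamma>s)"
  using assms
proof (induction t arbitrary: \<gamma>s)
  case TOne
  then show ?case by (auto elim!: length_oneE)
next
  case (TU s t)
  show ?case
    using TU.prems TU.IH(1)[of "take (leaves (tdom s)) \<gamma>s"] TU.IH(2)[of "drop (leaves (tdom s)) \<gamma>s"]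
    by (simp add: list_all_take_drop take_map drop_map leaves_tcod)
next
  case (TV r s t e)
  show ?case
    using TV.prems TV.IH(1)[of "take (leaves (tdom r)) \<gamma>s"]
      TV.IH(2)[of "take (leaves (tdom s)) (drop (leaves (tdom r)) \<gamma>s)"]
      TV.IH(3)[of "drop (leaves (tdom r) + leaves (tdom s)) \<gamma>s"]
    by (simp add: list_all_take_drop take_map drop_map leaves_tcod subst_obj_bracket)
next
  case (TComp s t)
  show ?case
    using TComp.prems TComp.IH(1)[of \<gamma>s] TComp.IH(2)[of "map (\<lambda>\<gamma>. aid (adom \<gamma>)) \<gamma>s"]
    by (simp add: leaves_tcod comp_def)
qed

lemma subst_term_tid:
  "length gs = leaves f \<Longrightarrow> subst_term (tid f) (map aid gs) = aid (subst_obj f gs)"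
proof (induction f arbitrary: gs)
  case Leaf
  then show ?case by (auto elim!: length_oneE)
qed (simp add: take_map drop_map)

lemma subst_term_left:
  assumes "tvalid t" "valid_args (tdom t) \<gamma>s"
  shows "subst_term t \<gamma>s =
    acomp (subst_term (tid (tcod t)) \<gamma>s) (subst_term t (map (\<lambda>\<gamma>. aid (adom \<gamma>)) \<gamma>s))"
  using assms
proof (induction t arbitrary: \<gamma>s)
  case TOne
  then show ?case by (auto elim!: length_oneE simp: arrow_eqs)
next
  case (TU s t)
  let ?i = "map (\<lambda>\<gamma>. aid (adom \<gamma>))"
  let ?a = "take (leaves (tdom s)) \<gamma>s" and ?b = "drop (leaves (tdom s)) \<gamma>s"
  have a: "valid_args (tdom s) ?a" and b: "valid_args (tdom t) ?b"
    using TU.prems by (simp_all add: list_all_take_drop)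
  then show ?case
    using TU.prems TU.IH(1)[OF _ a] TU.IH(2)[OF _ b] subst_term_type[of s ?a] subst_term_type[of t ?b]
      subst_term_type[of s "?i ?a"] subst_term_type[of t "?i ?b"]
      subst_term_type[of "tid (tcod s)" ?a] subst_term_type[of "tid (tcod t)" ?b]
    by (simp add: take_map drop_map leaves_tcod arrow_eqs(4) comp_def)
next
  case (TV r s t e)
  let ?i = "map (\<lambda>\<gamma>. aid (adom \<gamma>))"
  let ?a = "take (leaves (tdom r)) \<gamma>s" and ?b = "take (leaves (tdom s)) (drop (leaves (tdom r)) \<gamma>s)"
    and ?c = "drop (leaves (tdom r) + leaves (tdom s)) \<gamma>s"
  obtain x y where e: "e = (x, y)" by (cases e)
  have abc: "valid_args (tdom r) ?a" "valid_args (tdom s) ?b" "valid_args (tdom t) ?c"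
    using TV.prems by (simp_all add: list_all_take_drop)
  have *: "subst_term (tid (bracket y (tcod r) (tcod s) (tcod t))) \<gamma>s =
      aV (subst_term (tid (tcod r)) ?a) (subst_term (tid (tcod s)) ?b) (subst_term (tid (tcod t)) ?c) (y, y)"
    using TV.prems abc
      subst_term_type[of "tid (tcod r)" ?a] subst_term_type[of "tid (tcod s)" ?b]
      subst_term_type[of "tid (tcod t)" ?c]
    by (cases y) (simp_all add: leaves_tcod arrow_eqs(6,7) drop_take add.commute min_absorb1)
  show ?case
    using TV.prems TV.IH(1)[OF _ abc(1)] TV.IH(2)[OF _ abc(2)] TV.IH(3)[OF _ abc(3)] abc
      subst_term_type[of r ?a] subst_term_type[of s ?b] subst_term_type[of t ?c]
      subst_term_type[of r "?i ?a"] subst_term_type[of s "?i ?b"] subst_term_type[of t "?i ?c"]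
      subst_term_type[of "tid (tcod r)" ?a] subst_term_type[of "tid (tcod s)" ?b]
      subst_term_type[of "tid (tcod t)" ?c]
    by (simp add: e * take_map drop_map leaves_tcod arrow_eqs(5) comp_def)
next
  case (TComp s t)
  let ?i = "map (\<lambda>\<gamma>. aid (adom \<gamma>)) \<gamma>s"
  have s: "valid_args (tdom s) \<gamma>s" using TComp.prems by (simp add: leaves_tcod)
  show ?case
    using TComp.prems TComp.IH(1)[OF _ s] s subst_term_type[of s \<gamma>s] subst_term_type[of s ?i]
      subst_term_type[of t ?i] subst_term_type[of "tid (tcod s)" \<gamma>s]
    by (simp add: leaves_tcod comp_def arrow_eqs(3))
qed

lemma subst_term_teq:
  assumes "s \<approx> t" "tvalid s" "valid_args (tdom s) \<gamma>s"
  shows "subst_term s \<gamma>s = subst_term t \<gamma>s"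
  using assms
proof (induction arbitrary: \<gamma>s rule: teq.induct)
  case (teq_sym s t)
  then show ?case using teq_invariants[OF teq_sym(1)] by simp
next
  case (teq_trans r s t)
  then show ?case using teq_invariants[OF teq_trans(1)] by simp
next
  case (cong_U s s' t t')
  then show ?case
    using teq_invariants[OF cong_U(1)] teq_invariants[OF cong_U(2)] by (simp add: list_all_take_drop)
next
  case (cong_V r r' s s' t t' e)
  then show ?case
    using teq_invariants[OF cong_V(1)] teq_invariants[OF cong_V(2)] teq_invariants[OF cong_V(3)]
    by (simp add: list_all_take_drop)
next
  case (cong_Comp s s' t t')
  then show ?case by (simp add: leaves_tcod)
next
  case (id_left t)
  then show ?case using subst_term_left[of t \<gamma>s] by simp
next
  case (id_right t)
  then have "subst_term (tid (tdom t)) (map aid (map adom \<gamma>s)) = aid (subst_obj (tdom t) (map adom \<gamma>s))"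
    by (intro subst_term_tid) simp
  then show ?case using id_right subst_term_type[of t \<gamma>s] arrow_eqs(2)[of "subst_term t \<gamma>s"]
    by (simp add: comp_def)
next
  case (comp_assoc r s t)
  then show ?case
    using subst_term_type[of r \<gamma>s] subst_term_type[of s "map (\<lambda>\<gamma>. aid (adom \<gamma>)) \<gamma>s"]
      subst_term_type[of t "map (\<lambda>\<gamma>. aid (adom \<gamma>)) \<gamma>s"]
    by (simp add: leaves_tcod comp_def arrow_eqs(3))
next
  case (funct_U s s' t t')
  let ?i = "map (\<lambda>\<gamma>. aid (adom \<gamma>))"
  let ?a = "take (leaves (tdom s')) \<gamma>s" and ?b = "drop (leaves (tdom s')) \<gamma>s"
  have "valid_args (tdom s') ?a" "valid_args (tdom t') ?b"
    using funct_U.prems by (simp_all add: list_all_take_drop)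
  then show ?case
    using funct_U.prems funct_U.hyps subst_term_type[of s ?a] subst_term_type[of t ?b]
      subst_term_type[of s' "?i ?a"] subst_term_type[of t' "?i ?b"]
    by (simp add: take_map drop_map leaves_tcod arrow_eqs(4) comp_def)
next
  case (funct_V r r' s s' t t' y z x)
  let ?i = "map (\<lambda>\<gamma>. aid (adom \<gamma>))"
  let ?a = "take (leaves (tdom r')) \<gamma>s" and ?b = "take (leaves (tdom s')) (drop (leaves (tdom r')) \<gamma>s)"
    and ?c = "drop (leaves (tdom r') + leaves (tdom s')) \<gamma>s"
  have "valid_args (tdom r') ?a" "valid_args (tdom s') ?b" "valid_args (tdom t') ?c"
    using funct_V.prems by (simp_all add: list_all_take_drop)
  then show ?case
    using funct_V.prems funct_V.hyps subst_term_type[of r ?a] subst_term_type[of s ?b] subst_term_type[of t ?c]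
      subst_term_type[of r' "?i ?a"] subst_term_type[of s' "?i ?b"] subst_term_type[of t' "?i ?c"]
    by (simp add: take_map drop_map leaves_tcod arrow_eqs(5) comp_def)
next
  case (V_id0 r s t)
  let ?a = "take (leaves (tdom r)) \<gamma>s" and ?b = "take (leaves (tdom s)) (drop (leaves (tdom r)) \<gamma>s)"
    and ?c = "drop (leaves (tdom r) + leaves (tdom s)) \<gamma>s"
  have "valid_args (tdom r) ?a" "valid_args (tdom s) ?b" "valid_args (tdom t) ?c"
    using V_id0.prems by (simp_all add: list_all_take_drop)
  then show ?case
    using V_id0 subst_term_type[of r ?a] subst_term_type[of s ?b] subst_term_type[of t ?c]
    by (simp add: arrow_eqs(6) add.commute)
next
  case (V_id1 r s t)
  let ?a = "take (leaves (tdom r)) \<gamma>s" and ?b = "take (leaves (tdom s)) (drop (leaves (tdom r)) \<gamma>s)"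
    and ?c = "drop (leaves (tdom r) + leaves (tdom s)) \<gamma>s"
  have "valid_args (tdom r) ?a" "valid_args (tdom s) ?b" "valid_args (tdom t) ?c"
    using V_id1.prems by (simp_all add: list_all_take_drop)
  then show ?case
    using V_id1 subst_term_type[of r ?a] subst_term_type[of s ?b] subst_term_type[of t ?c]
    by (simp add: arrow_eqs(7) drop_take min_absorb1)
qed simp_all

lemma subst_arr_abs:
  assumes "tvalid t" "valid_args (tdom t) \<gamma>s"
  shows "subst_arr (abs_catalan_arrow t) \<gamma>s = subst_term t \<gamma>s"
  unfolding subst_arr_def using assms rep_arrow[of t] teq_invariants[OF rep_arrow[of t]]
  by (intro subst_term_teq) simp_all

lemma subst_arr_type [simp]:
  assumes "avalid \<phi>" "valid_args (adom \<phi>) \<gamma>s"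
  shows "avalid (subst_arr \<phi> \<gamma>s)" "adom (subst_arr \<phi> \<gamma>s) = subst_obj (adom \<phi>) (map adom \<gamma>s)"
    "acod (subst_arr \<phi> \<gamma>s) = subst_obj (acod \<phi>) (map acod \<gamma>s)"
proof -
  obtain t where "\<phi> = abs_catalan_arrow t" by (rule arrow_absE)
  then show "avalid (subst_arr \<phi> \<gamma>s)" "adom (subst_arr \<phi> \<gamma>s) = subst_obj (adom \<phi>) (map adom \<gamma>s)"
    "acod (subst_arr \<phi> \<gamma>s) = subst_obj (acod \<phi>) (map acod \<gamma>s)"
    using assms subst_term_type[of t \<gamma>s] by (simp_all add: abs_simps subst_arr_abs)
qed

lemma aid_Leaf: "aid Leaf = abs_catalan_arrow TOne"
  by (simp add: aid.abs_eq)

lemma subst_arr_simps: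
  "avalid \<gamma> \<Longrightarrow> subst_arr (aid Leaf) [\<gamma>] = \<gamma>"
  "avalid \<phi> \<Longrightarrow> avalid \<psi> \<Longrightarrow> length \<gamma>s = leaves (adom \<phi>) \<Longrightarrow> length \<delta>s = leaves (adom \<psi>) \<Longrightarrow>
     list_all avalid \<gamma>s \<Longrightarrow> list_all avalid \<delta>s \<Longrightarrow>
     subst_arr (aU \<phi> \<psi>) (\<gamma>s @ \<delta>s) = aU (subst_arr \<phi> \<gamma>s) (subst_arr \<psi> \<delta>s)"
  "avalid \<phi> \<Longrightarrow> avalid \<psi> \<Longrightarrow> avalid \<chi> \<Longrightarrow> length \<gamma>s = leaves (adom \<phi>) \<Longrightarrow> length \<delta>s = leaves (adom \<psi>) \<Longrightarrow>
     length \<epsilon>s = leaves (adom \<chi>) \<Longrightarrow> list_all avalid \<gamma>s \<Longrightarrow> list_all avalid \<delta>s \<Longrightarrow> list_all avalid \<epsilon>s \<Longrightarrow>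
     subst_arr (aV \<phi> \<psi> \<chi> e) (\<gamma>s @ \<delta>s @ \<epsilon>s) =
       aV (subst_arr \<phi> \<gamma>s) (subst_arr \<psi> \<delta>s) (subst_arr \<chi> \<epsilon>s) e"
  "length gs = leaves f \<Longrightarrow> subst_arr (aid f) (map aid gs) = aid (subst_obj f gs)"
proof -
  show "avalid \<gamma> \<Longrightarrow> subst_arr (aid Leaf) [\<gamma>] = \<gamma>"
    using subst_arr_abs[of TOne "[\<gamma>]"] by (simp add: aid_Leaf)
  show "length gs = leaves f \<Longrightarrow> subst_arr (aid f) (map aid gs) = aid (subst_obj f gs)"
    using subst_arr_abs[of "tid f" "map aid gs"] subst_term_tid[of gs f]
    by (simp add: abs_simps list_all_iff)
  obtain r s t where rst: "\<phi> = abs_catalan_arrow r" "\<psi> = abs_catalan_arrow s" "\<chi> = abs_catalan_arrow t"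
    by (metis Quotient_abs_rep[OF Quotient_catalan_arrow])
  show "subst_arr (aU \<phi> \<psi>) (\<gamma>s @ \<delta>s) = aU (subst_arr \<phi> \<gamma>s) (subst_arr \<psi> \<delta>s)"
    if "avalid \<phi>" "avalid \<psi>" "length \<gamma>s = leaves (adom \<phi>)" "length \<delta>s = leaves (adom \<psi>)"
     "list_all avalid \<gamma>s" "list_all avalid \<delta>s"
    using that subst_arr_abs[of "TU r s" "\<gamma>s @ \<delta>s"]
    by (simp add: rst abs_simps subst_arr_abs)
  show "subst_arr (aV \<phi> \<psi> \<chi> e) (\<gamma>s @ \<delta>s @ \<epsilon>s) =
       aV (subst_arr \<phi> \<gamma>s) (subst_arr \<psi> \<delta>s) (subst_arr \<chi> \<epsilon>s) e"
    if "avalid \<phi>" "avalid \<psi>" "avalid \<chi>" "length \<gamma>s = leaves (adom \<phi>)" "length \<delta>s = leaves (adom \<psi>)"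
     "length \<epsilon>s = leaves (adom \<chi>)" "list_all avalid \<gamma>s" "list_all avalid \<delta>s" "list_all avalid \<epsilon>s"
    using that subst_arr_abs[of "TV r s t e" "\<gamma>s @ \<delta>s @ \<epsilon>s"]
    by (simp add: rst abs_simps subst_arr_abs)
qed

lemma subst_term_right:
  assumes "tvalid t" "valid_args (tdom t) \<gamma>s" "valid_args (tdom t) \<delta>s" "map adom \<gamma>s = map acod \<delta>s"
  shows "subst_term t (map2 acomp \<gamma>s \<delta>s) = acomp (subst_term t \<gamma>s) (subst_term (tid (tdom t)) \<delta>s)"
  using assms
proof (induction t arbitrary: \<gamma>s \<delta>s)
  case TOne
  then obtain \<gamma> \<delta> where "\<gamma>s = [\<gamma>]" "\<delta>s = [\<delta>]" by (auto elim!: length_oneE)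
  then show ?case by simp
next
  case (TU s t)
  let ?a = "take (leaves (tdom s))" and ?b = "drop (leaves (tdom s))"
  have args: "valid_args (tdom s) (?a \<gamma>s)" "valid_args (tdom t) (?b \<gamma>s)"
    "valid_args (tdom s) (?a \<delta>s)" "valid_args (tdom t) (?b \<delta>s)"
    "map adom (?a \<gamma>s) = map acod (?a \<delta>s)" "map adom (?b \<gamma>s) = map acod (?b \<delta>s)"
    using TU.prems by (simp_all add: list_all_take_drop take_map[symmetric] drop_map[symmetric])
  show ?case
    using TU.prems TU.IH(1)[OF _ args(1,3,5)] TU.IH(2)[OF _ args(2,4,6)] args
      subst_term_type[of s "?a \<gamma>s"] subst_term_type[of t "?b \<gamma>s"]
      subst_term_type[of "tid (tdom s)" "?a \<delta>s"] subst_term_type[of "tid (tdom t)" "?b \<delta>s"]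
    by (simp add: take_map drop_map take_zip drop_zip arrow_eqs(4))
next
  case (TV r s t e)
  obtain x y where e: "e = (x, y)" by (cases e)
  let ?a = "take (leaves (tdom r))" and ?b = "\<lambda>xs. take (leaves (tdom s)) (drop (leaves (tdom r)) xs)"
    and ?c = "drop (leaves (tdom r) + leaves (tdom s))"
  have args: "valid_args (tdom r) (?a \<gamma>s)" "valid_args (tdom s) (?b \<gamma>s)" "valid_args (tdom t) (?c \<gamma>s)"
    "valid_args (tdom r) (?a \<delta>s)" "valid_args (tdom s) (?b \<delta>s)" "valid_args (tdom t) (?c \<delta>s)"
    "map adom (?a \<gamma>s) = map acod (?a \<delta>s)" "map adom (?b \<gamma>s) = map acod (?b \<delta>s)"
    "map adom (?c \<gamma>s) = map acod (?c \<delta>s)"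
    using TV.prems by (simp_all add: list_all_take_drop take_map[symmetric] drop_map[symmetric])
  have *: "subst_term (tid (bracket x (tdom r) (tdom s) (tdom t))) \<delta>s =
      aV (subst_term (tid (tdom r)) (?a \<delta>s)) (subst_term (tid (tdom s)) (?b \<delta>s))
        (subst_term (tid (tdom t)) (?c \<delta>s)) (x, x)"
    using TV.prems args
      subst_term_type[of "tid (tdom r)" "?a \<delta>s"] subst_term_type[of "tid (tdom s)" "?b \<delta>s"]
      subst_term_type[of "tid (tdom t)" "?c \<delta>s"]
    by (cases x) (simp_all add: arrow_eqs(6,7) drop_take add.commute min_absorb1)
  show ?case
    using TV.prems TV.IH(1)[OF _ args(1,4,7)] TV.IH(2)[OF _ args(2,5,8)] TV.IH(3)[OF _ args(3,6,9)] args
      subst_term_type[of r "?a \<gamma>s"] subst_term_type[of s "?b \<gamma>s"] subst_term_type[of t "?c \<gamma>s"]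
      subst_term_type[of "tid (tdom r)" "?a \<delta>s"] subst_term_type[of "tid (tdom s)" "?b \<delta>s"]
      subst_term_type[of "tid (tdom t)" "?c \<delta>s"]
    by (simp add: e * take_map drop_map take_zip drop_zip arrow_eqs(5))
next
  case (TComp s t)
  let ?i = "map (\<lambda>\<gamma>. aid (adom \<gamma>))"
  have i: "map2 acomp (?i \<gamma>s) \<delta>s = \<delta>s"
    using TComp.prems
    by (intro nth_equalityI) (auto simp: list_eq_iff_nth_eq list_all_length arrow_eqs(1))
  have i': "?i (map2 acomp \<gamma>s \<delta>s) = ?i \<delta>s"
    using TComp.prems by (intro nth_equalityI) auto
  have args: "valid_args (tdom s) \<gamma>s" "valid_args (tdom s) \<delta>s"
    using TComp.prems by (simp_all add: leaves_tcod)
  have eq1: "subst_term s (map2 acomp \<gamma>s \<delta>s) = acomp (subst_term s \<gamma>s) (subst_term (tid (tcod t)) \<delta>s)"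
    using TComp.IH(1)[OF _ args] TComp.prems by simp
  have eq2: "subst_term t \<delta>s = acomp (subst_term t (?i \<gamma>s)) (subst_term (tid (tdom t)) \<delta>s)"
    using TComp.IH(2)[of "?i \<gamma>s" \<delta>s] TComp.prems by (simp add: i comp_def)
  have eq3: "subst_term t \<delta>s = acomp (subst_term (tid (tcod t)) \<delta>s) (subst_term t (?i \<delta>s))"
    using subst_term_left TComp.prems by simp
  have types: "avalid (subst_term s \<gamma>s)" "adom (subst_term s \<gamma>s) = subst_obj (tcod t) (map adom \<gamma>s)"
    "avalid (subst_term (tid (tcod t)) \<delta>s)" "avalid (subst_term t (?i \<delta>s))"
    "acod (subst_term (tid (tcod t)) \<delta>s) = subst_obj (tcod t) (map acod \<delta>s)"
    "adom (subst_term (tid (tcod t)) \<delta>s) = subst_obj (tcod t) (map adom \<delta>s)"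
    "acod (subst_term t (?i \<delta>s)) = subst_obj (tcod t) (map adom \<delta>s)"
    "avalid (subst_term t (?i \<gamma>s))" "acod (subst_term t (?i \<gamma>s)) = subst_obj (tcod t) (map adom \<gamma>s)"
    "adom (subst_term t (?i \<gamma>s)) = subst_obj (tdom t) (map adom \<gamma>s)"
    "avalid (subst_term (tid (tdom t)) \<delta>s)"
    "acod (subst_term (tid (tdom t)) \<delta>s) = subst_obj (tdom t) (map acod \<delta>s)"
    using TComp.prems args subst_term_type[of s \<gamma>s] subst_term_type[of "tid (tcod t)" \<delta>s]
      subst_term_type[of t "?i \<delta>s"] subst_term_type[of t "?i \<gamma>s"] subst_term_type[of "tid (tdom t)" \<delta>s]
    by (simp_all add: comp_def leaves_tcod)
  have "subst_term (TComp s t) (map2 acomp \<gamma>s \<delta>s) =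
      acomp (acomp (subst_term s \<gamma>s) (subst_term (tid (tcod t)) \<delta>s)) (subst_term t (?i \<delta>s))"
    by (simp only: subst_term.simps eq1 i')
  also have "\<dots> = acomp (subst_term s \<gamma>s) (subst_term t \<delta>s)"
    unfolding eq3 using types TComp.prems(4) by (subst arrow_eqs(3)) simp_all
  also have "\<dots> = acomp (acomp (subst_term s \<gamma>s) (subst_term t (?i \<gamma>s))) (subst_term (tid (tdom t)) \<delta>s)"
    unfolding eq2 using types TComp.prems(4) by (subst arrow_eqs(3)) simp_all
  finally show ?case by simp
qed

lemma subst_arr_comp:
  assumes "avalid (acomp \<psi> \<phi>)" "valid_args (adom \<psi>) \<gamma>s" "valid_args (adom \<phi>) \<delta>s"
    "map adom \<gamma>s = map acod \<delta>s"
  shows "subst_arr (acomp \<psi> \<phi>) (map2 acomp \<gamma>s \<delta>s) = acomp (subst_arr \<psi> \<gamma>s) (subst_arr \<phi> \<delta>s)"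
proof -
  obtain s t where st: "\<psi> = abs_catalan_arrow s" "\<phi> = abs_catalan_arrow t"
    by (metis Quotient_abs_rep[OF Quotient_catalan_arrow])
  let ?i = "map (\<lambda>\<gamma>. aid (adom \<gamma>))"
  have v: "tvalid s" "tvalid t" "tdom s = tcod t" "valid_args (tcod t) \<gamma>s" "valid_args (tdom t) \<delta>s"
    "valid_args (tdom t) \<gamma>s" "valid_args (tdom s) \<delta>s" "valid_args (tdom s) \<gamma>s"
    using assms by (simp_all add: st abs_simps leaves_tcod)
  have nth: "adom (\<gamma>s ! k) = acod (\<delta>s ! k)" "avalid (\<gamma>s ! k)" "avalid (\<delta>s ! k)" if "k < length \<gamma>s" for k
    using that assms(4) v by (auto simp: list_eq_iff_nth_eq list_all_length)
  have c: "valid_args (tdom t) (map2 acomp \<gamma>s \<delta>s)"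
    using v nth by (auto simp: list_all_length)
  have i': "?i (map2 acomp \<gamma>s \<delta>s) = ?i \<delta>s"
    using v by (intro nth_equalityI) auto
  have "subst_arr (acomp \<psi> \<phi>) (map2 acomp \<gamma>s \<delta>s) =
      acomp (subst_term s (map2 acomp \<gamma>s \<delta>s)) (subst_term t (?i \<delta>s))"
    using subst_arr_abs[of "TComp s t" "map2 acomp \<gamma>s \<delta>s"] v c i' by (simp add: st abs_simps)
  also have "\<dots> = acomp (acomp (subst_term s \<gamma>s) (subst_term (tid (tcod t)) \<delta>s)) (subst_term t (?i \<delta>s))"
    using subst_term_right[OF v(1,8,7) assms(4)] v by simp
  also have "\<dots> = acomp (subst_term s \<gamma>s) (acomp (subst_term (tid (tcod t)) \<delta>s) (subst_term t (?i \<delta>s)))"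
    using v assms(4) subst_term_type[of s \<gamma>s] subst_term_type[of "tid (tcod t)" \<delta>s]
      subst_term_type[of t "?i \<delta>s"]
    by (subst arrow_eqs(3)) (simp_all add: comp_def leaves_tcod)
  also have "\<dots> = acomp (subst_arr \<psi> \<gamma>s) (subst_arr \<phi> \<delta>s)"
    using v subst_term_left[of t \<delta>s] by (simp add: st subst_arr_abs)
  finally show ?thesis .
qed

lemma leaves_subst_obj: "length gs = leaves f \<Longrightarrow> leaves (subst_obj f gs) = sum_list (map leaves gs)"
proof (induction f arbitrary: gs)
  case Leaf
  then show ?case by (auto elim!: length_oneE)
next
  case (Node f1 f2)
  then show ?case
    by (simp flip: sum_list_append map_append)
qed

context
  fixes ms :: "nat list"
begin

abbreviation (input) "lp \<equiv> list_prod_cat (map catalan ms)"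

lemma list_prod_catalan_Obj: "Obj lp = {gs. map leaves gs = ms}"
proof -
  have "list_all2 (\<lambda>C x. x \<in> Obj C) (map catalan ms) gs \<longleftrightarrow> map leaves gs = ms" for gs
    by (induction ms arbitrary: gs) (auto simp: list_all2_Cons1 Cons_eq_map_conv)
  then show ?thesis by (simp add: list_prod_cat_def Let_def)
qed

lemma list_prod_catalan_Arr:
  "Arr lp = {\<gamma>s. list_all avalid \<gamma>s \<and> map (\<lambda>\<gamma>. leaves (adom \<gamma>)) \<gamma>s = ms}"
proof -
  have "list_all2 (\<lambda>C x. x \<in> Arr C) (map catalan ms) \<gamma>s \<longleftrightarrow>
      list_all avalid \<gamma>s \<and> map (\<lambda>\<gamma>. leaves (adom \<gamma>)) \<gamma>s = ms" for \<gamma>s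
    by (induction ms arbitrary: \<gamma>s) (auto simp: list_all2_Cons1 Cons_eq_map_conv)
  then show ?thesis by (simp add: list_prod_cat_def Let_def)
qed

lemma list_prod_catalan_simps:
  "\<gamma>s \<in> Arr lp \<Longrightarrow> Dom lp \<gamma>s = map adom \<gamma>s"
  "\<gamma>s \<in> Arr lp \<Longrightarrow> Cod lp \<gamma>s = map acod \<gamma>s"
  "gs \<in> Obj lp \<Longrightarrow> Id lp gs = map aid gs"
  "composable lp \<gamma>s \<delta>s \<longleftrightarrow> \<gamma>s \<in> Arr lp \<and> \<delta>s \<in> Arr lp \<and> map adom \<gamma>s = map acod \<delta>s"
  "\<gamma>s \<in> Arr lp \<Longrightarrow> \<delta>s \<in> Arr lp \<Longrightarrow> map adom \<gamma>s = map acod \<delta>s \<Longrightarrow> Comp lp \<gamma>s \<delta>s = map2 acomp \<gamma>s \<delta>s"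
  "\<not> composable lp \<gamma>s \<delta>s \<Longrightarrow> Comp lp \<gamma>s \<delta>s = undefined"
  "Dom lp \<in> extensional (Arr lp)" "Cod lp \<in> extensional (Arr lp)" "Id lp \<in> extensional (Obj lp)"
proof -
  let ?C = "map catalan ms"
  have dom: "map2 Dom (map catalan ms) \<gamma>s = map adom \<gamma>s" "map2 Cod (map catalan ms) \<gamma>s = map acod \<gamma>s"
    if "list_all avalid \<gamma>s" "map (\<lambda>\<gamma>. leaves (adom \<gamma>)) \<gamma>s = ms" for \<gamma>s
    using that by (induction \<gamma>s arbitrary: ms) auto
  have id: "map2 Id (map catalan ms) gs = map aid gs" if "map leaves gs = ms" for gs
    using that by (induction gs arbitrary: ms) auto
  have comp: "map2 (\<lambda>C (g, f). Comp C g f) (map catalan ms) (zip \<gamma>s \<delta>s) = map2 acomp \<gamma>s \<delta>s"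
    if "list_all avalid \<gamma>s" "map (\<lambda>\<gamma>. leaves (adom \<gamma>)) \<gamma>s = ms" "list_all avalid \<delta>s"
      "map (\<lambda>\<gamma>. leaves (adom \<gamma>)) \<delta>s = ms" "map adom \<gamma>s = map acod \<delta>s" for \<gamma>s \<delta>s
    using that
  proof (induction \<gamma>s arbitrary: ms \<delta>s)
    case (Cons \<gamma> \<gamma>s)
    obtain \<delta> \<delta>s' where "\<delta>s = \<delta> # \<delta>s'" using Cons.prems by (cases \<delta>s) auto
    moreover from this have "map2 (\<lambda>C (g, f). Comp C g f) (map catalan (map (\<lambda>\<gamma>. leaves (adom \<gamma>)) \<gamma>s)) (zip \<gamma>s \<delta>s') =
        map2 acomp \<gamma>s \<delta>s'"
      using Cons.prems(1,2) Cons.prems(3-5)[simplified] by (intro Cons.IH) auto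
    ultimately show ?case
      using Cons.prems(1,3,5) unfolding Cons.prems(2)[symmetric] by (simp add: leaves_acod)
  qed simp
  have defs: "Dom lp = restrict (map2 Dom ?C) (Arr lp)" "Cod lp = restrict (map2 Cod ?C) (Arr lp)"
    "Id lp = restrict (map2 Id ?C) (Obj lp)"
    by (simp_all add: list_prod_cat_def Let_def)
  show D: "Dom lp \<gamma>s = map adom \<gamma>s" and E: "Cod lp \<gamma>s = map acod \<gamma>s" if "\<gamma>s \<in> Arr lp" for \<gamma>s
    using that dom by (simp_all add: defs list_prod_catalan_Arr)
  show "gs \<in> Obj lp \<Longrightarrow> Id lp gs = map aid gs"
    using id by (simp add: defs list_prod_catalan_Obj)
  show cp: "composable lp \<gamma>s \<delta>s \<longleftrightarrow> \<gamma>s \<in> Arr lp \<and> \<delta>s \<in> Arr lp \<and> map adom \<gamma>s = map acod \<delta>s"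
    by (auto simp: composable_def D E)
  have Comp: "Comp lp \<gamma>s \<delta>s = (if \<gamma>s \<in> Arr lp \<and> \<delta>s \<in> Arr lp \<and> map2 Dom ?C \<gamma>s = map2 Cod ?C \<delta>s
      then map2 (\<lambda>C (g, f). Comp C g f) ?C (zip \<gamma>s \<delta>s) else undefined)"
    by (simp add: list_prod_cat_def Let_def)
  show "\<gamma>s \<in> Arr lp \<Longrightarrow> \<delta>s \<in> Arr lp \<Longrightarrow> map adom \<gamma>s = map acod \<delta>s \<Longrightarrow> Comp lp \<gamma>s \<delta>s = map2 acomp \<gamma>s \<delta>s"
    using comp dom unfolding Comp by (simp add: list_prod_catalan_Arr)
  show "\<not> composable lp \<gamma>s \<delta>s \<Longrightarrow> Comp lp \<gamma>s \<delta>s = undefined"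
    using dom unfolding Comp cp by (auto simp: list_prod_catalan_Arr)
  show "Dom lp \<in> extensional (Arr lp)" "Cod lp \<in> extensional (Arr lp)" "Id lp \<in> extensional (Obj lp)"
    by (simp_all add: list_prod_cat_def Let_def)
qed

lemma list_prod_catalan_comp:
  assumes "composable lp \<gamma>s \<delta>s"
  shows "map2 acomp \<gamma>s \<delta>s \<in> Arr lp" "map adom (map2 acomp \<gamma>s \<delta>s) = map adom \<delta>s"
    "map acod (map2 acomp \<gamma>s \<delta>s) = map acod \<gamma>s"
proof -
  have *: "list_all avalid \<gamma>s" "list_all avalid \<delta>s" "map (\<lambda>\<gamma>. leaves (adom \<gamma>)) \<delta>s = ms"
    "map adom \<gamma>s = map acod \<delta>s" "length \<gamma>s = length \<delta>s"
    using assms by (auto simp: list_prod_catalan_simps list_prod_catalan_Arr dest: map_eq_imp_length_eq)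
  then show "map adom (map2 acomp \<gamma>s \<delta>s) = map adom \<delta>s" "map acod (map2 acomp \<gamma>s \<delta>s) = map acod \<gamma>s"
    by (auto intro!: nth_equalityI)
  then have "map leaves (map adom (map2 acomp \<gamma>s \<delta>s)) = ms"
    using * by (simp add: comp_def)
  then show "map2 acomp \<gamma>s \<delta>s \<in> Arr lp"
    using * by (auto simp: list_prod_catalan_Arr list_all_length list_eq_iff_nth_eq comp_def)
qed

lemma list_prod_catalan_dom:
  assumes "\<gamma>s \<in> Arr lp" shows "map adom \<gamma>s \<in> Obj lp" "map acod \<gamma>s \<in> Obj lp"
proof -
  have *: "map leaves (map acod \<gamma>s) = map (\<lambda>\<gamma>. leaves (adom \<gamma>)) \<gamma>s" if "list_all avalid \<gamma>s"
    using that by (induction \<gamma>s) (simp_all add: leaves_acod)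
  show "map adom \<gamma>s \<in> Obj lp" "map acod \<gamma>s \<in> Obj lp"
    using assms * by (simp_all add: list_prod_catalan_Arr list_prod_catalan_Obj comp_def)
qed

lemma category_list_prod_catalan: "category lp"
proof (rule categoryI)
  fix \<gamma>s assume *: "\<gamma>s \<in> Arr lp"
  then have v: "list_all avalid \<gamma>s" by (simp add: list_prod_catalan_Arr)
  have id: "map aid (map adom \<gamma>s) \<in> Arr lp" "map aid (map acod \<gamma>s) \<in> Arr lp"
    using list_prod_catalan_dom[OF *] by (auto simp: list_prod_catalan_Arr list_prod_catalan_Obj list_all_iff comp_def)
  have e: "map2 acomp \<gamma>s (map aid (map adom \<gamma>s)) = \<gamma>s" "map2 acomp (map aid (map acod \<gamma>s)) \<gamma>s = \<gamma>s"
    using v by (auto intro!: nth_equalityI simp: list_all_length arrow_eqs)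
  show "Comp lp \<gamma>s (Id lp (Dom lp \<gamma>s)) = \<gamma>s" "Comp lp (Id lp (Cod lp \<gamma>s)) \<gamma>s = \<gamma>s"
    using * id e list_prod_catalan_dom[OF *]
    by (simp_all add: list_prod_catalan_simps(1-5) comp_def)
next
  fix \<beta>s \<gamma>s \<delta>s assume *: "composable lp \<beta>s \<gamma>s" "composable lp \<gamma>s \<delta>s"
  then have "list_all avalid \<beta>s" "list_all avalid \<gamma>s" "list_all avalid \<delta>s"
    "map adom \<beta>s = map acod \<gamma>s" "map adom \<gamma>s = map acod \<delta>s"
    by (simp_all add: list_prod_catalan_simps(4) list_prod_catalan_Arr)
  then have "map2 acomp \<beta>s (map2 acomp \<gamma>s \<delta>s) = map2 acomp (map2 acomp \<beta>s \<gamma>s) \<delta>s"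
    by (auto intro!: nth_equalityI arrow_eqs(3) simp: list_all_length list_eq_iff_nth_eq)
  with * list_prod_catalan_comp[OF *(1)] list_prod_catalan_comp[OF *(2)]
  show "Comp lp \<beta>s (Comp lp \<gamma>s \<delta>s) = Comp lp (Comp lp \<beta>s \<gamma>s) \<delta>s"
    by (simp add: list_prod_catalan_simps(4,5))
next
  fix \<gamma>s \<delta>s assume *: "composable lp \<gamma>s \<delta>s"
  with list_prod_catalan_comp[OF *]
  show "Comp lp \<gamma>s \<delta>s \<in> hom lp (Dom lp \<delta>s) (Cod lp \<gamma>s)"
    by (simp add: hom_def list_prod_catalan_simps(1,2,4,5))
next
  have "map aid gs \<in> Arr lp" if "gs \<in> Obj lp" for gs
    using that by (simp add: list_prod_catalan_Arr list_prod_catalan_Obj list_all_iff comp_def)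
  then show "Id lp \<in> Obj lp \<rightarrow>\<^sub>E Arr lp" "\<And>x. x \<in> Obj lp \<Longrightarrow> Dom lp (Id lp x) = x"
    "\<And>x. x \<in> Obj lp \<Longrightarrow> Cod lp (Id lp x) = x"
    by (simp_all add: PiE_iff list_prod_catalan_simps comp_def)
qed (simp_all add: PiE_iff list_prod_catalan_simps list_prod_catalan_dom)

lemma is_functor_Q:
  assumes "length ms = n"
  shows "is_functor (catalan n \<times>\<^sub>C lp) (catalan (sum_list ms)) (Q_functor n ms)"
proof (rule is_functorI)
  show "category (catalan n \<times>\<^sub>C lp)" by (intro category_prod category_catalan category_list_prod_catalan)
  show "category (catalan (sum_list ms))" by (rule category_catalan)
  show "OMap (Q_functor n ms) \<in> extensional (Obj (catalan n \<times>\<^sub>C lp))"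
    "AMap (Q_functor n ms) \<in> extensional (Arr (catalan n \<times>\<^sub>C lp))"
    by (simp_all add: Q_functor_def Let_def)
next
  fix x assume x: "x \<in> Obj (catalan n \<times>\<^sub>C lp)"
  then obtain f gs where fg: "x = (f, gs)" "leaves f = n" "map leaves gs = ms" "gs \<in> Obj lp"
    by (auto simp: list_prod_catalan_Obj)
  then have l: "length gs = leaves f" using assms by auto
  show "OMap (Q_functor n ms) x \<in> Obj (catalan (sum_list ms))"
    using x fg l leaves_subst_obj[OF l] by (simp add: Q_functor_def Let_def)
  have "map aid gs \<in> Arr lp"
    using fg by (simp add: list_prod_catalan_Arr list_all_iff comp_def)
  then show "AMap (Q_functor n ms) (Id (catalan n \<times>\<^sub>C lp) x) =
      Id (catalan (sum_list ms)) (OMap (Q_functor n ms) x)"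
    using x fg l leaves_subst_obj[OF l]
    by (simp add: Q_functor_def Let_def list_prod_catalan_simps subst_arr_simps(4))
next
  fix x assume x: "x \<in> Arr (catalan n \<times>\<^sub>C lp)"
  then obtain \<phi> \<gamma>s where fg: "x = (\<phi>, \<gamma>s)" "avalid \<phi>" "leaves (adom \<phi>) = n" "list_all avalid \<gamma>s"
    "map (\<lambda>\<gamma>. leaves (adom \<gamma>)) \<gamma>s = ms" "\<gamma>s \<in> Arr lp"
    by (auto simp: list_prod_catalan_Arr)
  then have args: "length \<gamma>s = leaves (adom \<phi>)" "valid_args (adom \<phi>) \<gamma>s" using assms by auto
  have s: "leaves (subst_obj (adom \<phi>) (map adom \<gamma>s)) = sum_list ms"
    using leaves_subst_obj[of "map adom \<gamma>s" "adom \<phi>"] fg args by (simp add: comp_def)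
  have a: "AMap (Q_functor n ms) x = subst_arr \<phi> \<gamma>s"
    using x fg by (simp add: Q_functor_def Let_def)
  note t = subst_arr_type[OF fg(2) args(2)]
  show "AMap (Q_functor n ms) x \<in> Arr (catalan (sum_list ms))"
    using s t by (simp add: a)
  have "(adom \<phi>, map adom \<gamma>s) \<in> Obj (catalan n \<times>\<^sub>C lp)" "(acod \<phi>, map acod \<gamma>s) \<in> Obj (catalan n \<times>\<^sub>C lp)"
    using fg list_prod_catalan_dom[OF fg(6)] by (simp_all add: leaves_acod)
  then show "Dom (catalan (sum_list ms)) (AMap (Q_functor n ms) x) =
      OMap (Q_functor n ms) (Dom (catalan n \<times>\<^sub>C lp) x)"
    "Cod (catalan (sum_list ms)) (AMap (Q_functor n ms) x) =
      OMap (Q_functor n ms) (Cod (catalan n \<times>\<^sub>C lp) x)"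
    using fg s t unfolding a by (simp_all add: Q_functor_def Let_def list_prod_catalan_simps)
next
  fix y x assume c: "composable (catalan n \<times>\<^sub>C lp) y x"
  obtain \<psi> \<gamma>s \<phi> \<delta>s where yx: "y = (\<psi>, \<gamma>s)" "x = (\<phi>, \<delta>s)" by (cases y; cases x)
  have *: "avalid \<psi>" "avalid \<phi>" "adom \<psi> = acod \<phi>" "leaves (adom \<phi>) = n" "leaves (adom \<psi>) = n"
    "composable lp \<gamma>s \<delta>s" "\<gamma>s \<in> Arr lp" "\<delta>s \<in> Arr lp" "map adom \<gamma>s = map acod \<delta>s"
    using c by (simp_all add: yx list_prod_catalan_simps(4) leaves_acod)
  note l = list_prod_catalan_comp[OF *(6)]
  have l': "list_all avalid \<gamma>s" "list_all avalid \<delta>s" "map (\<lambda>\<gamma>. leaves (adom \<gamma>)) \<gamma>s = ms"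
    "map (\<lambda>\<gamma>. leaves (adom \<gamma>)) \<delta>s = ms"
    using * by (simp_all add: list_prod_catalan_Arr)
  then have l'': "length \<gamma>s = n" "length \<delta>s = n"
    using assms map_eq_imp_length_eq length_map by (metis (no_types))+
  note l' = l' l''
  have s: "leaves (subst_obj (adom \<phi>) (map adom \<delta>s)) = sum_list ms"
    using leaves_subst_obj[of "map adom \<delta>s" "adom \<phi>"] * l' by (simp add: comp_def)
  have "Comp (catalan n \<times>\<^sub>C lp) y x = (acomp \<psi> \<phi>, map2 acomp \<gamma>s \<delta>s)"
    using c * by (simp add: yx list_prod_catalan_simps(5))
  moreover have "subst_arr (acomp \<psi> \<phi>) (map2 acomp \<gamma>s \<delta>s) = acomp (subst_arr \<psi> \<gamma>s) (subst_arr \<phi> \<delta>s)"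
    using * l' by (intro subst_arr_comp) simp_all
  moreover have "composable (catalan (sum_list ms)) (subst_arr \<psi> \<gamma>s) (subst_arr \<phi> \<delta>s)"
    using * l' s by simp
  ultimately show "AMap (Q_functor n ms) (Comp (catalan n \<times>\<^sub>C lp) y x) =
      Comp (catalan (sum_list ms)) (AMap (Q_functor n ms) y) (AMap (Q_functor n ms) x)"
    using * l(1) by (simp add: yx Q_functor_def Let_def)
qed

end


section \<open>Strict tensor 2-categories, 2-functors and 2-natural transformations\<close>

text \<open>
  The first argument of \<open>HComp1\<close>, \<open>VComp\<close>, \<open>HComp2\<close> is the cell applied last.
  The operations are only meaningful on composable cells.
\<close>

record ('x, 'f, 't) tensor_2cat =
  Cell0 :: "'x set"
  Cell1 :: "'f set"
  Cell2 :: "'t set"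
  Src1 :: "'f \<Rightarrow> 'x"
  Trg1 :: "'f \<Rightarrow> 'x"
  Src2 :: "'t \<Rightarrow> 'f"
  Trg2 :: "'t \<Rightarrow> 'f"
  Id1 :: "'x \<Rightarrow> 'f"
  Id2 :: "'f \<Rightarrow> 't"
  HComp1 :: "'f \<Rightarrow> 'f \<Rightarrow> 'f"
  VComp :: "'t \<Rightarrow> 't \<Rightarrow> 't"
  HComp2 :: "'t \<Rightarrow> 't \<Rightarrow> 't"
  Ten0 :: "'x \<Rightarrow> 'x \<Rightarrow> 'x"
  Ten1 :: "'f \<Rightarrow> 'f \<Rightarrow> 'f"
  Ten2 :: "'t \<Rightarrow> 't \<Rightarrow> 't"

record ('x, 'f, 't, 'y, 'g, 'u) two_functor =
  Map0 :: "'x \<Rightarrow> 'y"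
  Map1 :: "'f \<Rightarrow> 'g"
  Map2 :: "'t \<Rightarrow> 'u"

definition strict_tensor_2functor ::
  "('x, 'f, 't) tensor_2cat \<Rightarrow> ('y, 'g, 'u) tensor_2cat \<Rightarrow> ('x, 'f, 't, 'y, 'g, 'u) two_functor \<Rightarrow> bool" where
  "strict_tensor_2functor X Y R \<longleftrightarrow>
     Map0 R \<in> Cell0 X \<rightarrow>\<^sub>E Cell0 Y \<and> Map1 R \<in> Cell1 X \<rightarrow>\<^sub>E Cell1 Y \<and> Map2 R \<in> Cell2 X \<rightarrow>\<^sub>E Cell2 Y \<and>
     (\<forall>f \<in> Cell1 X. Src1 Y (Map1 R f) = Map0 R (Src1 X f) \<and> Trg1 Y (Map1 R f) = Map0 R (Trg1 X f)) \<and>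
     (\<forall>\<phi> \<in> Cell2 X. Src2 Y (Map2 R \<phi>) = Map1 R (Src2 X \<phi>) \<and> Trg2 Y (Map2 R \<phi>) = Map1 R (Trg2 X \<phi>)) \<and>
     (\<forall>x \<in> Cell0 X. Map1 R (Id1 X x) = Id1 Y (Map0 R x)) \<and>
     (\<forall>f \<in> Cell1 X. Map2 R (Id2 X f) = Id2 Y (Map1 R f)) \<and>
     (\<forall>g \<in> Cell1 X. \<forall>f \<in> Cell1 X. Src1 X g = Trg1 X f \<longrightarrow>
        Map1 R (HComp1 X g f) = HComp1 Y (Map1 R g) (Map1 R f)) \<and>
     (\<forall>\<psi> \<in> Cell2 X. \<forall>\<phi> \<in> Cell2 X. Src2 X \<psi> = Trg2 X \<phi> \<longrightarrow>
        Map2 R (VComp X \<psi> \<phi>) = VComp Y (Map2 R \<psi>) (Map2 R \<phi>)) \<and>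
     (\<forall>\<psi> \<in> Cell2 X. \<forall>\<phi> \<in> Cell2 X. Src1 X (Src2 X \<psi>) = Trg1 X (Src2 X \<phi>) \<longrightarrow>
        Map2 R (HComp2 X \<psi> \<phi>) = HComp2 Y (Map2 R \<psi>) (Map2 R \<phi>)) \<and>
     (\<forall>x \<in> Cell0 X. \<forall>y \<in> Cell0 X. Map0 R (Ten0 X x y) = Ten0 Y (Map0 R x) (Map0 R y)) \<and>
     (\<forall>f \<in> Cell1 X. \<forall>g \<in> Cell1 X. Map1 R (Ten1 X f g) = Ten1 Y (Map1 R f) (Map1 R g)) \<and>
     (\<forall>\<phi> \<in> Cell2 X. \<forall>\<psi> \<in> Cell2 X. Map2 R (Ten2 X \<phi> \<psi>) = Ten2 Y (Map2 R \<phi>) (Map2 R \<psi>))"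

definition strict_tensor_2nat ::
  "('x, 'f, 't) tensor_2cat \<Rightarrow> ('y, 'g, 'u) tensor_2cat \<Rightarrow>
   ('x, 'f, 't, 'y, 'g, 'u) two_functor \<Rightarrow> ('x, 'f, 't, 'y, 'g, 'u) two_functor \<Rightarrow> ('x \<Rightarrow> 'g) \<Rightarrow> bool" where
  "strict_tensor_2nat X Y R S F \<longleftrightarrow>
     strict_tensor_2functor X Y R \<and> strict_tensor_2functor X Y S \<and>
     F \<in> Cell0 X \<rightarrow>\<^sub>E Cell1 Y \<and>
     (\<forall>x \<in> Cell0 X. Src1 Y (F x) = Map0 R x \<and> Trg1 Y (F x) = Map0 S x) \<and>
     (\<forall>x \<in> Cell0 X. \<forall>y \<in> Cell0 X. F (Ten0 X x y) = Ten1 Y (F x) (F y)) \<and>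
     (\<forall>f \<in> Cell1 X. HComp1 Y (Map1 S f) (F (Src1 X f)) = HComp1 Y (F (Trg1 X f)) (Map1 R f)) \<and>
     (\<forall>\<phi> \<in> Cell2 X. HComp2 Y (Map2 S \<phi>) (Id2 Y (F (Src1 X (Src2 X \<phi>)))) =
        HComp2 Y (Id2 Y (F (Trg1 X (Src2 X \<phi>)))) (Map2 R \<phi>))"

type_synonym ('x, 'f, 't, 'y, 'g, 'u) two_nat =
  "('x, 'f, 't, 'y, 'g, 'u) two_functor \<times> ('x, 'f, 't, 'y, 'g, 'u) two_functor \<times> ('x \<Rightarrow> 'g)"

definition Hom_st ::
  "('x, 'f, 't) tensor_2cat \<Rightarrow> ('y, 'g, 'u) tensor_2cat \<Rightarrow>
   (('x, 'f, 't, 'y, 'g, 'u) two_functor, ('x, 'f, 't, 'y, 'g, 'u) two_nat) category" where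
  "Hom_st X Y =
    (let B = {R. strict_tensor_2functor X Y R}; A = {(R, S, F). strict_tensor_2nat X Y R S F} in
     \<lparr>Obj = B, Arr = A,
      Dom = restrict (\<lambda>(R, S, F). R) A, Cod = restrict (\<lambda>(R, S, F). S) A,
      Id = restrict (\<lambda>R. (R, R, restrict (\<lambda>x. Id1 Y (Map0 R x)) (Cell0 X))) B,
      Comp = (\<lambda>(S', T, G) (R, S, F). if (S', T, G) \<in> A \<and> (R, S, F) \<in> A \<and> S' = S
        then (R, T, restrict (\<lambda>x. HComp1 Y (G x) (F x)) (Cell0 X)) else undefined)\<rparr>)"


section \<open>The strict tensor 2-category A\<close>

text \<open>
  Indices are shifted to start from \<open>0\<close>: a partition is an order-preserving surjection
  \<open>{0, \<dots>, n - 1} \<rightarrow> {0, \<dots>, k - 1}\<close>.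
\<close>

definition partitions :: "nat \<Rightarrow> nat \<Rightarrow> (nat \<Rightarrow> nat) set" where
  "partitions n k = {\<pi> \<in> {..<n} \<rightarrow>\<^sub>E {..<k}. mono_on {..<n} \<pi> \<and> \<pi> ` {..<n} = {..<k}}"

definition fibres :: "nat \<Rightarrow> nat \<Rightarrow> (nat \<Rightarrow> nat) \<Rightarrow> (tree list, catalan_arrow list) category" where
  "fibres n k \<pi> = list_prod_cat (map (\<lambda>i. catalan (card {j. j < n \<and> \<pi> j = i})) [0..<k])"

text \<open>
  \<open>fibres n k \<pi>\<close> is the summand \<open>\<Prod>\<^sub>i \<^bold>A\<^bsub>|\<pi>\<^sup>-\<^sup>1(i)|\<^esub>\<close> of \<open>Hom(n, k)\<close>. Since the \<open>\<^bold>A\<^sub>m\<close> are disjoint, so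
  are these summands, and their coproduct is a union: the partition of a 1-cell
  is \<open>partition_of\<close> (see \<open>partition_unique\<close> below).
\<close>

definition catalan_1cells :: "nat \<Rightarrow> nat \<Rightarrow> tree list set" where
  "catalan_1cells n k = (\<Union>\<pi> \<in> partitions n k. Obj (fibres n k \<pi>))"

definition catalan_2cells :: "nat \<Rightarrow> nat \<Rightarrow> catalan_arrow list set" where
  "catalan_2cells n k = (\<Union>\<pi> \<in> partitions n k. Arr (fibres n k \<pi>))"

fun partition_of :: "tree list \<Rightarrow> nat \<Rightarrow> nat" where
  "partition_of [] j = 0"
| "partition_of (f # fs) j = (if j < leaves f then 0 else Suc (partition_of fs (j - leaves f)))"

definition hcomp_obj :: "tree list \<Rightarrow> tree list \<Rightarrow> tree list" where
  "hcomp_obj g f = map (\<lambda>i. subst_obj (g ! i) (nths f {j. partition_of g j = i})) [0..<length g]"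

definition hcomp_arr :: "catalan_arrow list \<Rightarrow> catalan_arrow list \<Rightarrow> catalan_arrow list" where
  "hcomp_arr \<psi> \<phi> =
     map (\<lambda>i. subst_arr (\<psi> ! i) (nths \<phi> {j. partition_of (map adom \<psi>) j = i})) [0..<length \<psi>]"

definition catalan_2cat :: "(nat, tree list, catalan_arrow list) tensor_2cat" where
  "catalan_2cat =
     \<lparr>Cell0 = {1..},
      Cell1 = (\<Union>n \<in> {1..}. \<Union>k \<in> {1..}. catalan_1cells n k),
      Cell2 = (\<Union>n \<in> {1..}. \<Union>k \<in> {1..}. catalan_2cells n k),
      Src1 = (\<lambda>f. sum_list (map leaves f)), Trg1 = length,
      Src2 = map adom, Trg2 = map acod,
      Id1 = (\<lambda>n. replicate n Leaf), Id2 = map aid,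
      HComp1 = hcomp_obj, VComp = map2 acomp, HComp2 = hcomp_arr,
      Ten0 = (+), Ten1 = (@), Ten2 = (@)\<rparr>"

lemma down_closed_eq_lessThan:
  assumes "S \<subseteq> {..<n::nat}" "\<And>i j. j \<in> S \<Longrightarrow> i \<le> j \<Longrightarrow> i \<in> S"
  shows "S = {..<card S}"
proof -
  have fin: "finite S" using assms(1) finite_subset by blast
  show ?thesis
  proof (cases "S = {}")
    case False
    have "S = {..Max S}" using assms(2) fin False by (auto intro: Max_ge Max_in)
    then have "card S = Suc (Max S)" by (metis card_atMost)
    with \<open>S = {..Max S}\<close> show ?thesis by (metis lessThan_Suc_atMost)
  qed simp
qed

lemma partition_le_iff:
  assumes "\<pi> \<in> partitions n k" "j < n"
  shows "\<pi> j \<le> i \<longleftrightarrow> j < (\<Sum>i' \<le> i. card {j. j < n \<and> \<pi> j = i'})"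
proof -
  let ?S = "{j. j < n \<and> \<pi> j \<le> i}"
  have "mono_on {..<n} \<pi>" using assms(1) by (simp add: partitions_def)
  then have "?S = {..<card ?S}"
    by (intro down_closed_eq_lessThan[of _ n]) (auto simp: mono_on_def, meson le_less_trans le_trans)
  moreover have "card ?S = (\<Sum>i' \<le> i. card {j. j < n \<and> \<pi> j = i'})"
  proof -
    have "?S = (\<Union>i' \<in> {..i}. {j. j < n \<and> \<pi> j = i'})" by auto
    then show ?thesis by (subst card_UN_disjoint[symmetric]) auto
  qed
  ultimately show ?thesis using assms(2) by auto
qed

lemma partition_of_less: "j < sum_list (map leaves f) \<Longrightarrow> partition_of f j < length f"
proof (induction f arbitrary: j)
  case (Cons g f)
  show ?case using Cons.prems Cons.IH[of "j - leaves g"] by simp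
qed simp

lemma partition_of_mono: "i \<le> j \<Longrightarrow> partition_of f i \<le> partition_of f j"
proof (induction f arbitrary: i j)
  case (Cons g f)
  show ?case using Cons.prems Cons.IH[of "i - leaves g" "j - leaves g"] by auto
qed simp

lemma card_partition_of:
  "i < length f \<Longrightarrow> card {j. j < sum_list (map leaves f) \<and> partition_of f j = i} = leaves (f ! i)"
proof (induction f arbitrary: i)
  case (Cons g f)
  let ?n = "sum_list (map leaves f)"
  show ?case
  proof (cases i)
    case 0
    then have "{j. j < sum_list (map leaves (g # f)) \<and> partition_of (g # f) j = i} = {..<leaves g}"
      by auto
    then show ?thesis using 0 by simp
  next
    case (Suc i')
    have "{j. j < sum_list (map leaves (g # f)) \<and> partition_of (g # f) j = i} =
        (\<lambda>j. j + leaves g) ` {j. j < ?n \<and> partition_of f j = i'}" (is "?A = ?B")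
    proof
      show "?A \<subseteq> ?B"
      proof
        fix j assume "j \<in> ?A"
        then have "j = (j - leaves g) + leaves g" "j - leaves g \<in> {j. j < ?n \<and> partition_of f j = i'}"
          using Suc by (auto split: if_splits)
        then show "j \<in> ?B" by blast
      qed
      show "?B \<subseteq> ?A" using Suc by auto
    qed
    then show ?thesis
      using Suc Cons by (simp add: card_image)
  qed
qed simp

lemma fibres_Obj_iff:
  "f \<in> Obj (fibres n k \<pi>) \<longleftrightarrow> length f = k \<and> (\<forall>i < k. leaves (f ! i) = card {j. j < n \<and> \<pi> j = i})"
proof -
  have "fibres n k \<pi> = list_prod_cat (map catalan (map (\<lambda>i. card {j. j < n \<and> \<pi> j = i}) [0..<k]))"
    unfolding fibres_def map_map comp_def ..
  then have "f \<in> Obj (fibres n k \<pi>) \<longleftrightarrow>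
      map leaves f = map (\<lambda>i. card {j. j < n \<and> \<pi> j = i}) [0..<k]"
    by (simp only: list_prod_catalan_Obj mem_Collect_eq)
  also have "\<dots> \<longleftrightarrow> length f = k \<and> (\<forall>i < k. leaves (f ! i) = card {j. j < n \<and> \<pi> j = i})"
    unfolding list_eq_iff_nth_eq by (simp cong: conj_cong)
  finally show ?thesis .
qed

lemma sum_list_leaves: "sum_list (map leaves f) = (\<Sum>i < length f. leaves (f ! i))"
  by (simp add: sum_list_sum_nth lessThan_atLeast0)

lemma partition_unique:
  assumes \<pi>: "\<pi> \<in> partitions n k" and f: "f \<in> Obj (fibres n k \<pi>)"
  shows "sum_list (map leaves f) = n" "\<pi> = restrict (partition_of f) {..<n}"
proof -
  have len: "length f = k" and l: "\<And>i. i < k \<Longrightarrow> leaves (f ! i) = card {j. j < n \<and> \<pi> j = i}"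
    using f by (simp_all add: fibres_Obj_iff)
  have ran: "\<pi> j < k" if "j < n" for j using \<pi> that by (auto simp: partitions_def)
  have "{..<n} = (\<Union>i \<in> {..<k}. {j. j < n \<and> \<pi> j = i})" using ran by auto
  then have "n = card (\<Union>i \<in> {..<k}. {j. j < n \<and> \<pi> j = i})" by (metis card_lessThan)
  also have "\<dots> = (\<Sum>i < k. card {j. j < n \<and> \<pi> j = i})" by (subst card_UN_disjoint) auto
  finally show n: "sum_list (map leaves f) = n" using l len by (simp add: sum_list_leaves)
  have *: "restrict (partition_of f) {..<n} \<in> partitions n k"
  proof -
    have "\<exists>j<n. partition_of f j = i" if "i < k" for i
    proof -
      have "card {j. j < n \<and> partition_of f j = i} > 0"
        using card_partition_of[of i f] that n len by simp
      then show ?thesis by (auto simp: card_gt_0_iff)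
    qed
    then show ?thesis
      using partition_of_less[of _ f] n len
      by (auto simp: partitions_def mono_on_def intro!: partition_of_mono)
  qed
  have eq: "\<pi> j \<le> i \<longleftrightarrow> partition_of f j \<le> i" if "j < n" "i < k" for i j
  proof -
    have "card {j. j < n \<and> \<pi> j = i'} = card {j. j < n \<and> restrict (partition_of f) {..<n} j = i'}" if "i' \<le> i" for i'
    proof -
      have "{j. j < n \<and> restrict (partition_of f) {..<n} j = i'} = {j. j < n \<and> partition_of f j = i'}"
        by auto
      then show ?thesis using l[of i'] card_partition_of[of i' f] n len \<open>i < k\<close> that by simp
    qed
    then show ?thesis
      using partition_le_iff[OF \<pi> \<open>j < n\<close>, of i] partition_le_iff[OF * \<open>j < n\<close>, of i] \<open>j < n\<close> by simp
  qed
  show "\<pi> = restrict (partition_of f) {..<n}"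
  proof (rule extensionalityI[of _ "{..<n}"])
    fix j assume "j \<in> {..<n}"
    then have "j < n" by simp
    then show "\<pi> j = restrict (partition_of f) {..<n} j"
      using eq[of j "\<pi> j"] eq[of j "partition_of f j"] ran[of j] partition_of_less[of j f] n len by simp
  qed (use \<pi> in \<open>auto simp: partitions_def PiE_def\<close>)
qed

lemma partition_of_in:
  assumes "sum_list (map leaves f) = n"
  shows "restrict (partition_of f) {..<n} \<in> partitions n (length f)"
    "f \<in> Obj (fibres n (length f) (restrict (partition_of f) {..<n}))"
proof -
  have "\<exists>j<n. partition_of f j = i" if "i < length f" for i
  proof -
    have "card {j. j < n \<and> partition_of f j = i} > 0"
      using card_partition_of[of i f] that assms by simp
    then show ?thesis by (auto simp: card_gt_0_iff)
  qed
  then show "restrict (partition_of f) {..<n} \<in> partitions n (length f)"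
    using partition_of_less[of _ f] assms
    by (auto simp: partitions_def mono_on_def intro!: partition_of_mono)
  have "{j. j < n \<and> restrict (partition_of f) {..<n} j = i} = {j. j < n \<and> partition_of f j = i}" for i
    by auto
  then show "f \<in> Obj (fibres n (length f) (restrict (partition_of f) {..<n}))"
    using card_partition_of[of _ f] assms by (simp add: fibres_Obj_iff)
qed

lemma catalan_1cells_eq: "catalan_1cells n k = {f. length f = k \<and> sum_list (map leaves f) = n}"
  unfolding catalan_1cells_def
proof (intro equalityI subsetI)
  fix f assume "f \<in> (\<Union>\<pi> \<in> partitions n k. Obj (fibres n k \<pi>))"
  then obtain \<pi> where "\<pi> \<in> partitions n k" "f \<in> Obj (fibres n k \<pi>)" by blast
  then show "f \<in> {f. length f = k \<and> sum_list (map leaves f) = n}"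
    using partition_unique(1) by (simp add: fibres_Obj_iff)
next
  fix f assume "f \<in> {f. length f = k \<and> sum_list (map leaves f) = n}"
  then have "length f = k" "sum_list (map leaves f) = n" by simp_all
  then show "f \<in> (\<Union>\<pi> \<in> partitions n k. Obj (fibres n k \<pi>))"
    using partition_of_in[of f n] by blast
qed

lemma fibres_Arr_iff:
  "\<phi> \<in> Arr (fibres n k \<pi>) \<longleftrightarrow> list_all avalid \<phi> \<and> map adom \<phi> \<in> Obj (fibres n k \<pi>)"
proof -
  have "fibres n k \<pi> = list_prod_cat (map catalan (map (\<lambda>i. card {j. j < n \<and> \<pi> j = i}) [0..<k]))"
    unfolding fibres_def map_map comp_def ..
  then show ?thesis by (simp only: list_prod_catalan_Obj list_prod_catalan_Arr) (simp add: comp_def)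
qed

lemma catalan_2cells_eq:
  "catalan_2cells n k = {\<phi>. list_all avalid \<phi> \<and> map adom \<phi> \<in> catalan_1cells n k}"
  unfolding catalan_2cells_def catalan_1cells_def by (auto simp: fibres_Arr_iff)

lemma nths_partition_of_Cons:
  assumes "leaves g \<le> length xs"
  shows "nths xs {j. partition_of (g # gs) j = 0} = take (leaves g) xs"
    and "nths xs {j. partition_of (g # gs) j = Suc i} = nths (drop (leaves g) xs) {j. partition_of gs j = i}"
proof -
  have "{j. partition_of (g # gs) j = 0} = {..<leaves g}" by auto
  then show "nths xs {j. partition_of (g # gs) j = 0} = take (leaves g) xs" by simp
  let ?A = "{j. partition_of (g # gs) j = Suc i}"
  have "nths (take (leaves g) xs @ drop (leaves g) xs) ?A =
      nths (take (leaves g) xs) ?A @ nths (drop (leaves g) xs) {j. j + length (take (leaves g) xs) \<in> ?A}"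
    by (rule nths_append)
  moreover have "nths (take (leaves g) xs) ?A = []"
    by (auto simp: nths_def filter_empty_conv set_zip split: if_splits)
  moreover have "{j. j + length (take (leaves g) xs) \<in> ?A} = {j. partition_of gs j = i}"
    using assms by (simp add: min_absorb2)
  ultimately show "nths xs ?A = nths (drop (leaves g) xs) {j. partition_of gs j = i}"
    by simp
qed

lemma hcomp_obj_simps:
  "hcomp_obj [] f = []"
  "leaves g \<le> length f \<Longrightarrow>
     hcomp_obj (g # gs) f = subst_obj g (take (leaves g) f) # hcomp_obj gs (drop (leaves g) f)"
  unfolding hcomp_obj_def
  by (simp_all add: nths_partition_of_Cons map_upt_Suc del: upt_Suc partition_of.simps)

lemma hcomp_arr_simps:
  "hcomp_arr [] \<phi> = []"
  "leaves (adom \<psi>) \<le> length \<phi> \<Longrightarrow>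
     hcomp_arr (\<psi> # \<psi>s) \<phi> =
       subst_arr \<psi> (take (leaves (adom \<psi>)) \<phi>) # hcomp_arr \<psi>s (drop (leaves (adom \<psi>)) \<phi>)"
  unfolding hcomp_arr_def
  by (simp_all add: nths_partition_of_Cons map_upt_Suc del: upt_Suc partition_of.simps)


section \<open>The strict tensor 2-category Cat\<close>

text \<open>
  The cartesian product is made strictly associative as follows. Objects and arrows of a small category are
  tuples, that is lists, of a fixed length \<open>width\<close>, with entries in arbitrary types \<open>'o\<close> and \<open>'m\<close>.
  The product of two categories consists of the concatenated tuples. A category with
  objects in \<open>'o\<close> and arrows in \<open>'m\<close> is a category of width \<open>1\<close>. By \<open>times_cat_iso\<close> below,
  this product is isomorphic to the category of pairs.
\<close>

record ('o, 'm) small_cat = "('o list, 'm list) category" +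
  width :: nat

record ('o, 'm) cat_1cell = "('o list, 'm list, 'o list, 'm list) functor_maps" +
  FSrc :: "('o, 'm) small_cat"
  FTrg :: "('o, 'm) small_cat"

record ('o, 'm) cat_2cell =
  NSrc :: "('o, 'm) cat_1cell"
  NTrg :: "('o, 'm) cat_1cell"
  Component :: "'o list \<Rightarrow> 'm list"

definition is_small_cat :: "('o, 'm) small_cat \<Rightarrow> bool" where
  "is_small_cat C \<longleftrightarrow> category C \<and>
     (\<forall>x \<in> Obj C. length x = width C) \<and> (\<forall>f \<in> Arr C. length f = width C)"

definition is_cat_1cell :: "('o, 'm) cat_1cell \<Rightarrow> bool" where
  "is_cat_1cell F \<longleftrightarrow> is_small_cat (FSrc F) \<and> is_small_cat (FTrg F) \<and> is_functor (FSrc F) (FTrg F) F"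

definition is_cat_2cell :: "('o, 'm) cat_2cell \<Rightarrow> bool" where
  "is_cat_2cell \<tau> \<longleftrightarrow>
     is_cat_1cell (NSrc \<tau>) \<and> is_cat_1cell (NTrg \<tau>) \<and>
     FSrc (NSrc \<tau>) = FSrc (NTrg \<tau>) \<and> FTrg (NSrc \<tau>) = FTrg (NTrg \<tau>) \<and>
     is_nat_trans (FSrc (NSrc \<tau>)) (FTrg (NSrc \<tau>)) (NSrc \<tau>) (NTrg \<tau>) (Component \<tau>)"

definition cat_id1 :: "('o, 'm) small_cat \<Rightarrow> ('o, 'm) cat_1cell" where
  "cat_id1 C = \<lparr>OMap = restrict (\<lambda>x. x) (Obj C), AMap = restrict (\<lambda>f. f) (Arr C), FSrc = C, FTrg = C\<rparr>"

definition cat_comp1 :: "('o, 'm) cat_1cell \<Rightarrow> ('o, 'm) cat_1cell \<Rightarrow> ('o, 'm) cat_1cell" where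
  "cat_comp1 G F =
     \<lparr>OMap = compose (Obj (FSrc F)) (OMap G) (OMap F), AMap = compose (Arr (FSrc F)) (AMap G) (AMap F),
      FSrc = FSrc F, FTrg = FTrg G\<rparr>"

definition cat_id2 :: "('o, 'm) cat_1cell \<Rightarrow> ('o, 'm) cat_2cell" where
  "cat_id2 F =
     \<lparr>NSrc = F, NTrg = F, Component = restrict (\<lambda>x. Id (FTrg F) (OMap F x)) (Obj (FSrc F))\<rparr>"

definition cat_vcomp :: "('o, 'm) cat_2cell \<Rightarrow> ('o, 'm) cat_2cell \<Rightarrow> ('o, 'm) cat_2cell" where
  "cat_vcomp \<sigma> \<tau> =
     \<lparr>NSrc = NSrc \<tau>, NTrg = NTrg \<sigma>,
      Component = restrict (\<lambda>x. Comp (FTrg (NSrc \<tau>)) (Component \<sigma> x) (Component \<tau> x)) (Obj (FSrc (NSrc \<tau>)))\<rparr>"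

definition cat_hcomp :: "('o, 'm) cat_2cell \<Rightarrow> ('o, 'm) cat_2cell \<Rightarrow> ('o, 'm) cat_2cell" where
  "cat_hcomp \<sigma> \<tau> =
     \<lparr>NSrc = cat_comp1 (NSrc \<sigma>) (NSrc \<tau>), NTrg = cat_comp1 (NTrg \<sigma>) (NTrg \<tau>),
      Component = restrict (\<lambda>x. Comp (FTrg (NSrc \<sigma>))
        (Component \<sigma> (OMap (NTrg \<tau>) x)) (AMap (NSrc \<sigma>) (Component \<tau> x))) (Obj (FSrc (NSrc \<tau>)))\<rparr>"

definition times_cat :: "('o, 'm) small_cat \<Rightarrow> ('o, 'm) small_cat \<Rightarrow> ('o, 'm) small_cat" where
  "times_cat C D =
    (let w = width C; B = {x @ y | x y. x \<in> Obj C \<and> y \<in> Obj D};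
         A = {f @ g | f g. f \<in> Arr C \<and> g \<in> Arr D} in
     \<lparr>Obj = B, Arr = A,
      Dom = restrict (\<lambda>f. Dom C (take w f) @ Dom D (drop w f)) A,
      Cod = restrict (\<lambda>f. Cod C (take w f) @ Cod D (drop w f)) A,
      Id = restrict (\<lambda>x. Id C (take w x) @ Id D (drop w x)) B,
      Comp = (\<lambda>g f. if composable C (take w g) (take w f) \<and> composable D (drop w g) (drop w f)
                    then Comp C (take w g) (take w f) @ Comp D (drop w g) (drop w f) else undefined),
      width = w + width D\<rparr>)"

definition times_1cell :: "('o, 'm) cat_1cell \<Rightarrow> ('o, 'm) cat_1cell \<Rightarrow> ('o, 'm) cat_1cell" where
  "times_1cell F G =
    (let C = times_cat (FSrc F) (FSrc G); w = width (FSrc F) in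
     \<lparr>OMap = restrict (\<lambda>x. OMap F (take w x) @ OMap G (drop w x)) (Obj C),
      AMap = restrict (\<lambda>f. AMap F (take w f) @ AMap G (drop w f)) (Arr C),
      FSrc = C, FTrg = times_cat (FTrg F) (FTrg G)\<rparr>)"

definition times_2cell :: "('o, 'm) cat_2cell \<Rightarrow> ('o, 'm) cat_2cell \<Rightarrow> ('o, 'm) cat_2cell" where
  "times_2cell \<sigma> \<tau> =
    (let w = width (FSrc (NSrc \<sigma>)) in
     \<lparr>NSrc = times_1cell (NSrc \<sigma>) (NSrc \<tau>), NTrg = times_1cell (NTrg \<sigma>) (NTrg \<tau>),
      Component = restrict (\<lambda>x. Component \<sigma> (take w x) @ Component \<tau> (drop w x))
        (Obj (times_cat (FSrc (NSrc \<sigma>)) (FSrc (NSrc \<tau>))))\<rparr>)"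

definition cat_2cat :: "(('o, 'm) small_cat, ('o, 'm) cat_1cell, ('o, 'm) cat_2cell) tensor_2cat" where
  "cat_2cat =
     \<lparr>Cell0 = Collect is_small_cat, Cell1 = Collect is_cat_1cell, Cell2 = Collect is_cat_2cell,
      Src1 = FSrc, Trg1 = FTrg, Src2 = NSrc, Trg2 = NTrg,
      Id1 = cat_id1, Id2 = cat_id2,
      HComp1 = cat_comp1, VComp = cat_vcomp, HComp2 = cat_hcomp,
      Ten0 = times_cat, Ten1 = times_1cell, Ten2 = times_2cell\<rparr>"

lemma times_cat_simps:
  assumes C: "is_small_cat C" and D: "is_small_cat D"
  shows "x \<in> Obj C \<Longrightarrow> y \<in> Obj D \<Longrightarrow> x @ y \<in> Obj (times_cat C D)"
    and "f \<in> Arr C \<Longrightarrow> f' \<in> Arr D \<Longrightarrow> f @ f' \<in> Arr (times_cat C D)"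
    and "f \<in> Arr C \<Longrightarrow> f' \<in> Arr D \<Longrightarrow> Dom (times_cat C D) (f @ f') = Dom C f @ Dom D f'"
    and "f \<in> Arr C \<Longrightarrow> f' \<in> Arr D \<Longrightarrow> Cod (times_cat C D) (f @ f') = Cod C f @ Cod D f'"
    and "x \<in> Obj C \<Longrightarrow> y \<in> Obj D \<Longrightarrow> Id (times_cat C D) (x @ y) = Id C x @ Id D y"
    and "composable C g f \<Longrightarrow> composable D g' f' \<Longrightarrow>
      Comp (times_cat C D) (g @ g') (f @ f') = Comp C g f @ Comp D g' f'"
  using C D by (auto simp: times_cat_def Let_def is_small_cat_def composable_def)

lemma is_small_cat_times:
  assumes C: "is_small_cat C" and D: "is_small_cat D"
  shows "is_small_cat (times_cat C D)"
proof -
  have cats: "category C" "category D" using C D by (simp_all add: is_small_cat_def)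
  note cD = categoryD[OF cats(1)] categoryD[OF cats(2)]
  have len: "\<And>x. x \<in> Obj C \<Longrightarrow> length x = width C" "\<And>f. f \<in> Arr C \<Longrightarrow> length f = width C"
    "\<And>x. x \<in> Obj D \<Longrightarrow> length x = width D" "\<And>f. f \<in> Arr D \<Longrightarrow> length f = width D"
    using C D by (simp_all add: is_small_cat_def)
  note ts = times_cat_simps[OF C D]
  let ?T = "times_cat C D"
  have A: "\<exists>f' f''. f = f' @ f'' \<and> f' \<in> Arr C \<and> f'' \<in> Arr D" if "f \<in> Arr ?T" for f
    using that by (auto simp: times_cat_def Let_def)
  have O: "\<exists>x' x''. x = x' @ x'' \<and> x' \<in> Obj C \<and> x'' \<in> Obj D" if "x \<in> Obj ?T" for x
    using that by (auto simp: times_cat_def Let_def)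
  have comp: "composable ?T (g @ g') (f @ f') \<longleftrightarrow> composable C g f \<and> composable D g' f'"
    if "f \<in> Arr C" "f' \<in> Arr D" "g \<in> Arr C" "g' \<in> Arr D" for f f' g g'
    using that ts(2-4) cD(1,2) len(1) by (simp add: composable_def)
  have compE: "\<exists>g' g'' f' f''. g = g' @ g'' \<and> f = f' @ f'' \<and> composable C g' f' \<and> composable D g'' f''"
    if "composable ?T g f" for g f
  proof -
    have "g \<in> Arr ?T" "f \<in> Arr ?T" using that by (simp_all add: composable_def)
    then obtain g' g'' f' f'' where "g = g' @ g''" "g' \<in> Arr C" "g'' \<in> Arr D"
      "f = f' @ f''" "f' \<in> Arr C" "f'' \<in> Arr D" using A by meson
    then show ?thesis using that comp by blast
  qed
  have cArr: "composable C g f \<Longrightarrow> g \<in> Arr C \<and> f \<in> Arr C" "composable D g f \<Longrightarrow> g \<in> Arr D \<and> f \<in> Arr D" for g f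
    by (simp_all add: composable_def)
  have "category ?T"
  proof (rule categoryI)
    fix g f assume "\<not> composable ?T g f"
    moreover have "composable ?T g f" if *: "composable C (take (width C) g) (take (width C) f)"
      "composable D (drop (width C) g) (drop (width C) f)"
      using comp[of "take (width C) f" "drop (width C) f" "take (width C) g" "drop (width C) g"] *
        cArr(1)[OF *(1)] cArr(2)[OF *(2)] by simp
    ultimately show "Comp ?T g f = undefined" by (auto simp: times_cat_def Let_def)
  next
    fix g f assume "composable ?T g f"
    then obtain g' g'' f' f'' where *: "g = g' @ g''" "f = f' @ f''" "composable C g' f'" "composable D g'' f''"
      using compE by meson
    then show "Comp ?T g f \<in> hom ?T (Dom ?T f) (Cod ?T g)"
      using cArr(1)[OF *(3)] cArr(2)[OF *(4)] ts(2-6) cD(6-8)[OF *(3)] cD(17-19)[OF *(4)]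
      by (simp add: hom_def)
  next
    fix h g f assume hg: "composable ?T h g" and gf: "composable ?T g f"
    obtain h' h'' g' g'' where *: "h = h' @ h''" "g = g' @ g''" "composable C h' g'" "composable D h'' g''"
      using compE[OF hg] by blast
    have "f \<in> Arr ?T" using gf by (simp add: composable_def)
    then obtain f' f'' where f: "f = f' @ f''" "f' \<in> Arr C" "f'' \<in> Arr D" using A by meson
    have **: "composable C g' f'" "composable D g'' f''"
      using gf comp f * cArr by blast+
    have "composable C h' (Comp C g' f')" "composable D h'' (Comp D g'' f'')"
      "composable C (Comp C h' g') f'" "composable D (Comp D h'' g'') f''"
      using * ** cD(6-8) cD(17-19) by (simp_all add: composable_def)
    then show "Comp ?T h (Comp ?T g f) = Comp ?T (Comp ?T h g) f"
      using * ** f ts(6) cD(11)[OF *(3) **(1)] cD(22)[OF *(4) **(2)] by simp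
  next
    fix f assume "f \<in> Arr ?T"
    then obtain f' f'' where f: "f = f' @ f''" "f' \<in> Arr C" "f'' \<in> Arr D" using A by meson
    then have "composable C f' (Id C (Dom C f'))" "composable D f'' (Id D (Dom D f''))"
      "composable C (Id C (Cod C f')) f'" "composable D (Id D (Cod D f'')) f''"
      using cD by (simp_all add: composable_def)
    then show "Comp ?T f (Id ?T (Dom ?T f)) = f" "Comp ?T (Id ?T (Cod ?T f)) f = f"
      using f ts cD by simp_all
  next
    have "Dom ?T f \<in> Obj ?T" "Cod ?T f \<in> Obj ?T" if "f \<in> Arr ?T" for f
      using A[OF that] ts(1,3,4) cD(1,2,12,13) by auto
    then show "Dom ?T \<in> Arr ?T \<rightarrow>\<^sub>E Obj ?T" "Cod ?T \<in> Arr ?T \<rightarrow>\<^sub>E Obj ?T"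
      by (simp_all add: PiE_iff) (simp_all add: times_cat_def Let_def)
  next
    have "Id ?T x \<in> Arr ?T" if "x \<in> Obj ?T" for x
      using O[OF that] ts(2,5) cD(3,14) by auto
    then show "Id ?T \<in> Obj ?T \<rightarrow>\<^sub>E Arr ?T"
      by (simp add: PiE_iff) (simp add: times_cat_def Let_def)
  next
    fix x assume "x \<in> Obj ?T"
    then obtain x' x'' where "x = x' @ x''" "x' \<in> Obj C" "x'' \<in> Obj D" using O by meson
    then show "Dom ?T (Id ?T x) = x" "Cod ?T (Id ?T x) = x"
      using ts(3-5) cD(3-5,14-16) by simp_all
  qed
  then show ?thesis
    using len by (auto simp: is_small_cat_def) (auto simp: times_cat_def Let_def)
qed

lemma times_cat_iso:
  assumes C: "is_small_cat C" and D: "is_small_cat D"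
  defines "F \<equiv> \<lparr>OMap = restrict (\<lambda>(x, y). x @ y) (Obj C \<times> Obj D),
                AMap = restrict (\<lambda>(f, g). f @ g) (Arr C \<times> Arr D)\<rparr>"
  shows "is_functor (C \<times>\<^sub>C D) (times_cat C D) F"
    and "bij_betw (OMap F) (Obj (C \<times>\<^sub>C D)) (Obj (times_cat C D))"
    and "bij_betw (AMap F) (Arr (C \<times>\<^sub>C D)) (Arr (times_cat C D))"
proof -
  have cats: "category C" "category D" using C D by (simp_all add: is_small_cat_def)
  note ts = times_cat_simps[OF C D]
  show "is_functor (C \<times>\<^sub>C D) (times_cat C D) F"
  proof (rule is_functorI)
    fix g f assume "composable (C \<times>\<^sub>C D) g f"
    moreover obtain g' g'' f' f'' where gf: "g = (g', g'')" "f = (f', f'')" by (cases g; cases f)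
    ultimately have *: "composable C g' f'" "composable D g'' f''" by simp_all
    then have "g' \<in> Arr C" "f' \<in> Arr C" "g'' \<in> Arr D" "f'' \<in> Arr D" by (simp_all add: composable_def)
    then show "AMap F (Comp (C \<times>\<^sub>C D) g f) = Comp (times_cat C D) (AMap F g) (AMap F f)"
      using * gf ts(6)[OF *] categoryD(6)[OF cats(1) *(1)] categoryD(6)[OF cats(2) *(2)]
      by (simp add: F_def)
  qed (use cats is_small_cat_times[OF C D] ts categoryD[OF cats(1)] categoryD[OF cats(2)] in
      \<open>auto simp: F_def category_prod is_small_cat_def\<close>)
  show "bij_betw (OMap F) (Obj (C \<times>\<^sub>C D)) (Obj (times_cat C D))"
    using C D by (force simp: bij_betw_def inj_on_def F_def times_cat_def Let_def is_small_cat_def)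
  show "bij_betw (AMap F) (Arr (C \<times>\<^sub>C D)) (Arr (times_cat C D))"
    using C D by (force simp: bij_betw_def inj_on_def F_def times_cat_def Let_def is_small_cat_def)
qed


section \<open>Associative categories and strict tensor functors\<close>

record ('o, 'm) assoc_cat =
  Base :: "('o, 'm) small_cat"
  Tensor :: "('o, 'm) cat_1cell"
  Assoc :: "('o, 'm) cat_2cell"

text \<open>
  \<open>x @ y\<close> is the object \<open>(x, y)\<close> of \<open>B \<times> B\<close>; the component of \<open>\<beta>\<close> at
  \<open>(x, y, z)\<close> is that at \<open>x @ y @ z\<close>.
\<close>

definition is_assoc_cat :: "('o, 'm) assoc_cat \<Rightarrow> bool" where
  "is_assoc_cat B \<longleftrightarrow>
    (let C = Base B; T = Tensor B; \<beta> = Assoc B in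
     is_small_cat C \<and>
     is_cat_1cell T \<and> FSrc T = times_cat C C \<and> FTrg T = C \<and>
     is_cat_2cell \<beta> \<and>
     NSrc \<beta> = cat_comp1 T (times_1cell (cat_id1 C) T) \<and>
     NTrg \<beta> = cat_comp1 T (times_1cell T (cat_id1 C)) \<and>
     (\<forall>x \<in> Obj C. \<forall>y \<in> Obj C. \<forall>z \<in> Obj C. iso C (Component \<beta> (x @ y @ z))))"

definition is_strict_tensor_functor ::
  "('o, 'm) assoc_cat \<Rightarrow> ('o, 'm) assoc_cat \<Rightarrow> ('o, 'm) cat_1cell \<Rightarrow> bool" where
  "is_strict_tensor_functor B B' F \<longleftrightarrow>
     is_assoc_cat B \<and> is_assoc_cat B' \<and>
     is_cat_1cell F \<and> FSrc F = Base B \<and> FTrg F = Base B' \<and>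
     (\<forall>x \<in> Obj (Base B). \<forall>y \<in> Obj (Base B).
        OMap F (OMap (Tensor B) (x @ y)) = OMap (Tensor B') (OMap F x @ OMap F y)) \<and>
     (\<forall>f \<in> Arr (Base B). \<forall>g \<in> Arr (Base B).
        AMap F (AMap (Tensor B) (f @ g)) = AMap (Tensor B') (AMap F f @ AMap F g)) \<and>
     (\<forall>x \<in> Obj (Base B). \<forall>y \<in> Obj (Base B). \<forall>z \<in> Obj (Base B).
        AMap F (Component (Assoc B) (x @ y @ z)) =
          Component (Assoc B') (OMap F x @ OMap F y @ OMap F z))"

definition Assoc_Cat_st ::
  "(('o, 'm) assoc_cat, ('o, 'm) assoc_cat \<times> ('o, 'm) assoc_cat \<times> ('o, 'm) cat_1cell) category" where
  "Assoc_Cat_st =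
    (let Bs = Collect is_assoc_cat; Fs = {(B, B', F). is_strict_tensor_functor B B' F} in
     \<lparr>Obj = Bs, Arr = Fs,
      Dom = restrict (\<lambda>(B, B', F). B) Fs, Cod = restrict (\<lambda>(B, B', F). B') Fs,
      Id = restrict (\<lambda>B. (B, B, cat_id1 (Base B))) Bs,
      Comp = (\<lambda>(B', B'', G) (B, C', F). if (B', B'', G) \<in> Fs \<and> (B, C', F) \<in> Fs \<and> C' = B'
        then (B, B'', cat_comp1 G F) else undefined)\<rparr>)"

end

theory Submission
  imports Defs
begin

text \<open>
  A strict tensor 2-functor \<open>R\<close> on \<open>\<^bold>A\<close> is determined by the category \<open>R(1)\<close>, the functor
  \<open>R(U(*, *))\<close> and the natural isomorphism \<open>R(V(*, *, *, \<iota>))\<close>: every tree and every arrow is obtained from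
  these two by substitution, tensor and vertical composition. Conversely an associative category interprets
  trees as iterated tensor products and formal arrows as composites of the associator and its inverse. This
  respects the congruence on formal arrows because each of its clauses is an instance of a strict 2-category
  law (no coherence of the associator is involved), and it sends substitution to horizontal composition.
  In the same way a 2-natural transformation is determined by its component \<open>F(1)\<close>, since
  \<open>F(n) = F(1)\<^sup>n\<close>, and naturality propagates from the two generators to all cells. The equivalence
  is therefore even an isomorphism of categories. Only the laws of a strict tensor 2-category are used for
  this, together with a strict unit for \<open>\<times>\<close>, which in \<open>\<^bold>C\<^bold>a\<^bold>t\<close> is the
  terminal category of width \<open>0\<close>.
\<close>

section \<open>Strict tensor 2-categories with a strict unit\<close>

text \<open>Arrows of the Catalan groupoids are classes of formal composites, so nothing can be
  defined on them by recursion directly. An associative object is therefore evaluated on raw terms,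
  and the passage to the quotient is one induction over the congruence. Formal terms also contain
  the inverse of \<iota>, while an associative category names only one direction of its associator:
  the inverse is carried along as a separate parameter, and its uniqueness enters where naturality
  is transferred to it.

  The 2-category A has no 0-cell 0, yet lists are most easily evaluated from the empty list upwards;
  the unit of the target gives the empty list a value. A given 2-functor, on the other hand, has no
  value there, so inductions about it start at singletons.

  That a 2-functor is determined by its values on the generators is the case of an identity
  component in the propagation of naturality. Since all data are undefined off their carriers,
  agreement of values is equality of records, and bijections on objects and on arrows are
  enough.\<close>

locale tensor_2category =
  fixes Y :: "('y, 'g, 'u) tensor_2cat" and unit0 :: 'y
  assumes Src1_in [simp]: "f \<in> Cell1 Y \<Longrightarrow> Src1 Y f \<in> Cell0 Y"
    and Trg1_in [simp]: "f \<in> Cell1 Y \<Longrightarrow> Trg1 Y f \<in> Cell0 Y"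
    and Src2_in [simp]: "\<phi> \<in> Cell2 Y \<Longrightarrow> Src2 Y \<phi> \<in> Cell1 Y"
    and Trg2_in [simp]: "\<phi> \<in> Cell2 Y \<Longrightarrow> Trg2 Y \<phi> \<in> Cell1 Y"
    and Src1_Trg2 [simp]: "\<phi> \<in> Cell2 Y \<Longrightarrow> Src1 Y (Trg2 Y \<phi>) = Src1 Y (Src2 Y \<phi>)"
    and Trg1_Trg2 [simp]: "\<phi> \<in> Cell2 Y \<Longrightarrow> Trg1 Y (Trg2 Y \<phi>) = Trg1 Y (Src2 Y \<phi>)"
    and Id1 [simp]: "x \<in> Cell0 Y \<Longrightarrow> Id1 Y x \<in> Cell1 Y"
      "x \<in> Cell0 Y \<Longrightarrow> Src1 Y (Id1 Y x) = x" "x \<in> Cell0 Y \<Longrightarrow> Trg1 Y (Id1 Y x) = x"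
    and Id2 [simp]: "f \<in> Cell1 Y \<Longrightarrow> Id2 Y f \<in> Cell2 Y"
      "f \<in> Cell1 Y \<Longrightarrow> Src2 Y (Id2 Y f) = f" "f \<in> Cell1 Y \<Longrightarrow> Trg2 Y (Id2 Y f) = f"
    and HComp1 [simp]:
      "g \<in> Cell1 Y \<Longrightarrow> f \<in> Cell1 Y \<Longrightarrow> Src1 Y g = Trg1 Y f \<Longrightarrow> HComp1 Y g f \<in> Cell1 Y"
      "g \<in> Cell1 Y \<Longrightarrow> f \<in> Cell1 Y \<Longrightarrow> Src1 Y g = Trg1 Y f \<Longrightarrow> Src1 Y (HComp1 Y g f) = Src1 Y f"
      "g \<in> Cell1 Y \<Longrightarrow> f \<in> Cell1 Y \<Longrightarrow> Src1 Y g = Trg1 Y f \<Longrightarrow> Trg1 Y (HComp1 Y g f) = Trg1 Y g"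
    and VComp [simp]:
      "\<psi> \<in> Cell2 Y \<Longrightarrow> \<phi> \<in> Cell2 Y \<Longrightarrow> Src2 Y \<psi> = Trg2 Y \<phi> \<Longrightarrow> VComp Y \<psi> \<phi> \<in> Cell2 Y"
      "\<psi> \<in> Cell2 Y \<Longrightarrow> \<phi> \<in> Cell2 Y \<Longrightarrow> Src2 Y \<psi> = Trg2 Y \<phi> \<Longrightarrow> Src2 Y (VComp Y \<psi> \<phi>) = Src2 Y \<phi>"
      "\<psi> \<in> Cell2 Y \<Longrightarrow> \<phi> \<in> Cell2 Y \<Longrightarrow> Src2 Y \<psi> = Trg2 Y \<phi> \<Longrightarrow> Trg2 Y (VComp Y \<psi> \<phi>) = Trg2 Y \<psi>"
    and HComp2 [simp]:
      "\<psi> \<in> Cell2 Y \<Longrightarrow> \<phi> \<in> Cell2 Y \<Longrightarrow> Src1 Y (Src2 Y \<psi>) = Trg1 Y (Src2 Y \<phi>) \<Longrightarrow> HComp2 Y \<psi> \<phi> \<in> Cell2 Y"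
      "\<psi> \<in> Cell2 Y \<Longrightarrow> \<phi> \<in> Cell2 Y \<Longrightarrow> Src1 Y (Src2 Y \<psi>) = Trg1 Y (Src2 Y \<phi>) \<Longrightarrow>
        Src2 Y (HComp2 Y \<psi> \<phi>) = HComp1 Y (Src2 Y \<psi>) (Src2 Y \<phi>)"
      "\<psi> \<in> Cell2 Y \<Longrightarrow> \<phi> \<in> Cell2 Y \<Longrightarrow> Src1 Y (Src2 Y \<psi>) = Trg1 Y (Src2 Y \<phi>) \<Longrightarrow>
        Trg2 Y (HComp2 Y \<psi> \<phi>) = HComp1 Y (Trg2 Y \<psi>) (Trg2 Y \<phi>)"
    and unit0_in [simp]: "unit0 \<in> Cell0 Y"
    and Ten0_in [simp]: "x \<in> Cell0 Y \<Longrightarrow> y \<in> Cell0 Y \<Longrightarrow> Ten0 Y x y \<in> Cell0 Y"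
    and Ten1 [simp]: "f \<in> Cell1 Y \<Longrightarrow> g \<in> Cell1 Y \<Longrightarrow> Ten1 Y f g \<in> Cell1 Y"
      "f \<in> Cell1 Y \<Longrightarrow> g \<in> Cell1 Y \<Longrightarrow> Src1 Y (Ten1 Y f g) = Ten0 Y (Src1 Y f) (Src1 Y g)"
      "f \<in> Cell1 Y \<Longrightarrow> g \<in> Cell1 Y \<Longrightarrow> Trg1 Y (Ten1 Y f g) = Ten0 Y (Trg1 Y f) (Trg1 Y g)"
    and Ten2 [simp]: "\<phi> \<in> Cell2 Y \<Longrightarrow> \<psi> \<in> Cell2 Y \<Longrightarrow> Ten2 Y \<phi> \<psi> \<in> Cell2 Y"
      "\<phi> \<in> Cell2 Y \<Longrightarrow> \<psi> \<in> Cell2 Y \<Longrightarrow> Src2 Y (Ten2 Y \<phi> \<psi>) = Ten1 Y (Src2 Y \<phi>) (Src2 Y \<psi>)"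
      "\<phi> \<in> Cell2 Y \<Longrightarrow> \<psi> \<in> Cell2 Y \<Longrightarrow> Trg2 Y (Ten2 Y \<phi> \<psi>) = Ten1 Y (Trg2 Y \<phi>) (Trg2 Y \<psi>)"
    and HComp1_assoc: "h \<in> Cell1 Y \<Longrightarrow> g \<in> Cell1 Y \<Longrightarrow> f \<in> Cell1 Y \<Longrightarrow>
        Src1 Y h = Trg1 Y g \<Longrightarrow> Src1 Y g = Trg1 Y f \<Longrightarrow>
        HComp1 Y (HComp1 Y h g) f = HComp1 Y h (HComp1 Y g f)"
    and HComp1_Id1 [simp]: "f \<in> Cell1 Y \<Longrightarrow> Trg1 Y f = x \<Longrightarrow> HComp1 Y (Id1 Y x) f = f"
      "f \<in> Cell1 Y \<Longrightarrow> Src1 Y f = x \<Longrightarrow> HComp1 Y f (Id1 Y x) = f"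
    and VComp_assoc: "\<chi> \<in> Cell2 Y \<Longrightarrow> \<psi> \<in> Cell2 Y \<Longrightarrow> \<phi> \<in> Cell2 Y \<Longrightarrow>
        Src2 Y \<chi> = Trg2 Y \<psi> \<Longrightarrow> Src2 Y \<psi> = Trg2 Y \<phi> \<Longrightarrow>
        VComp Y (VComp Y \<chi> \<psi>) \<phi> = VComp Y \<chi> (VComp Y \<psi> \<phi>)"
    and VComp_Id2 [simp]: "\<phi> \<in> Cell2 Y \<Longrightarrow> Trg2 Y \<phi> = f \<Longrightarrow> VComp Y (Id2 Y f) \<phi> = \<phi>"
      "\<phi> \<in> Cell2 Y \<Longrightarrow> Src2 Y \<phi> = f \<Longrightarrow> VComp Y \<phi> (Id2 Y f) = \<phi>"
    and HComp2_assoc: "\<chi> \<in> Cell2 Y \<Longrightarrow> \<psi> \<in> Cell2 Y \<Longrightarrow> \<phi> \<in> Cell2 Y \<Longrightarrow>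
        Src1 Y (Src2 Y \<chi>) = Trg1 Y (Src2 Y \<psi>) \<Longrightarrow> Src1 Y (Src2 Y \<psi>) = Trg1 Y (Src2 Y \<phi>) \<Longrightarrow>
        HComp2 Y (HComp2 Y \<chi> \<psi>) \<phi> = HComp2 Y \<chi> (HComp2 Y \<psi> \<phi>)"
    and HComp2_Id1 [simp]: "\<phi> \<in> Cell2 Y \<Longrightarrow> Trg1 Y (Src2 Y \<phi>) = x \<Longrightarrow> HComp2 Y (Id2 Y (Id1 Y x)) \<phi> = \<phi>"
      "\<phi> \<in> Cell2 Y \<Longrightarrow> Src1 Y (Src2 Y \<phi>) = x \<Longrightarrow> HComp2 Y \<phi> (Id2 Y (Id1 Y x)) = \<phi>"
    and HComp2_Id2: "g \<in> Cell1 Y \<Longrightarrow> f \<in> Cell1 Y \<Longrightarrow> Src1 Y g = Trg1 Y f \<Longrightarrow>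
        HComp2 Y (Id2 Y g) (Id2 Y f) = Id2 Y (HComp1 Y g f)"
    and HComp2_VComp: "\<psi> \<in> Cell2 Y \<Longrightarrow> \<phi> \<in> Cell2 Y \<Longrightarrow> \<psi>' \<in> Cell2 Y \<Longrightarrow> \<phi>' \<in> Cell2 Y \<Longrightarrow>
        Src2 Y \<psi> = Trg2 Y \<phi> \<Longrightarrow> Src2 Y \<psi>' = Trg2 Y \<phi>' \<Longrightarrow> Src1 Y (Src2 Y \<phi>) = Trg1 Y (Src2 Y \<phi>') \<Longrightarrow>
        HComp2 Y (VComp Y \<psi> \<phi>) (VComp Y \<psi>' \<phi>') = VComp Y (HComp2 Y \<psi> \<psi>') (HComp2 Y \<phi> \<phi>')"
    and Ten0_assoc: "x \<in> Cell0 Y \<Longrightarrow> y \<in> Cell0 Y \<Longrightarrow> z \<in> Cell0 Y \<Longrightarrow>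
        Ten0 Y (Ten0 Y x y) z = Ten0 Y x (Ten0 Y y z)"
    and Ten1_assoc: "f \<in> Cell1 Y \<Longrightarrow> g \<in> Cell1 Y \<Longrightarrow> h \<in> Cell1 Y \<Longrightarrow>
        Ten1 Y (Ten1 Y f g) h = Ten1 Y f (Ten1 Y g h)"
    and Ten2_assoc: "\<phi> \<in> Cell2 Y \<Longrightarrow> \<psi> \<in> Cell2 Y \<Longrightarrow> \<chi> \<in> Cell2 Y \<Longrightarrow>
        Ten2 Y (Ten2 Y \<phi> \<psi>) \<chi> = Ten2 Y \<phi> (Ten2 Y \<psi> \<chi>)"
    and Ten0_unit [simp]: "x \<in> Cell0 Y \<Longrightarrow> Ten0 Y unit0 x = x" "x \<in> Cell0 Y \<Longrightarrow> Ten0 Y x unit0 = x"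
    and Ten1_unit [simp]: "f \<in> Cell1 Y \<Longrightarrow> Ten1 Y (Id1 Y unit0) f = f"
      "f \<in> Cell1 Y \<Longrightarrow> Ten1 Y f (Id1 Y unit0) = f"
    and Ten2_unit [simp]: "\<phi> \<in> Cell2 Y \<Longrightarrow> Ten2 Y (Id2 Y (Id1 Y unit0)) \<phi> = \<phi>"
      "\<phi> \<in> Cell2 Y \<Longrightarrow> Ten2 Y \<phi> (Id2 Y (Id1 Y unit0)) = \<phi>"
    and Ten1_Id1: "x \<in> Cell0 Y \<Longrightarrow> y \<in> Cell0 Y \<Longrightarrow> Ten1 Y (Id1 Y x) (Id1 Y y) = Id1 Y (Ten0 Y x y)"
    and Ten2_Id2: "f \<in> Cell1 Y \<Longrightarrow> g \<in> Cell1 Y \<Longrightarrow> Ten2 Y (Id2 Y f) (Id2 Y g) = Id2 Y (Ten1 Y f g)"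
    and Ten1_HComp1: "g \<in> Cell1 Y \<Longrightarrow> f \<in> Cell1 Y \<Longrightarrow> g' \<in> Cell1 Y \<Longrightarrow> f' \<in> Cell1 Y \<Longrightarrow>
        Src1 Y g = Trg1 Y f \<Longrightarrow> Src1 Y g' = Trg1 Y f' \<Longrightarrow>
        Ten1 Y (HComp1 Y g f) (HComp1 Y g' f') = HComp1 Y (Ten1 Y g g') (Ten1 Y f f')"
    and Ten2_VComp: "\<psi> \<in> Cell2 Y \<Longrightarrow> \<phi> \<in> Cell2 Y \<Longrightarrow> \<psi>' \<in> Cell2 Y \<Longrightarrow> \<phi>' \<in> Cell2 Y \<Longrightarrow>
        Src2 Y \<psi> = Trg2 Y \<phi> \<Longrightarrow> Src2 Y \<psi>' = Trg2 Y \<phi>' \<Longrightarrow>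
        Ten2 Y (VComp Y \<psi> \<phi>) (VComp Y \<psi>' \<phi>') = VComp Y (Ten2 Y \<psi> \<psi>') (Ten2 Y \<phi> \<phi>')"
    and Ten2_HComp2: "\<psi> \<in> Cell2 Y \<Longrightarrow> \<phi> \<in> Cell2 Y \<Longrightarrow> \<psi>' \<in> Cell2 Y \<Longrightarrow> \<phi>' \<in> Cell2 Y \<Longrightarrow>
        Src1 Y (Src2 Y \<psi>) = Trg1 Y (Src2 Y \<phi>) \<Longrightarrow> Src1 Y (Src2 Y \<psi>') = Trg1 Y (Src2 Y \<phi>') \<Longrightarrow>
        Ten2 Y (HComp2 Y \<psi> \<phi>) (HComp2 Y \<psi>' \<phi>') = HComp2 Y (Ten2 Y \<psi> \<psi>') (Ten2 Y \<phi> \<phi>')"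
begin

abbreviation hcomp1 (infixr "\<odot>" 70) where "g \<odot> f \<equiv> HComp1 Y g f"
abbreviation hcomp2 (infixr "\<star>" 70) where "\<psi> \<star> \<phi> \<equiv> HComp2 Y \<psi> \<phi>"
abbreviation vcomp (infixr "\<bullet>" 60) where "\<psi> \<bullet> \<phi> \<equiv> VComp Y \<psi> \<phi>"
abbreviation ten0 (infixr "\<otimes>\<^sub>0" 75) where "x \<otimes>\<^sub>0 y \<equiv> Ten0 Y x y"
abbreviation ten1 (infixr "\<otimes>\<^sub>1" 75) where "f \<otimes>\<^sub>1 g \<equiv> Ten1 Y f g"
abbreviation ten2 (infixr "\<otimes>\<^sub>2" 75) where "\<phi> \<otimes>\<^sub>2 \<psi> \<equiv> Ten2 Y \<phi> \<psi>"

text \<open>The base case is what the strict unit is for: it gives a source and a target to the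
  value of the empty list, although 0 is not a 0-cell of A.\<close>

primrec pow0 :: "'y \<Rightarrow> nat \<Rightarrow> 'y" where
  "pow0 x 0 = unit0"
| "pow0 x (Suc n) = x \<otimes>\<^sub>0 pow0 x n"

primrec pow1 :: "'g \<Rightarrow> nat \<Rightarrow> 'g" where
  "pow1 F 0 = Id1 Y unit0"
| "pow1 F (Suc n) = F \<otimes>\<^sub>1 pow1 F n"

lemma pow0_in [simp]: "x \<in> Cell0 Y \<Longrightarrow> pow0 x n \<in> Cell0 Y"
  by (induction n) auto

lemma pow0_add: "x \<in> Cell0 Y \<Longrightarrow> pow0 x (m + n) = pow0 x m \<otimes>\<^sub>0 pow0 x n"
  by (induction m) (auto simp: Ten0_assoc)

lemma pow1_type [simp]:
  assumes "F \<in> Cell1 Y"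
  shows "pow1 F n \<in> Cell1 Y" "Src1 Y (pow1 F n) = pow0 (Src1 Y F) n" "Trg1 Y (pow1 F n) = pow0 (Trg1 Y F) n"
proof -
  have "pow1 F n \<in> Cell1 Y \<and> Src1 Y (pow1 F n) = pow0 (Src1 Y F) n \<and> Trg1 Y (pow1 F n) = pow0 (Trg1 Y F) n"
    using assms by (induction n) auto
  then show "pow1 F n \<in> Cell1 Y" "Src1 Y (pow1 F n) = pow0 (Src1 Y F) n" "Trg1 Y (pow1 F n) = pow0 (Trg1 Y F) n"
    by auto
qed

lemma pow1_add: "F \<in> Cell1 Y \<Longrightarrow> pow1 F (m + n) = pow1 F m \<otimes>\<^sub>1 pow1 F n"
  by (induction m) (auto simp: Ten1_assoc)

text \<open>The interchange law, with \<open>Id2 Y g\<close> read as the vertical composite of two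
  copies of itself.\<close>

lemma whisker_VComp:
  "g \<in> Cell1 Y \<Longrightarrow> \<psi> \<in> Cell2 Y \<Longrightarrow> \<phi> \<in> Cell2 Y \<Longrightarrow> Src2 Y \<psi> = Trg2 Y \<phi> \<Longrightarrow>
   Src1 Y g = Trg1 Y (Src2 Y \<phi>) \<Longrightarrow> Id2 Y g \<star> (\<psi> \<bullet> \<phi>) = (Id2 Y g \<star> \<psi>) \<bullet> (Id2 Y g \<star> \<phi>)"
  "g \<in> Cell1 Y \<Longrightarrow> \<psi> \<in> Cell2 Y \<Longrightarrow> \<phi> \<in> Cell2 Y \<Longrightarrow> Src2 Y \<psi> = Trg2 Y \<phi> \<Longrightarrow>
   Src1 Y (Src2 Y \<phi>) = Trg1 Y g \<Longrightarrow> (\<psi> \<bullet> \<phi>) \<star> Id2 Y g = (\<psi> \<star> Id2 Y g) \<bullet> (\<phi> \<star> Id2 Y g)"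
  by (simp_all flip: HComp2_VComp)

lemma pow1_Id1: "x \<in> Cell0 Y \<Longrightarrow> pow1 (Id1 Y x) n = Id1 Y (pow0 x n)"
  by (induction n) (auto simp: Ten1_Id1)

end

section \<open>The 2-functor generated by an associative object\<close>

text \<open>An associative category internal to \<open>Y\<close>. The inverse
  \<open>\<beta>'\<close> is a parameter because \<open>ev2\<close> must give a value to the formal
  arrows whose last argument is \<open>(True, False)\<close>.\<close>

locale assoc_object = tensor_2category +
  fixes c T \<beta> \<beta>'
  assumes c_in [simp]: "c \<in> Cell0 Y"
    and T_type [simp]: "T \<in> Cell1 Y" "Src1 Y T = c \<otimes>\<^sub>0 c" "Trg1 Y T = c"
    and beta_type [simp]: "\<beta> \<in> Cell2 Y" "Src2 Y \<beta> = T \<odot> (Id1 Y c \<otimes>\<^sub>1 T)" "Trg2 Y \<beta> = T \<odot> (T \<otimes>\<^sub>1 Id1 Y c)"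
    and beta'_type [simp]: "\<beta>' \<in> Cell2 Y" "Src2 Y \<beta>' = T \<odot> (T \<otimes>\<^sub>1 Id1 Y c)" "Trg2 Y \<beta>' = T \<odot> (Id1 Y c \<otimes>\<^sub>1 T)"
    and beta_inverse: "\<beta>' \<bullet> \<beta> = Id2 Y (T \<odot> (Id1 Y c \<otimes>\<^sub>1 T))" "\<beta> \<bullet> \<beta>' = Id2 Y (T \<odot> (T \<otimes>\<^sub>1 Id1 Y c))"
begin

section \<open>Evaluation of trees and formal arrows\<close>

primrec ev1 :: "tree \<Rightarrow> 'b" where
  "ev1 Leaf = Id1 Y c"
| "ev1 (Node f g) = T \<odot> (ev1 f \<otimes>\<^sub>1 ev1 g)"

primrec ev1s :: "tree list \<Rightarrow> 'b" where
  "ev1s [] = Id1 Y unit0"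
| "ev1s (f # fs) = ev1 f \<otimes>\<^sub>1 ev1s fs"

text \<open>The value of \<open>bracket x Leaf Leaf Leaf\<close> once the unit laws have removed the
  identities, in exactly the form in which source and target of \<open>\<beta>\<close> are
  given.\<close>

definition brk :: "bool \<Rightarrow> 'b" where
  "brk x = (if x then T \<odot> (T \<otimes>\<^sub>1 Id1 Y c) else T \<odot> (Id1 Y c \<otimes>\<^sub>1 T))"

text \<open>The functor on the indiscrete category with two objects that sends \<iota> to
  \<open>\<beta>\<close>. Diagonal arguments have to go to identities because of
  \<open>V_id0\<close> and \<open>V_id1\<close>.\<close>

definition reassoc :: "bool \<times> bool \<Rightarrow> 'c" where
  "reassoc e = (if fst e = snd e then Id2 Y (brk (fst e)) else if snd e then \<beta> else \<beta>')"

primrec ev2 :: "arrow_term \<Rightarrow> 'c" where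
  "ev2 TOne = Id2 Y (Id1 Y c)"
| "ev2 (TU s t) = Id2 Y T \<star> (ev2 s \<otimes>\<^sub>2 ev2 t)"
| "ev2 (TV r s t e) = reassoc e \<star> (ev2 r \<otimes>\<^sub>2 ev2 s \<otimes>\<^sub>2 ev2 t)"
| "ev2 (TComp s t) = ev2 s \<bullet> ev2 t"

lemma ev1_type [simp]: "ev1 f \<in> Cell1 Y" "Src1 Y (ev1 f) = pow0 c (leaves f)" "Trg1 Y (ev1 f) = c"
proof -
  have "ev1 f \<in> Cell1 Y \<and> Src1 Y (ev1 f) = pow0 c (leaves f) \<and> Trg1 Y (ev1 f) = c"
    by (induction f) (auto simp: pow0_add)
  then show "ev1 f \<in> Cell1 Y" "Src1 Y (ev1 f) = pow0 c (leaves f)" "Trg1 Y (ev1 f) = c"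
    by auto
qed

lemma ev1s_type [simp]: "ev1s f \<in> Cell1 Y" "Src1 Y (ev1s f) = pow0 c (sum_list (map leaves f))"
  "Trg1 Y (ev1s f) = pow0 c (length f)"
proof -
  have "ev1s f \<in> Cell1 Y \<and> Src1 Y (ev1s f) = pow0 c (sum_list (map leaves f)) \<and> Trg1 Y (ev1s f) = pow0 c (length f)"
    by (induction f) (auto simp: pow0_add)
  then show "ev1s f \<in> Cell1 Y" "Src1 Y (ev1s f) = pow0 c (sum_list (map leaves f))"
    "Trg1 Y (ev1s f) = pow0 c (length f)"
    by auto
qed

lemma brk_type [simp]: "brk x \<in> Cell1 Y" "Src1 Y (brk x) = c \<otimes>\<^sub>0 c \<otimes>\<^sub>0 c" "Trg1 Y (brk x) = c"
  by (simp_all add: brk_def Ten0_assoc)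

lemma reassoc_type [simp]:
  "reassoc e \<in> Cell2 Y" "Src2 Y (reassoc e) = brk (fst e)" "Trg2 Y (reassoc e) = brk (snd e)"
  by (auto simp: reassoc_def brk_def)

text \<open>If two neighbouring arguments agree, one factor is an identity. The two other cases,
  with \<open>x = z\<close> and \<open>y\<close> different, are the two halves of
  \<open>beta_inverse\<close>.\<close>

lemma reassoc_comp: "reassoc (y, z) \<bullet> reassoc (x, y) = reassoc (x, z)"
  by (cases x; cases y; cases z; simp add: reassoc_def brk_def beta_inverse)

text \<open>Interchange of tensor and horizontal composition absorbs the identity that stands beside
  \<open>T\<close> into one of the outer factors. Hence \<open>ev2\<close> of a \<open>TV\<close>
  term has the source and target that \<open>tdom\<close> and \<open>tcod\<close> prescribe.\<close>

lemma brk_ev1: "brk x \<odot> (ev1 f \<otimes>\<^sub>1 ev1 g \<otimes>\<^sub>1 ev1 h) = ev1 (bracket x f g h)"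
proof (cases x)
  case True
  have "(T \<otimes>\<^sub>1 Id1 Y c) \<odot> ((ev1 f \<otimes>\<^sub>1 ev1 g) \<otimes>\<^sub>1 ev1 h) = (T \<odot> (ev1 f \<otimes>\<^sub>1 ev1 g)) \<otimes>\<^sub>1 ev1 h"
    by (simp flip: Ten1_HComp1)
  then show ?thesis using True by (simp add: brk_def HComp1_assoc Ten1_assoc Ten0_assoc)
next
  case False
  have "(Id1 Y c \<otimes>\<^sub>1 T) \<odot> (ev1 f \<otimes>\<^sub>1 (ev1 g \<otimes>\<^sub>1 ev1 h)) = ev1 f \<otimes>\<^sub>1 (T \<odot> (ev1 g \<otimes>\<^sub>1 ev1 h))"
    by (simp flip: Ten1_HComp1)
  then show ?thesis using False by (simp add: brk_def HComp1_assoc)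
qed

text \<open>The counterpart of \<open>brk_ev1\<close> for 2-cells: it is what the clauses
  \<open>V_id0\<close> and \<open>V_id1\<close> of the congruence amount to after
  evaluation.\<close>

lemma brk_ev2:
  assumes "\<phi> \<in> Cell2 Y" "\<psi> \<in> Cell2 Y" "\<chi> \<in> Cell2 Y"
    "Trg1 Y (Src2 Y \<phi>) = c" "Trg1 Y (Src2 Y \<psi>) = c" "Trg1 Y (Src2 Y \<chi>) = c"
  shows "Id2 Y (brk False) \<star> (\<phi> \<otimes>\<^sub>2 \<psi> \<otimes>\<^sub>2 \<chi>) = Id2 Y T \<star> (\<phi> \<otimes>\<^sub>2 (Id2 Y T \<star> (\<psi> \<otimes>\<^sub>2 \<chi>)))"
    "Id2 Y (brk True) \<star> (\<phi> \<otimes>\<^sub>2 \<psi> \<otimes>\<^sub>2 \<chi>) = Id2 Y T \<star> ((Id2 Y T \<star> (\<phi> \<otimes>\<^sub>2 \<psi>)) \<otimes>\<^sub>2 \<chi>)"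
proof -
  have "Id2 Y (brk False) = Id2 Y T \<star> (Id2 Y (Id1 Y c) \<otimes>\<^sub>2 Id2 Y T)"
    "Id2 Y (brk True) = Id2 Y T \<star> (Id2 Y T \<otimes>\<^sub>2 Id2 Y (Id1 Y c))"
    by (simp_all add: brk_def Ten2_Id2 HComp2_Id2)
  moreover have "(Id2 Y (Id1 Y c) \<otimes>\<^sub>2 Id2 Y T) \<star> (\<phi> \<otimes>\<^sub>2 \<psi> \<otimes>\<^sub>2 \<chi>) = \<phi> \<otimes>\<^sub>2 (Id2 Y T \<star> (\<psi> \<otimes>\<^sub>2 \<chi>))"
    using assms by (simp flip: Ten2_HComp2)
  moreover have "(Id2 Y T \<otimes>\<^sub>2 Id2 Y (Id1 Y c)) \<star> (\<phi> \<otimes>\<^sub>2 \<psi> \<otimes>\<^sub>2 \<chi>) = (Id2 Y T \<star> (\<phi> \<otimes>\<^sub>2 \<psi>)) \<otimes>\<^sub>2 \<chi>"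
    using assms by (simp flip: Ten2_HComp2 Ten2_assoc)
  ultimately show "Id2 Y (brk False) \<star> (\<phi> \<otimes>\<^sub>2 \<psi> \<otimes>\<^sub>2 \<chi>) = Id2 Y T \<star> (\<phi> \<otimes>\<^sub>2 (Id2 Y T \<star> (\<psi> \<otimes>\<^sub>2 \<chi>)))"
    "Id2 Y (brk True) \<star> (\<phi> \<otimes>\<^sub>2 \<psi> \<otimes>\<^sub>2 \<chi>) = Id2 Y T \<star> ((Id2 Y T \<star> (\<phi> \<otimes>\<^sub>2 \<psi>)) \<otimes>\<^sub>2 \<chi>)"
    using assms by (simp_all add: HComp2_assoc Ten0_assoc)
qed

lemma ev2_type:
  assumes "tvalid t"
  shows "ev2 t \<in> Cell2 Y \<and> Src2 Y (ev2 t) = ev1 (tdom t) \<and> Trg2 Y (ev2 t) = ev1 (tcod t)"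
  using assms by (induction t) (simp_all add: brk_ev1 Ten0_assoc)

lemma ev2_type' [simp]:
  assumes "tvalid t"
  shows "ev2 t \<in> Cell2 Y" "Src2 Y (ev2 t) = ev1 (tdom t)" "Trg2 Y (ev2 t) = ev1 (tcod t)"
  using ev2_type[OF assms] by auto

lemma ev2_tid: "ev2 (tid f) = Id2 Y (ev1 f)"
  by (induction f) (simp_all add: Ten2_Id2 HComp2_Id2)

text \<open>The clauses \<open>id_left\<close>, \<open>id_right\<close> and
  \<open>comp_assoc\<close> become unit and associativity laws of vertical composition,
  \<open>funct_U\<close> and \<open>funct_V\<close> become interchange laws, the latter together
  with \<open>reassoc_comp\<close>, and the last two clauses are \<open>brk_ev2\<close>. The
  congruence relates ill-typed terms as well, so validity is assumed and carried along by
  \<open>teq_invariants\<close>.\<close>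

lemma ev2_teq: "s \<approx> t \<Longrightarrow> tvalid s \<Longrightarrow> ev2 s = ev2 t"
proof (induction rule: teq.induct)
  case (teq_sym s t)
  then show ?case using teq_invariants[OF teq_sym(1)] by simp
next
  case (teq_trans r s t)
  then show ?case using teq_invariants[OF teq_trans(1)] by simp
next
  case (id_left t)
  then show ?case by (simp add: ev2_tid)
next
  case (id_right t)
  then show ?case by (simp add: ev2_tid)
next
  case (comp_assoc r s t)
  then show ?case by (simp add: VComp_assoc)
next
  case (funct_U s s' t t')
  then show ?case by (simp add: Ten2_VComp whisker_VComp)
next
  case (funct_V r r' s s' t t' y z x)
  have "(ev2 r \<bullet> ev2 r') \<otimes>\<^sub>2 (ev2 s \<bullet> ev2 s') \<otimes>\<^sub>2 (ev2 t \<bullet> ev2 t') =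
      (ev2 r \<otimes>\<^sub>2 ev2 s \<otimes>\<^sub>2 ev2 t) \<bullet> (ev2 r' \<otimes>\<^sub>2 ev2 s' \<otimes>\<^sub>2 ev2 t')"
    using funct_V by (simp add: Ten2_VComp)
  then show ?case using funct_V by (simp add: reassoc_comp flip: HComp2_VComp)
next
  case (V_id0 r s t)
  then show ?case by (simp add: reassoc_def brk_ev2)
next
  case (V_id1 r s t)
  then show ?case by (simp add: reassoc_def brk_ev2)
qed (simp_all)

section \<open>Evaluation of classes of terms and of lists\<close>

definition ev2a :: "catalan_arrow \<Rightarrow> 'c" where
  "ev2a \<phi> = ev2 (rep_catalan_arrow \<phi>)"

text \<open>The representative inside \<open>ev2a\<close> is arbitrary, but it is congruent to
  \<open>t\<close>, and \<open>ev2_teq\<close> makes the choice invisible.\<close>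

lemma ev2a_abs: "tvalid t \<Longrightarrow> ev2a (abs_catalan_arrow t) = ev2 t"
  unfolding ev2a_def using rep_arrow[of t] teq_invariants[OF rep_arrow[of t]] by (intro ev2_teq) simp_all

lemma ev2a_type [simp]:
  assumes "avalid \<phi>"
  shows "ev2a \<phi> \<in> Cell2 Y" "Src2 Y (ev2a \<phi>) = ev1 (adom \<phi>)" "Trg2 Y (ev2a \<phi>) = ev1 (acod \<phi>)"
proof -
  obtain t where "\<phi> = abs_catalan_arrow t" by (rule arrow_absE)
  then show "ev2a \<phi> \<in> Cell2 Y" "Src2 Y (ev2a \<phi>) = ev1 (adom \<phi>)" "Trg2 Y (ev2a \<phi>) = ev1 (acod \<phi>)"
    using assms by (simp_all add: abs_simps ev2a_abs)
qed

lemma ev2a_aid [simp]: "ev2a (aid f) = Id2 Y (ev1 f)"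
  using ev2a_abs[of "tid f"] by (simp add: abs_simps ev2_tid)

lemma ev2a_simps [simp]:
  "avalid \<phi> \<Longrightarrow> avalid \<psi> \<Longrightarrow> ev2a (aU \<phi> \<psi>) = Id2 Y T \<star> (ev2a \<phi> \<otimes>\<^sub>2 ev2a \<psi>)"
  "avalid \<phi> \<Longrightarrow> avalid \<psi> \<Longrightarrow> avalid \<chi> \<Longrightarrow> ev2a (aV \<phi> \<psi> \<chi> e) = reassoc e \<star> (ev2a \<phi> \<otimes>\<^sub>2 ev2a \<psi> \<otimes>\<^sub>2 ev2a \<chi>)"
  "avalid \<psi> \<Longrightarrow> avalid \<phi> \<Longrightarrow> adom \<psi> = acod \<phi> \<Longrightarrow> ev2a (acomp \<psi> \<phi>) = ev2a \<psi> \<bullet> ev2a \<phi>"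
proof -
  obtain r s t where rst: "\<phi> = abs_catalan_arrow r" "\<psi> = abs_catalan_arrow s" "\<chi> = abs_catalan_arrow t"
    by (metis Quotient_abs_rep[OF Quotient_catalan_arrow])
  show "ev2a (aU \<phi> \<psi>) = Id2 Y T \<star> (ev2a \<phi> \<otimes>\<^sub>2 ev2a \<psi>)" if "avalid \<phi>" "avalid \<psi>"
    using that ev2a_abs[of "TU r s"] by (simp add: rst abs_simps ev2a_abs)
  show "ev2a (aV \<phi> \<psi> \<chi> e) = reassoc e \<star> (ev2a \<phi> \<otimes>\<^sub>2 ev2a \<psi> \<otimes>\<^sub>2 ev2a \<chi>)"
    if "avalid \<phi>" "avalid \<psi>" "avalid \<chi>"
    using that ev2a_abs[of "TV r s t e"] by (simp add: rst abs_simps ev2a_abs)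
  show "ev2a (acomp \<psi> \<phi>) = ev2a \<psi> \<bullet> ev2a \<phi>" if "avalid \<psi>" "avalid \<phi>" "adom \<psi> = acod \<phi>"
    using that ev2a_abs[of "TComp s r"] by (simp add: rst abs_simps ev2a_abs)
qed

primrec ev2s :: "catalan_arrow list \<Rightarrow> 'c" where
  "ev2s [] = Id2 Y (Id1 Y unit0)"
| "ev2s (\<phi> # \<phi>s) = ev2a \<phi> \<otimes>\<^sub>2 ev2s \<phi>s"

lemma ev2s_type [simp]:
  assumes "list_all avalid \<phi>s"
  shows "ev2s \<phi>s \<in> Cell2 Y" "Src2 Y (ev2s \<phi>s) = ev1s (map adom \<phi>s)" "Trg2 Y (ev2s \<phi>s) = ev1s (map acod \<phi>s)"
proof -
  have "ev2s \<phi>s \<in> Cell2 Y \<and> Src2 Y (ev2s \<phi>s) = ev1s (map adom \<phi>s) \<and> Trg2 Y (ev2s \<phi>s) = ev1s (map acod \<phi>s)"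
    using assms by (induction \<phi>s) auto
  then show "ev2s \<phi>s \<in> Cell2 Y" "Src2 Y (ev2s \<phi>s) = ev1s (map adom \<phi>s)" "Trg2 Y (ev2s \<phi>s) = ev1s (map acod \<phi>s)"
    by auto
qed

lemma ev1s_append: "ev1s (f @ g) = ev1s f \<otimes>\<^sub>1 ev1s g"
  by (induction f) (auto simp: Ten1_assoc)

lemma ev2s_append: "list_all avalid \<phi> \<Longrightarrow> list_all avalid \<psi> \<Longrightarrow> ev2s (\<phi> @ \<psi>) = ev2s \<phi> \<otimes>\<^sub>2 ev2s \<psi>"
  by (induction \<phi>) (auto simp: Ten2_assoc)

lemma ev2s_aid: "ev2s (map aid f) = Id2 Y (ev1s f)"
  by (induction f) (auto simp: Ten2_Id2)

lemma ev1s_replicate: "ev1s (replicate n Leaf) = Id1 Y (pow0 c n)"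
  by (induction n) (auto simp: Ten1_Id1)

lemma ev2s_vcomp:
  "list_all avalid \<psi> \<Longrightarrow> list_all avalid \<phi> \<Longrightarrow> map adom \<psi> = map acod \<phi> \<Longrightarrow>
   ev2s (map2 acomp \<psi> \<phi>) = ev2s \<psi> \<bullet> ev2s \<phi>"
proof (induction \<psi> arbitrary: \<phi>)
  case (Cons a \<psi>)
  then obtain b \<phi>' where \<phi>: "\<phi> = b # \<phi>'" by (cases \<phi>) auto
  show ?case using Cons.prems Cons.IH[of \<phi>'] by (simp add: \<phi> Ten2_VComp)
qed simp

section \<open>Substitution becomes horizontal composition\<close>

lemma ev1_subst: "length gs = leaves f \<Longrightarrow> ev1 (subst_obj f gs) = ev1 f \<odot> ev1s gs"
proof (induction f arbitrary: gs)
  case Leaf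
  then show ?case by (auto elim!: length_oneE)
next
  case (Node f g)
  let ?a = "take (leaves f) gs" and ?b = "drop (leaves f) gs"
  \<comment> \<open>The arguments are cut where \<open>subst_obj\<close> cuts them; interchange then
    distributes the two blocks over the tensor factors.\<close>
  have "ev1s gs = ev1s ?a \<otimes>\<^sub>1 ev1s ?b" by (simp flip: ev1s_append)
  then show ?case using Node by (simp add: Ten1_HComp1 HComp1_assoc)
qed

lemma ev2_subst:
  assumes "tvalid t" "valid_args (tdom t) \<gamma>s"
  shows "ev2a (subst_term t \<gamma>s) = ev2 t \<star> ev2s \<gamma>s"
  using assms
proof (induction t arbitrary: \<gamma>s)
  case TOne
  then show ?case by (auto elim!: length_oneE)
next
  case (TU s t)
  let ?a = "take (leaves (tdom s)) \<gamma>s" and ?b = "drop (leaves (tdom s)) \<gamma>s"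
  have args: "valid_args (tdom s) ?a" "valid_args (tdom t) ?b"
    using TU.prems by (simp_all add: list_all_take_drop)
  have "ev2s \<gamma>s = ev2s ?a \<otimes>\<^sub>2 ev2s ?b" using args by (simp flip: ev2s_append)
  then show ?case
    using TU.prems args TU.IH(1)[OF _ args(1)] TU.IH(2)[OF _ args(2)]
      subst_term_type[of s ?a] subst_term_type[of t ?b]
    by (simp add: Ten2_HComp2 HComp2_assoc)
next
  case (TV r s t e)
  let ?a = "take (leaves (tdom r)) \<gamma>s" and ?b = "take (leaves (tdom s)) (drop (leaves (tdom r)) \<gamma>s)"
    and ?c = "drop (leaves (tdom r) + leaves (tdom s)) \<gamma>s"
  have args: "valid_args (tdom r) ?a" "valid_args (tdom s) ?b" "valid_args (tdom t) ?c"
    using TV.prems by (simp_all add: list_all_take_drop)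
  have "\<gamma>s = ?a @ ?b @ ?c" by (metis append_take_drop_id drop_drop add.commute)
  then have "ev2s \<gamma>s = ev2s ?a \<otimes>\<^sub>2 ev2s ?b \<otimes>\<^sub>2 ev2s ?c"
    using args by (metis ev2s_append list_all_append)
  then show ?case
    using TV.prems args TV.IH(1)[OF _ args(1)] TV.IH(2)[OF _ args(2)] TV.IH(3)[OF _ args(3)]
      subst_term_type[of r ?a] subst_term_type[of s ?b] subst_term_type[of t ?c]
    by (simp add: Ten2_HComp2 HComp2_assoc)
next
  case (TComp s t)
  \<comment> \<open>\<open>subst_term\<close> gives all of \<open>\<gamma>s\<close> to the factor
    applied last and identities to the other one. Interchange joins the two horizontal composites,
    after which the identities drop out.\<close>
  let ?i = "map (\<lambda>\<gamma>. aid (adom \<gamma>)) \<gamma>s"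
  have i: "ev2s ?i = Id2 Y (ev1s (map adom \<gamma>s))" using ev2s_aid[of "map adom \<gamma>s"] by (simp add: comp_def)
  have args: "valid_args (tdom s) \<gamma>s" "valid_args (tdom t) ?i"
    using TComp.prems by (simp_all add: leaves_tcod)
  have "ev2a (subst_term (TComp s t) \<gamma>s) = (ev2 s \<star> ev2s \<gamma>s) \<bullet> (ev2 t \<star> ev2s ?i)"
    using TComp.prems args TComp.IH(1)[OF _ args(1)] TComp.IH(2)[OF _ args(2)]
      subst_term_type[of s \<gamma>s] subst_term_type[of t ?i] by (simp add: comp_def)
  also have "\<dots> = (ev2 s \<bullet> ev2 t) \<star> (ev2s \<gamma>s \<bullet> ev2s ?i)"
    using TComp.prems by (subst HComp2_VComp) (simp_all add: comp_def)
  also have "ev2s \<gamma>s \<bullet> ev2s ?i = ev2s \<gamma>s" using TComp.prems by (simp add: i)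
  finally show ?case by simp
qed

lemma ev2a_subst:
  assumes "avalid \<phi>" "valid_args (adom \<phi>) \<gamma>s"
  shows "ev2a (subst_arr \<phi> \<gamma>s) = ev2a \<phi> \<star> ev2s \<gamma>s"
proof -
  obtain t where "\<phi> = abs_catalan_arrow t" by (rule arrow_absE)
  then show ?thesis using assms ev2_subst[of t \<gamma>s] by (simp add: abs_simps subst_arr_abs ev2a_abs)
qed

text \<open>This is \<open>ev1_subst\<close> block by block: by \<open>hcomp_obj_simps\<close> the
  fibre of the partition over the first entry is an initial segment whose length is the number of
  leaves of that entry, so the induction cuts \<open>f\<close> there.\<close>

lemma ev1s_hcomp: "length f = sum_list (map leaves g) \<Longrightarrow> ev1s (hcomp_obj g f) = ev1s g \<odot> ev1s f"
proof (induction g arbitrary: f)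
  case (Cons a g)
  let ?a = "take (leaves a) f" and ?b = "drop (leaves a) f"
  have "ev1s f = ev1s ?a \<otimes>\<^sub>1 ev1s ?b" by (simp flip: ev1s_append)
  then show ?case using Cons.prems Cons.IH[of ?b] by (simp add: hcomp_obj_simps ev1_subst Ten1_HComp1)
qed (simp add: hcomp_obj_simps)

lemma ev2s_hcomp:
  "list_all avalid \<psi> \<Longrightarrow> list_all avalid \<phi> \<Longrightarrow> length \<phi> = sum_list (map leaves (map adom \<psi>)) \<Longrightarrow>
   ev2s (hcomp_arr \<psi> \<phi>) = ev2s \<psi> \<star> ev2s \<phi>"
proof (induction \<psi> arbitrary: \<phi>)
  case (Cons a \<psi>)
  let ?a = "take (leaves (adom a)) \<phi>" and ?b = "drop (leaves (adom a)) \<phi>"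
  have v: "list_all avalid ?a" "list_all avalid ?b" using Cons.prems by (simp_all add: list_all_take_drop)
  then have "ev2s \<phi> = ev2s ?a \<otimes>\<^sub>2 ev2s ?b" by (simp flip: ev2s_append)
  then show ?case
    using Cons.prems v Cons.IH[of ?b] by (simp add: hcomp_arr_simps ev2a_subst Ten2_HComp2 comp_def)
qed (simp add: hcomp_arr_simps)

end

section \<open>2-functors and 2-natural transformations out of the Catalan 2-category\<close>

lemma one_le_length [simp]: "xs \<noteq> [] \<Longrightarrow> Suc 0 \<le> length xs"
  by (cases xs) auto

lemma one_le_leaves [simp]:
  "f \<noteq> [] \<Longrightarrow> Suc 0 \<le> sum_list (map leaves f)"
  "\<phi> \<noteq> [] \<Longrightarrow> Suc 0 \<le> sum_list (map (leaves \<circ> adom) \<phi>)"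
  "\<phi> \<noteq> [] \<Longrightarrow> Suc 0 \<le> (\<Sum>x\<leftarrow>\<phi>. leaves (adom x))"
  by (cases f; simp add: Suc_le_eq) (cases \<phi>; simp add: Suc_le_eq)+

text \<open>A list of trees determines its source, its target and its partition, so the unions over
  0-cells and partitions collapse. Only the empty list is excluded, because 0-cells are
  positive.\<close>

lemma catalan_2cat_simps [simp]:
  "Cell0 catalan_2cat = {1..}" "Cell1 catalan_2cat = {f. f \<noteq> []}"
  "Cell2 catalan_2cat = {\<phi>. \<phi> \<noteq> [] \<and> list_all avalid \<phi>}"
  "Src1 catalan_2cat f = sum_list (map leaves f)" "Trg1 catalan_2cat f = length f"
  "Src2 catalan_2cat \<phi> = map adom \<phi>" "Trg2 catalan_2cat \<phi> = map acod \<phi>"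
  "Id1 catalan_2cat n = replicate n Leaf" "Id2 catalan_2cat f = map aid f"
  "HComp1 catalan_2cat = hcomp_obj" "VComp catalan_2cat = map2 acomp" "HComp2 catalan_2cat = hcomp_arr"
  "Ten0 catalan_2cat = (+)" "Ten1 catalan_2cat = (@)" "Ten2 catalan_2cat = (@)"
proof -
  show "Cell1 catalan_2cat = {f. f \<noteq> []}"
    by (auto simp: catalan_2cat_def catalan_1cells_eq)
  show "Cell2 catalan_2cat = {\<phi>. \<phi> \<noteq> [] \<and> list_all avalid \<phi>}"
    by (auto simp: catalan_2cat_def catalan_2cells_eq catalan_1cells_eq)
qed (simp_all add: catalan_2cat_def)

lemma hcomp_obj_Nil_iff [simp]: "hcomp_obj g f = [] \<longleftrightarrow> g = []"
  by (simp add: hcomp_obj_def)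

lemma hcomp_arr_Nil_iff [simp]: "hcomp_arr \<psi> \<phi> = [] \<longleftrightarrow> \<psi> = []"
  by (simp add: hcomp_arr_def)

lemma avalid_hcomp_arr:
  "list_all avalid \<psi> \<Longrightarrow> list_all avalid \<phi> \<Longrightarrow> length \<phi> = sum_list (map leaves (map adom \<psi>)) \<Longrightarrow>
   list_all avalid (hcomp_arr \<psi> \<phi>)"
  by (induction \<psi> arbitrary: \<phi>) (auto simp: hcomp_arr_simps list_all_take_drop)

lemma avalid_map2_acomp:
  "list_all avalid \<psi> \<Longrightarrow> list_all avalid \<phi> \<Longrightarrow> map adom \<psi> = map acod \<phi> \<Longrightarrow> list_all avalid (map2 acomp \<psi> \<phi>)"
proof (induction \<psi> arbitrary: \<phi>)
  case (Cons a \<psi>)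
  then show ?case by (cases \<phi>) auto
qed simp

text \<open>The generators: \<open>cherry\<close> is U of two leaves, and
  \<open>assoc_arrow e\<close> is V of three leaves and \<open>e\<close>, where
  \<open>(False, True)\<close> stands for \<iota>.\<close>

abbreviation (input) cherry :: tree where "cherry \<equiv> Node Leaf Leaf"

abbreviation (input) assoc_arrow :: "bool \<times> bool \<Rightarrow> catalan_arrow" where
  "assoc_arrow e \<equiv> aV (aid Leaf) (aid Leaf) (aid Leaf) e"

lemma assoc_arrow_id: "assoc_arrow (x, x) = aid (bracket x Leaf Leaf Leaf)"
  by (cases x) (simp_all add: arrow_eqs)

text \<open>Functoriality of V in its last argument: opposite arrows of the indiscrete category
  compose to an identity, and \<open>V_id0\<close> and \<open>V_id1\<close> identify the
  result.\<close>

lemma assoc_arrow_inverse: "acomp (assoc_arrow (y, x)) (assoc_arrow (x, y)) = aid (bracket x Leaf Leaf Leaf)"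
proof -
  have "acomp (aid Leaf) (aid Leaf) = aid Leaf" using arrow_eqs(1)[of "aid Leaf"] by simp
  then show ?thesis by (simp add: arrow_eqs(5) flip: assoc_arrow_id)
qed

section \<open>The generated 2-functor\<close>

context assoc_object
begin

definition generated :: "(nat, tree list, catalan_arrow list, 'a, 'b, 'c) two_functor" where
  "generated = \<lparr>Map0 = restrict (pow0 c) (Cell0 catalan_2cat), Map1 = restrict ev1s (Cell1 catalan_2cat),
     Map2 = restrict ev2s (Cell2 catalan_2cat)\<rparr>"

lemma generated_2functor: "strict_tensor_2functor catalan_2cat Y generated"
proof -
  show ?thesis
    by (auto simp: strict_tensor_2functor_def generated_def ev1s_replicate ev2s_aid ev1s_hcomp pow0_add
        ev2s_vcomp ev2s_hcomp ev1s_append ev2s_append avalid_hcomp_arr avalid_map2_acomp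
        dest: map_eq_imp_length_eq)
qed

text \<open>Unit laws remove the identities that come from the leaves. This is the surjectivity on
  objects of evaluation at the generators.\<close>

lemma generated_data:
  "Map0 generated 1 = c" "Map1 generated [cherry] = T" "Map2 generated [assoc_arrow (False, True)] = \<beta>"
  by (simp_all add: generated_def Ten1_Id1 Ten2_Id2 reassoc_def Ten0_assoc)

end

section \<open>Values of a 2-functor on the generators\<close>

context tensor_2category
begin

context
  fixes R :: "(nat, tree list, catalan_arrow list, 'y, 'g, 'u) two_functor"
  assumes R: "strict_tensor_2functor catalan_2cat Y R"
begin

lemma Map_in [simp]:
  "n \<ge> 1 \<Longrightarrow> Map0 R n \<in> Cell0 Y" "f \<noteq> [] \<Longrightarrow> Map1 R f \<in> Cell1 Y"
  "\<phi> \<noteq> [] \<Longrightarrow> list_all avalid \<phi> \<Longrightarrow> Map2 R \<phi> \<in> Cell2 Y"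
  using R unfolding strict_tensor_2functor_def by auto

lemma Map_extensional:
  "Map0 R \<in> extensional {1..}" "Map1 R \<in> extensional {f. f \<noteq> []}"
  "Map2 R \<in> extensional {\<phi>. \<phi> \<noteq> [] \<and> list_all avalid \<phi>}"
  using R unfolding strict_tensor_2functor_def catalan_2cat_simps PiE_def by blast+

lemma Map0_add: "m \<ge> 1 \<Longrightarrow> n \<ge> 1 \<Longrightarrow> Map0 R (m + n) = Map0 R m \<otimes>\<^sub>0 Map0 R n"
  using R unfolding strict_tensor_2functor_def by auto

lemma Map0_pow: "n \<ge> Suc 0 \<Longrightarrow> pow0 (Map0 R (Suc 0)) n = Map0 R n"
proof (induction n rule: dec_induct)
  case (step n)
  then show ?case using Map0_add[of 1 n] by simp
qed simp

text \<open>Boundaries are written as powers of the value at 1. Those of \<open>pow1\<close> and of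
  tensor products have the same form, so that composability can be decided by rewriting.\<close>

lemma Map1_type [simp]:
  assumes "f \<noteq> []"
  shows "Src1 Y (Map1 R f) = pow0 (Map0 R (Suc 0)) (sum_list (map leaves f))"
    "Trg1 Y (Map1 R f) = pow0 (Map0 R (Suc 0)) (length f)"
proof -
  have "Src1 Y (Map1 R f) = Map0 R (sum_list (map leaves f))" "Trg1 Y (Map1 R f) = Map0 R (length f)"
    using R assms unfolding strict_tensor_2functor_def by auto
  then show "Src1 Y (Map1 R f) = pow0 (Map0 R (Suc 0)) (sum_list (map leaves f))"
    "Trg1 Y (Map1 R f) = pow0 (Map0 R (Suc 0)) (length f)"
    using assms by (simp_all add: Map0_pow)
qed

lemma Map2_type [simp]:
  "\<phi> \<noteq> [] \<Longrightarrow> list_all avalid \<phi> \<Longrightarrow> Src2 Y (Map2 R \<phi>) = Map1 R (map adom \<phi>)"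
  "\<phi> \<noteq> [] \<Longrightarrow> list_all avalid \<phi> \<Longrightarrow> Trg2 Y (Map2 R \<phi>) = Map1 R (map acod \<phi>)"
  using R unfolding strict_tensor_2functor_def by auto

lemma Map_laws:
  "n \<ge> 1 \<Longrightarrow> Map1 R (replicate n Leaf) = Id1 Y (Map0 R n)"
  "f \<noteq> [] \<Longrightarrow> Map2 R (map aid f) = Id2 Y (Map1 R f)"
  "g \<noteq> [] \<Longrightarrow> f \<noteq> [] \<Longrightarrow> sum_list (map leaves g) = length f \<Longrightarrow>
   Map1 R (hcomp_obj g f) = Map1 R g \<odot> Map1 R f"
  "\<psi> \<noteq> [] \<Longrightarrow> list_all avalid \<psi> \<Longrightarrow> \<phi> \<noteq> [] \<Longrightarrow> list_all avalid \<phi> \<Longrightarrow> map adom \<psi> = map acod \<phi> \<Longrightarrow>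
   Map2 R (map2 acomp \<psi> \<phi>) = Map2 R \<psi> \<bullet> Map2 R \<phi>"
  "\<psi> \<noteq> [] \<Longrightarrow> list_all avalid \<psi> \<Longrightarrow> \<phi> \<noteq> [] \<Longrightarrow> list_all avalid \<phi> \<Longrightarrow>
   sum_list (map (leaves \<circ> adom) \<psi>) = length \<phi> \<Longrightarrow> Map2 R (hcomp_arr \<psi> \<phi>) = Map2 R \<psi> \<star> Map2 R \<phi>"
  using R unfolding strict_tensor_2functor_def by auto

lemma Map1_Leaf: "Map1 R [Leaf] = Id1 Y (Map0 R 1)"
  using Map_laws(1)[of 1] by simp

lemma Map1_append: "f \<noteq> [] \<Longrightarrow> g \<noteq> [] \<Longrightarrow> Map1 R (f @ g) = Map1 R f \<otimes>\<^sub>1 Map1 R g"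
  using R unfolding strict_tensor_2functor_def by auto

lemma Map2_append: "\<phi> \<noteq> [] \<Longrightarrow> \<psi> \<noteq> [] \<Longrightarrow> list_all avalid \<phi> \<Longrightarrow> list_all avalid \<psi> \<Longrightarrow>
    Map2 R (\<phi> @ \<psi>) = Map2 R \<phi> \<otimes>\<^sub>2 Map2 R \<psi>"
  using R unfolding strict_tensor_2functor_def by auto

lemma Map1_Cons: "g \<noteq> [] \<Longrightarrow> Map1 R (f # g) = Map1 R [f] \<otimes>\<^sub>1 Map1 R g"
  using Map1_append[of "[f]" g] by simp

lemma Map2_Cons: "\<psi> \<noteq> [] \<Longrightarrow> avalid \<phi> \<Longrightarrow> list_all avalid \<psi> \<Longrightarrow> Map2 R (\<phi> # \<psi>) = Map2 R [\<phi>] \<otimes>\<^sub>2 Map2 R \<psi>"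
  using Map2_append[of "[\<phi>]" \<psi>] by simp

lemma Map2_aid: "Map2 R [aid f] = Id2 Y (Map1 R [f])"
  using Map_laws(2)[of "[f]"] by simp

text \<open>Substituting \<open>[f, g]\<close> into the two-leaf tree returns
  \<open>Node f g\<close>, so the node is a horizontal composite in A.\<close>

lemma Map1_Node: "Map1 R [Node f g] = Map1 R [cherry] \<odot> (Map1 R [f] \<otimes>\<^sub>1 Map1 R [g])"
  using Map_laws(3)[of "[cherry]" "[f, g]"] by (simp add: hcomp_obj_simps Map1_Cons)

lemma Map2_subst_arr:
  assumes "avalid \<psi>" "\<phi> \<noteq> []" "list_all avalid \<phi>" "length \<phi> = leaves (adom \<psi>)"
  shows "Map2 R [subst_arr \<psi> \<phi>] = Map2 R [\<psi>] \<star> Map2 R \<phi>"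
  using Map_laws(5)[of "[\<psi>]" \<phi>] assms by (simp add: hcomp_arr_simps)

text \<open>\<open>aU\<close> is substitution into the identity arrow of the two-leaf tree, and that
  arrow is sent to an identity 2-cell.\<close>

lemma Map2_aU:
  assumes "avalid \<phi>" "avalid \<psi>"
  shows "Map2 R [aU \<phi> \<psi>] = Id2 Y (Map1 R [cherry]) \<star> (Map2 R [\<phi>] \<otimes>\<^sub>2 Map2 R [\<psi>])"
proof -
  have "subst_arr (aid cherry) [\<phi>, \<psi>] = aU \<phi> \<psi>"
    using assms subst_arr_simps(2)[of "aid Leaf" "aid Leaf" "[\<phi>]" "[\<psi>]"] by (simp add: subst_arr_simps(1))
  then show ?thesis
    using Map2_subst_arr[of "aid cherry" "[\<phi>, \<psi>]"] Map2_aid[of cherry] assms by (simp add: Map2_Cons)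
qed

text \<open>An arbitrary V is substitution into V of three leaves with the same last argument; this
  reduces all associators to the one generator and its inverse.\<close>

lemma Map2_aV:
  assumes "avalid \<phi>" "avalid \<psi>" "avalid \<chi>"
  shows "Map2 R [aV \<phi> \<psi> \<chi> e] = Map2 R [assoc_arrow e] \<star> (Map2 R [\<phi>] \<otimes>\<^sub>2 Map2 R [\<psi>] \<otimes>\<^sub>2 Map2 R [\<chi>])"
proof -
  have "subst_arr (assoc_arrow e) [\<phi>, \<psi>, \<chi>] = aV \<phi> \<psi> \<chi> e"
    using assms subst_arr_simps(3)[of "aid Leaf" "aid Leaf" "aid Leaf" "[\<phi>]" "[\<psi>]" "[\<chi>]"]
    by (simp add: subst_arr_simps(1))
  then show ?thesis
    using Map2_subst_arr[of "assoc_arrow e" "[\<phi>, \<psi>, \<chi>]"] assms by (simp add: Map2_Cons)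
qed

lemma Map2_acomp:
  "avalid \<psi> \<Longrightarrow> avalid \<phi> \<Longrightarrow> adom \<psi> = acod \<phi> \<Longrightarrow> Map2 R [acomp \<psi> \<phi>] = Map2 R [\<psi>] \<bullet> Map2 R [\<phi>]"
  using Map_laws(4)[of "[\<psi>]" "[\<phi>]"] by simp

text \<open>The boundary of the associator comes from \<open>Map1_Node\<close>, its invertibility
  from \<open>assoc_arrow_inverse\<close>.\<close>

lemma assoc_object_data:
  "assoc_object Y unit0 (Map0 R 1) (Map1 R [cherry])
     (Map2 R [assoc_arrow (False, True)]) (Map2 R [assoc_arrow (True, False)])"
proof -
  have "Map1 R [Node Leaf cherry] = Map1 R [cherry] \<odot> (Id1 Y (Map0 R 1) \<otimes>\<^sub>1 Map1 R [cherry])"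
    "Map1 R [Node cherry Leaf] = Map1 R [cherry] \<odot> (Map1 R [cherry] \<otimes>\<^sub>1 Id1 Y (Map0 R 1))"
    using Map1_Node[of Leaf cherry] Map1_Node[of cherry Leaf] Map1_Leaf by simp_all
  moreover have "Map2 R [assoc_arrow (True, False)] \<bullet> Map2 R [assoc_arrow (False, True)] =
      Id2 Y (Map1 R [Node Leaf cherry])"
    "Map2 R [assoc_arrow (False, True)] \<bullet> Map2 R [assoc_arrow (True, False)] =
      Id2 Y (Map1 R [Node cherry Leaf])"
    using Map2_aid[of "Node Leaf cherry"] Map2_aid[of "Node cherry Leaf"]
      assoc_arrow_inverse[of False True] assoc_arrow_inverse[of True False]
    by (simp_all flip: Map2_acomp)
  ultimately show ?thesis by unfold_locales simp_all
qed

end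

text \<open>Carries an equation between 2-cells over to their inverses; \<open>natural_assoc\<close>
  applies it to \<iota>.\<close>

lemma inverse_2cell_unique:
  assumes "\<phi> \<in> Cell2 Y" "\<psi> \<in> Cell2 Y" "\<psi>' \<in> Cell2 Y" "Src2 Y \<psi>' = Trg2 Y \<phi>" "Src2 Y \<phi> = Trg2 Y \<psi>"
    "\<psi>' \<bullet> \<phi> = Id2 Y (Src2 Y \<phi>)" "\<phi> \<bullet> \<psi> = Id2 Y (Trg2 Y \<phi>)"
  shows "\<psi> = \<psi>'"
  using VComp_assoc[of \<psi>' \<phi> \<psi>] assms by simp

section \<open>Propagation of naturality from the generators\<close>

context
  fixes R S :: "(nat, tree list, catalan_arrow list, 'y, 'g, 'u) two_functor" and G :: 'g
  assumes R: "strict_tensor_2functor catalan_2cat Y R" and S: "strict_tensor_2functor catalan_2cat Y S"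
    and G: "G \<in> Cell1 Y" "Src1 Y G = Map0 R 1" "Trg1 Y G = Map0 S 1"
    and GT: "Map1 S [cherry] \<odot> (G \<otimes>\<^sub>1 G) = G \<odot> Map1 R [cherry]"
    and Gb: "Map2 S [assoc_arrow (False, True)] \<star> Id2 Y (G \<otimes>\<^sub>1 G \<otimes>\<^sub>1 G) =
      Id2 Y G \<star> Map2 R [assoc_arrow (False, True)]"
begin

lemmas RS = Map_in[OF R] Map_in[OF S] Map1_type[OF R] Map1_type[OF S] Map2_type[OF R] Map2_type[OF S] G

text \<open>The power of \<open>G\<close> splits over the two subtrees and slides past each of them
  by induction; the remaining \<open>G \<otimes>\<^sub>1 G\<close> slides past the generator by
  \<open>GT\<close>.\<close>

lemma natural_tree: "Map1 S [f] \<odot> pow1 G (leaves f) = G \<odot> Map1 R [f]"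
proof (induction f)
  case Leaf
  then show ?case using G by (simp add: Map1_Leaf[OF R] Map1_Leaf[OF S])
next
  case (Node f g)
  have "Map1 S [Node f g] \<odot> pow1 G (leaves (Node f g)) =
      Map1 S [cherry] \<odot> ((Map1 S [f] \<otimes>\<^sub>1 Map1 S [g]) \<odot> (pow1 G (leaves f) \<otimes>\<^sub>1 pow1 G (leaves g)))"
    by (simp add: Map1_Node[OF S, of f g] pow1_add HComp1_assoc RS pow0_add)
  also have "\<dots> = Map1 S [cherry] \<odot> ((G \<odot> Map1 R [f]) \<otimes>\<^sub>1 (G \<odot> Map1 R [g]))"
    by (simp add: RS Node flip: Ten1_HComp1)
  also have "\<dots> = (Map1 S [cherry] \<odot> (G \<otimes>\<^sub>1 G)) \<odot> (Map1 R [f] \<otimes>\<^sub>1 Map1 R [g])"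
    by (simp add: RS Ten1_HComp1 HComp1_assoc)
  also have "\<dots> = G \<odot> Map1 R [Node f g]"
    by (simp add: GT Map1_Node[OF R, of f g] RS HComp1_assoc)
  finally show ?case .
qed

text \<open>Tensoring \<open>natural_tree\<close> over the entries. The induction starts at
  singletons because a 2-functor is undefined at the empty list.\<close>

lemma natural_trees: "f \<noteq> [] \<Longrightarrow> Map1 S f \<odot> pow1 G (sum_list (map leaves f)) = pow1 G (length f) \<odot> Map1 R f"
proof (induction f rule: list_nonempty_induct)
  case (single f)
  then show ?case using natural_tree[of f] G by simp
next
  case (cons f fs)
  have "Map1 S (f # fs) \<odot> pow1 G (sum_list (map leaves (f # fs))) =
      (Map1 S [f] \<odot> pow1 G (leaves f)) \<otimes>\<^sub>1 (Map1 S fs \<odot> pow1 G (sum_list (map leaves fs)))"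
    using cons.hyps by (simp add: Map1_Cons[OF S, of fs f] pow1_add RS flip: Ten1_HComp1)
  then show ?case
    using cons by (simp add: natural_tree Map1_Cons[OF R, of fs f] Ten1_HComp1 RS)
qed

text \<open>A diagonal \<open>e\<close> is an identity, for which naturality on trees suffices;
  \<iota> is the hypothesis \<open>Gb\<close>; the inverse of \<iota> is reached through uniqueness
  of inverses.\<close>

lemma natural_assoc: "Map2 S [assoc_arrow e] \<star> Id2 Y (G \<otimes>\<^sub>1 G \<otimes>\<^sub>1 G) = Id2 Y G \<star> Map2 R [assoc_arrow e]"
proof -
  obtain x y where e: "e = (x, y)" by (cases e)
  have GGG: "pow1 G (Suc (Suc (Suc 0))) = G \<otimes>\<^sub>1 G \<otimes>\<^sub>1 G" using G by simp
  have nat: "Map1 S [bracket x Leaf Leaf Leaf] \<odot> (G \<otimes>\<^sub>1 G \<otimes>\<^sub>1 G) = G \<odot> Map1 R [bracket x Leaf Leaf Leaf]" for x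
    using natural_tree[of "bracket x Leaf Leaf Leaf"] GGG by (simp del: pow1.simps)
  consider "x = y" | "\<not> x" "y" | "x" "\<not> y" by blast
  then show ?thesis
  proof cases
    case 1
    then show ?thesis
      by (simp add: e assoc_arrow_id Map2_aid[OF R] Map2_aid[OF S] HComp2_Id2 RS nat Ten0_assoc)
  next
    case 2
    then show ?thesis using Gb by (simp add: e)
  next
    case 3
    let ?P = "Id2 Y (G \<otimes>\<^sub>1 G \<otimes>\<^sub>1 G)"
    have S_inv: "Map2 S [assoc_arrow (y, x)] \<bullet> Map2 S [assoc_arrow (x, y)] = Id2 Y (Map1 S [bracket x Leaf Leaf Leaf])"
      "Map2 S [assoc_arrow (x, y)] \<bullet> Map2 S [assoc_arrow (y, x)] = Id2 Y (Map1 S [bracket y Leaf Leaf Leaf])"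
      for x y by (simp_all add: assoc_arrow_inverse Map2_aid[OF S] flip: Map2_acomp[OF S])
    have R_inv: "Map2 R [assoc_arrow (y, x)] \<bullet> Map2 R [assoc_arrow (x, y)] = Id2 Y (Map1 R [bracket x Leaf Leaf Leaf])"
      "Map2 R [assoc_arrow (x, y)] \<bullet> Map2 R [assoc_arrow (y, x)] = Id2 Y (Map1 R [bracket y Leaf Leaf Leaf])"
      for x y by (simp_all add: assoc_arrow_inverse Map2_aid[OF R] flip: Map2_acomp[OF R])
    have l: "(Map2 S [assoc_arrow (True, False)] \<star> ?P) \<bullet> (Map2 S [assoc_arrow (False, True)] \<star> ?P) =
        Id2 Y (Map1 S [bracket False Leaf Leaf Leaf] \<odot> (G \<otimes>\<^sub>1 G \<otimes>\<^sub>1 G))"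
      by (simp add: RS S_inv HComp2_Id2 Ten0_assoc del: bracket.simps flip: whisker_VComp)
    have r: "(Id2 Y G \<star> Map2 R [assoc_arrow (False, True)]) \<bullet> (Id2 Y G \<star> Map2 R [assoc_arrow (True, False)]) =
        Id2 Y (G \<odot> Map1 R [bracket True Leaf Leaf Leaf])"
      by (simp add: RS R_inv HComp2_Id2 Ten0_assoc del: bracket.simps flip: whisker_VComp)
    \<comment> \<open>By \<open>Gb\<close>, the whiskered associator of \<open>R\<close> is also a
      whiskering of the associator of \<open>S\<close>. So it has a right inverse built from
      \<open>R\<close> and a left inverse built from \<open>S\<close>, and these agree.\<close>
    have "Id2 Y G \<star> Map2 R [assoc_arrow (True, False)] = Map2 S [assoc_arrow (True, False)] \<star> ?P"
    proof (rule inverse_2cell_unique[of "Id2 Y G \<star> Map2 R [assoc_arrow (False, True)]"])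
      show "Src2 Y (Map2 S [assoc_arrow (True, False)] \<star> ?P) =
          Trg2 Y (Id2 Y G \<star> Map2 R [assoc_arrow (False, True)])"
        using nat[of True] by (simp add: RS Ten0_assoc)
      show "(Map2 S [assoc_arrow (True, False)] \<star> ?P) \<bullet> (Id2 Y G \<star> Map2 R [assoc_arrow (False, True)]) =
          Id2 Y (Src2 Y (Id2 Y G \<star> Map2 R [assoc_arrow (False, True)]))"
        unfolding Gb[symmetric] l by (simp add: RS Ten0_assoc)
      show "(Id2 Y G \<star> Map2 R [assoc_arrow (False, True)]) \<bullet> (Id2 Y G \<star> Map2 R [assoc_arrow (True, False)]) =
          Id2 Y (Trg2 Y (Id2 Y G \<star> Map2 R [assoc_arrow (False, True)]))"
        unfolding r by (simp add: RS Ten0_assoc)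
    qed (simp_all add: RS Ten0_assoc)
    then show ?thesis using 3 by (simp add: e)
  qed
qed

lemma natural_arrow:
  assumes "avalid \<phi>"
  shows "Map2 S [\<phi>] \<star> Id2 Y (pow1 G (leaves (adom \<phi>))) = Id2 Y G \<star> Map2 R [\<phi>]"
  using assms
proof (induction rule: arrow_induct)
  case One
  then show ?case using G by (simp add: Map2_aid[OF R] Map2_aid[OF S] Map1_Leaf[OF R] Map1_Leaf[OF S])
next
  case (U \<phi> \<psi>)
  let ?p = "Id2 Y (pow1 G (leaves (adom \<phi>)))" and ?q = "Id2 Y (pow1 G (leaves (adom \<psi>)))"
  have "Map2 S [aU \<phi> \<psi>] \<star> Id2 Y (pow1 G (leaves (adom (aU \<phi> \<psi>)))) =
      Id2 Y (Map1 S [cherry]) \<star> ((Map2 S [\<phi>] \<star> ?p) \<otimes>\<^sub>2 (Map2 S [\<psi>] \<star> ?q))"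
    using U.hyps by (simp add: Map2_aU[OF S, of \<phi> \<psi>] pow1_add pow0_add HComp2_assoc RS flip: Ten2_Id2 Ten2_HComp2)
  also have "\<dots> = (Id2 Y (Map1 S [cherry]) \<star> Id2 Y (G \<otimes>\<^sub>1 G)) \<star> (Map2 R [\<phi>] \<otimes>\<^sub>2 Map2 R [\<psi>])"
    using U by (simp add: Ten2_HComp2 HComp2_assoc RS flip: Ten2_Id2)
  \<comment> \<open>The two identity 2-cells are merged into one so that \<open>GT\<close> applies,
    and the result is split again.\<close>
  also have "\<dots> = Id2 Y G \<star> Map2 R [aU \<phi> \<psi>]"
    using U by (simp add: HComp2_Id2 RS GT Map2_aU[OF R, of \<phi> \<psi>])
      (simp add: RS HComp2_assoc flip: HComp2_Id2)
  finally show ?case .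
next
  case (V \<phi> \<psi> \<chi> e)
  let ?p = "\<lambda>\<phi>. Id2 Y (pow1 G (leaves (adom \<phi>)))"
  have "Map2 S [aV \<phi> \<psi> \<chi> e] \<star> ?p (aV \<phi> \<psi> \<chi> e) =
      Map2 S [assoc_arrow e] \<star> ((Map2 S [\<phi>] \<star> ?p \<phi>) \<otimes>\<^sub>2 (Map2 S [\<psi>] \<star> ?p \<psi>) \<otimes>\<^sub>2 (Map2 S [\<chi>] \<star> ?p \<chi>))"
    using V.hyps by (simp add: Map2_aV[OF S, of \<phi> \<psi> \<chi> e] pow1_add pow0_add HComp2_assoc Ten0_assoc
        Ten1_assoc RS flip: Ten2_Id2 Ten2_HComp2)
  also have "\<dots> = (Map2 S [assoc_arrow e] \<star> Id2 Y (G \<otimes>\<^sub>1 G \<otimes>\<^sub>1 G)) \<star> (Map2 R [\<phi>] \<otimes>\<^sub>2 Map2 R [\<psi>] \<otimes>\<^sub>2 Map2 R [\<chi>])"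
    using V by (simp add: Ten2_HComp2 HComp2_assoc RS Ten0_assoc flip: Ten2_Id2)
  also have "\<dots> = Id2 Y G \<star> Map2 R [aV \<phi> \<psi> \<chi> e]"
    using V by (simp add: natural_assoc RS Map2_aV[OF R, of \<phi> \<psi> \<chi> e] HComp2_assoc Ten0_assoc)
  finally show ?case .
next
  case (Comp \<psi> \<phi>)
  \<comment> \<open>Composable arrows have equally many leaves, so both factors are whiskered with
    the same power of \<open>G\<close>.\<close>
  have "leaves (adom \<psi>) = leaves (adom \<phi>)" using Comp by (simp add: leaves_acod)
  with Comp show ?case
    by (simp add: Map2_acomp[OF S, of \<psi> \<phi>] Map2_acomp[OF R, of \<psi> \<phi>] whisker_VComp RS)
qed

lemma natural_arrows:
  "\<phi> \<noteq> [] \<Longrightarrow> list_all avalid \<phi> \<Longrightarrow>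
   Map2 S \<phi> \<star> Id2 Y (pow1 G (sum_list (map leaves (map adom \<phi>)))) = Id2 Y (pow1 G (length \<phi>)) \<star> Map2 R \<phi>"
proof (induction \<phi> rule: list_nonempty_induct)
  case (single \<phi>)
  then show ?case using natural_arrow[of \<phi>] G by simp
next
  case (cons \<phi> \<phi>s)
  let ?p = "Id2 Y (pow1 G (leaves (adom \<phi>)))" and ?q = "Id2 Y (pow1 G (sum_list (map leaves (map adom \<phi>s))))"
  have "Map2 S (\<phi> # \<phi>s) \<star> Id2 Y (pow1 G (sum_list (map leaves (map adom (\<phi> # \<phi>s))))) =
      (Map2 S [\<phi>] \<star> ?p) \<otimes>\<^sub>2 (Map2 S \<phi>s \<star> ?q)"
    using cons.hyps cons.prems by (simp add: Map2_Cons[OF S, of \<phi>s \<phi>] pow1_add RS comp_def flip: Ten2_Id2 Ten2_HComp2)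
  then show ?case
    using cons by (simp add: natural_arrow Map2_Cons[OF R, of \<phi>s \<phi>] Ten2_HComp2 RS flip: Ten2_Id2)
qed

text \<open>Fullness: a 1-cell compatible with the two generators extends to a 2-natural
  transformation. The restriction makes the family of components extensional.\<close>

lemma pow1_2nat: "strict_tensor_2nat catalan_2cat Y R S (restrict (pow1 G) {1..})"
proof -
  show ?thesis
    using natural_trees natural_arrows
    by (auto simp: strict_tensor_2nat_def R S G pow1_add comp_def Map0_pow[OF R] Map0_pow[OF S])
qed

end

section \<open>Determination by the values at the generators\<close>

lemma two_functor_eqI:
  assumes R: "strict_tensor_2functor catalan_2cat Y R" and S: "strict_tensor_2functor catalan_2cat Y S"
    and eq: "Map0 R 1 = Map0 S 1" "Map1 R [cherry] = Map1 S [cherry]"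
      "Map2 R [assoc_arrow (False, True)] = Map2 S [assoc_arrow (False, True)]"
  shows "R = S"
proof -
  let ?G = "Id1 Y (Map0 R 1)" \<comment> \<open>its naturality with respect to all cells says that \<open>R\<close> and \<open>S\<close> agree\<close>
  note [simp] = Map_in[OF R] Map_in[OF S] Map1_type[OF R] Map1_type[OF S] Map2_type[OF R] Map2_type[OF S]
  have G: "?G \<in> Cell1 Y" "Src1 Y ?G = Map0 R 1" "Trg1 Y ?G = Map0 S 1"
    "Map1 S [cherry] \<odot> (?G \<otimes>\<^sub>1 ?G) = ?G \<odot> Map1 R [cherry]"
    "Map2 S [assoc_arrow (False, True)] \<star> Id2 Y (?G \<otimes>\<^sub>1 ?G \<otimes>\<^sub>1 ?G) =
      Id2 Y ?G \<star> Map2 R [assoc_arrow (False, True)]"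
    using eq by (simp_all add: Ten1_Id1 Ten0_assoc)
  have "Map0 R n = Map0 S n" if "n \<ge> 1" for n
    using that eq(1) Map0_pow[OF R, of n] Map0_pow[OF S, of n] by simp
  moreover have "Map1 R f = Map1 S f" if "f \<noteq> []" for f
    using natural_trees[OF R S G that] that eq(1) by (simp add: pow1_Id1)
  moreover have "Map2 R \<phi> = Map2 S \<phi>" if "\<phi> \<noteq> []" "list_all avalid \<phi>" for \<phi>
  proof -
    have "Src1 Y (Src2 Y (Map2 S \<phi>)) = pow0 (Map0 R 1) (sum_list (map leaves (map adom \<phi>)))"
      "Trg1 Y (Src2 Y (Map2 R \<phi>)) = pow0 (Map0 R 1) (length \<phi>)"
      using that eq(1) by simp_all
    then show ?thesis
      using natural_arrows[OF R S G that] HComp2_Id1 Map_in(3)[OF R that] Map_in(3)[OF S that]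
        pow1_Id1[OF Map_in(1)[OF R order_refl]] by metis
  qed
  ultimately have "Map0 R = Map0 S" "Map1 R = Map1 S" "Map2 R = Map2 S"
    using extensionalityI[OF Map_extensional(1)[OF R] Map_extensional(1)[OF S]]
      extensionalityI[OF Map_extensional(2)[OF R] Map_extensional(2)[OF S]]
      extensionalityI[OF Map_extensional(3)[OF R] Map_extensional(3)[OF S]] by blast+
  \<comment> \<open>The goal left over concerns the extension slot of the record, which has type
    \<open>unit\<close>.\<close>
  then show ?thesis by (rule two_functor.equality) (metis old.unit.exhaust)
qed

text \<open>Compatibility with the tensor at \<open>1 + n\<close> is the recursion equation of
  \<open>pow1\<close>; at 1 the trailing unit disappears.\<close>

lemma two_nat_pow:
  assumes "strict_tensor_2nat catalan_2cat Y R S F"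
  shows "F = restrict (pow1 (F 1)) {1..}"
proof (rule extensionalityI[of _ "{1..}"])
  fix n :: nat assume "n \<in> {1..}"
  then have "n \<ge> 1" by simp
  then show "F n = restrict (pow1 (F 1)) {1..} n"
  proof (induction n rule: dec_induct)
    case base
    have "F 1 \<in> Cell1 Y" using assms by (auto simp: strict_tensor_2nat_def)
    then show ?case by simp
  next
    case (step n)
    have "\<forall>m \<in> {1..}. \<forall>n \<in> {1..}. F (m + n) = F m \<otimes>\<^sub>1 F n"
      using assms unfolding strict_tensor_2nat_def catalan_2cat_simps by blast
    then have "F (1 + n) = F 1 \<otimes>\<^sub>1 F n" using step(1) by blast
    then show ?case using step by simp
  qed
qed (use assms in \<open>auto simp: strict_tensor_2nat_def PiE_def\<close>)

text \<open>Converse of \<open>pow1_2nat\<close>: naturality is read off at the two generators.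
  Their sources are 2 and 3, where \<open>F\<close> is a power of \<open>F 1\<close> with a trailing
  unit that the unit law removes.\<close>

lemma two_nat_data:
  assumes "strict_tensor_2nat catalan_2cat Y R S F"
  shows "strict_tensor_2functor catalan_2cat Y R" "strict_tensor_2functor catalan_2cat Y S"
    "F 1 \<in> Cell1 Y" "Src1 Y (F 1) = Map0 R 1" "Trg1 Y (F 1) = Map0 S 1"
    "Map1 S [cherry] \<odot> (F 1 \<otimes>\<^sub>1 F 1) = F 1 \<odot> Map1 R [cherry]"
    "Map2 S [assoc_arrow (False, True)] \<star> Id2 Y (F 1 \<otimes>\<^sub>1 F 1 \<otimes>\<^sub>1 F 1) =
      Id2 Y (F 1) \<star> Map2 R [assoc_arrow (False, True)]"
proof -
  show RS: "strict_tensor_2functor catalan_2cat Y R" "strict_tensor_2functor catalan_2cat Y S"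
    and G: "F 1 \<in> Cell1 Y" "Src1 Y (F 1) = Map0 R 1" "Trg1 Y (F 1) = Map0 S 1"
    using assms by (auto simp: strict_tensor_2nat_def)
  have F: "F n = pow1 (F 1) n" if "n \<ge> 1" for n using two_nat_pow[OF assms] that by (metis atLeast_iff restrict_apply)
  have "Map1 S f \<odot> F (sum_list (map leaves f)) = F (length f) \<odot> Map1 R f" if "f \<noteq> []" for f
    using assms that unfolding strict_tensor_2nat_def by auto
  from this[of "[cherry]"] show "Map1 S [cherry] \<odot> (F 1 \<otimes>\<^sub>1 F 1) = F 1 \<odot> Map1 R [cherry]"
    using F[of 2] G by (simp add: numeral_2_eq_2)
  have "Map2 S \<phi> \<star> Id2 Y (F (sum_list (map leaves (map adom \<phi>)))) = Id2 Y (F (length \<phi>)) \<star> Map2 R \<phi>"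
    if "\<phi> \<noteq> []" "list_all avalid \<phi>" for \<phi>
    using assms that unfolding strict_tensor_2nat_def by auto
  from this[of "[assoc_arrow (False, True)]"]
  show "Map2 S [assoc_arrow (False, True)] \<star> Id2 Y (F 1 \<otimes>\<^sub>1 F 1 \<otimes>\<^sub>1 F 1) =
      Id2 Y (F 1) \<star> Map2 R [assoc_arrow (False, True)]"
    using F[of 3] G by (simp add: numeral_3_eq_3)
qed

end

section \<open>The strict tensor 2-category of small categories\<close>

lemma small_catD:
  assumes "is_small_cat C"
  shows "category C" "x \<in> Obj C \<Longrightarrow> length x = width C" "f \<in> Arr C \<Longrightarrow> length f = width C"
  using assms by (auto simp: is_small_cat_def)

text \<open>Composability is unfolded into memberships and an equation between \<open>Dom\<close>
  and \<open>Cod\<close>, conditions that the simplifier can discharge inside nested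
  composites.\<close>

lemma small_cat_simps [simp]:
  assumes "is_small_cat C"
  shows "f \<in> Arr C \<Longrightarrow> Dom C f \<in> Obj C" "f \<in> Arr C \<Longrightarrow> Cod C f \<in> Obj C"
    and "x \<in> Obj C \<Longrightarrow> Id C x \<in> Arr C"
    and "x \<in> Obj C \<Longrightarrow> Dom C (Id C x) = x" "x \<in> Obj C \<Longrightarrow> Cod C (Id C x) = x"
    and "g \<in> Arr C \<Longrightarrow> f \<in> Arr C \<Longrightarrow> Dom C g = Cod C f \<Longrightarrow> Comp C g f \<in> Arr C"
    and "g \<in> Arr C \<Longrightarrow> f \<in> Arr C \<Longrightarrow> Dom C g = Cod C f \<Longrightarrow> Dom C (Comp C g f) = Dom C f"
    and "g \<in> Arr C \<Longrightarrow> f \<in> Arr C \<Longrightarrow> Dom C g = Cod C f \<Longrightarrow> Cod C (Comp C g f) = Cod C g"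
    and "f \<in> Arr C \<Longrightarrow> Dom C f = x \<Longrightarrow> Comp C f (Id C x) = f"
    and "f \<in> Arr C \<Longrightarrow> Cod C f = x \<Longrightarrow> Comp C (Id C x) f = f"
  using categoryD[OF small_catD(1)[OF assms]] by (auto simp: composable_def)

lemma small_cat_assoc:
  assumes "is_small_cat C"
  shows "h \<in> Arr C \<Longrightarrow> g \<in> Arr C \<Longrightarrow> f \<in> Arr C \<Longrightarrow> Dom C h = Cod C g \<Longrightarrow> Dom C g = Cod C f \<Longrightarrow>
    Comp C (Comp C h g) f = Comp C h (Comp C g f)"
  using categoryD(11)[OF small_catD(1)[OF assms], of h g f] by (simp add: composable_def)

text \<open>Both categories are undefined off their carriers, so agreement on arrows and composable
  pairs is enough. Strict associativity and units of the product are equations of records and rest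
  on this.\<close>

lemma small_cat_eqI:
  assumes C: "is_small_cat C" and D: "is_small_cat D"
    and eq: "Obj C = Obj D" "Arr C = Arr D" "width C = width D"
    and "\<And>f. f \<in> Arr C \<Longrightarrow> Dom C f = Dom D f" "\<And>f. f \<in> Arr C \<Longrightarrow> Cod C f = Cod D f"
    and "\<And>x. x \<in> Obj C \<Longrightarrow> Id C x = Id D x"
    and "\<And>g f. g \<in> Arr C \<Longrightarrow> f \<in> Arr C \<Longrightarrow> Dom C g = Cod C f \<Longrightarrow> Comp C g f = Comp D g f"
  shows "C = D"
proof -
  note c = small_catD(1)[OF C, unfolded category_def] and d = small_catD(1)[OF D, unfolded category_def]
  have "Dom C = Dom D" "Cod C = Cod D"
    by (rule extensionalityI[of _ "Arr C"]; use c d eq assms(6,7) in \<open>simp add: PiE_def\<close>)+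
  moreover have "Id C = Id D"
    by (rule extensionalityI[of _ "Obj C"]; use c d eq assms(8) in \<open>simp add: PiE_def\<close>)
  moreover have "Comp C g f = Comp D g f" for g f
  proof (cases "composable C g f")
    case True
    then show ?thesis using assms(9) by (simp add: composable_def)
  next
    case False
    moreover from this have "\<not> composable D g f"
      using eq \<open>Dom C = Dom D\<close> \<open>Cod C = Cod D\<close> by (simp add: composable_def)
    ultimately show ?thesis using c d by simp
  qed
  then have "Comp C = Comp D" by blast
  ultimately show ?thesis using eq by simp
qed

lemma cat1D [simp]:
  assumes "is_cat_1cell F"
  shows "is_small_cat (FSrc F)" "is_small_cat (FTrg F)"
    "x \<in> Obj (FSrc F) \<Longrightarrow> OMap F x \<in> Obj (FTrg F)" "f \<in> Arr (FSrc F) \<Longrightarrow> AMap F f \<in> Arr (FTrg F)"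
    "f \<in> Arr (FSrc F) \<Longrightarrow> Dom (FTrg F) (AMap F f) = OMap F (Dom (FSrc F) f)"
    "f \<in> Arr (FSrc F) \<Longrightarrow> Cod (FTrg F) (AMap F f) = OMap F (Cod (FSrc F) f)"
    "x \<in> Obj (FSrc F) \<Longrightarrow> AMap F (Id (FSrc F) x) = Id (FTrg F) (OMap F x)"
    "g \<in> Arr (FSrc F) \<Longrightarrow> f \<in> Arr (FSrc F) \<Longrightarrow> Dom (FSrc F) g = Cod (FSrc F) f \<Longrightarrow>
      AMap F (Comp (FSrc F) g f) = Comp (FTrg F) (AMap F g) (AMap F f)"
  using assms is_functorD[of "FSrc F" "FTrg F" F] by (auto simp: is_cat_1cell_def composable_def)

lemma cat1I:
  assumes "is_small_cat (FSrc F)" "is_small_cat (FTrg F)"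
    and "OMap F \<in> extensional (Obj (FSrc F))" "AMap F \<in> extensional (Arr (FSrc F))"
    and "\<And>x. x \<in> Obj (FSrc F) \<Longrightarrow> OMap F x \<in> Obj (FTrg F)"
    and "\<And>f. f \<in> Arr (FSrc F) \<Longrightarrow> AMap F f \<in> Arr (FTrg F)"
    and "\<And>f. f \<in> Arr (FSrc F) \<Longrightarrow> Dom (FTrg F) (AMap F f) = OMap F (Dom (FSrc F) f)"
    and "\<And>f. f \<in> Arr (FSrc F) \<Longrightarrow> Cod (FTrg F) (AMap F f) = OMap F (Cod (FSrc F) f)"
    and "\<And>x. x \<in> Obj (FSrc F) \<Longrightarrow> AMap F (Id (FSrc F) x) = Id (FTrg F) (OMap F x)"
    and "\<And>g f. g \<in> Arr (FSrc F) \<Longrightarrow> f \<in> Arr (FSrc F) \<Longrightarrow> Dom (FSrc F) g = Cod (FSrc F) f \<Longrightarrow>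
      AMap F (Comp (FSrc F) g f) = Comp (FTrg F) (AMap F g) (AMap F f)"
  shows "is_cat_1cell F"
  unfolding is_cat_1cell_def
proof (intro conjI is_functorI)
  fix g f assume "composable (FSrc F) g f"
  then show "AMap F (Comp (FSrc F) g f) = Comp (FTrg F) (AMap F g) (AMap F f)"
    using assms(10) by (simp add: composable_def)
qed (rule assms(1-9) assms(1,2)[THEN small_catD(1)] | assumption)+

lemma cat1_extensional:
  assumes "is_cat_1cell F"
  shows "OMap F \<in> extensional (Obj (FSrc F))" "AMap F \<in> extensional (Arr (FSrc F))"
  using assms is_functorD(3,4) unfolding is_cat_1cell_def by blast+

lemma cat1_eqI:
  assumes F: "is_cat_1cell F" and G: "is_cat_1cell G" and eq: "FSrc F = FSrc G" "FTrg F = FTrg G"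
    and "\<And>x. x \<in> Obj (FSrc F) \<Longrightarrow> OMap F x = OMap G x" "\<And>f. f \<in> Arr (FSrc F) \<Longrightarrow> AMap F f = AMap G f"
  shows "F = G"
proof -
  have "OMap F = OMap G" "AMap F = AMap G"
    using extensionalityI[OF cat1_extensional(1)[OF F] cat1_extensional(1)[OF G, folded eq(1)] assms(5)]
      extensionalityI[OF cat1_extensional(2)[OF F] cat1_extensional(2)[OF G, folded eq(1)] assms(6)] by blast+
  then show ?thesis using eq by simp
qed

lemma cat2D [simp]:
  assumes "is_cat_2cell \<tau>"
  shows "is_cat_1cell (NSrc \<tau>)" "is_cat_1cell (NTrg \<tau>)"
    "FSrc (NTrg \<tau>) = FSrc (NSrc \<tau>)" "FTrg (NTrg \<tau>) = FTrg (NSrc \<tau>)"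
    "x \<in> Obj (FSrc (NSrc \<tau>)) \<Longrightarrow> Component \<tau> x \<in> Arr (FTrg (NSrc \<tau>))"
    "x \<in> Obj (FSrc (NSrc \<tau>)) \<Longrightarrow> Dom (FTrg (NSrc \<tau>)) (Component \<tau> x) = OMap (NSrc \<tau>) x"
    "x \<in> Obj (FSrc (NSrc \<tau>)) \<Longrightarrow> Cod (FTrg (NSrc \<tau>)) (Component \<tau> x) = OMap (NTrg \<tau>) x"
  using assms by (auto simp: is_cat_2cell_def is_nat_trans_def hom_def PiE_iff)

text \<open>\<open>cat2D\<close> rewrites source and target of \<open>NTrg \<tau>\<close> to those
  of \<open>NSrc \<tau>\<close>, so the facts about the functor \<open>NTrg \<tau>\<close> are
  restated in that normal form.\<close>

lemma cat2_trg [simp]: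
  assumes "is_cat_2cell \<tau>"
  shows "x \<in> Obj (FSrc (NSrc \<tau>)) \<Longrightarrow> OMap (NTrg \<tau>) x \<in> Obj (FTrg (NSrc \<tau>))"
    "f \<in> Arr (FSrc (NSrc \<tau>)) \<Longrightarrow> AMap (NTrg \<tau>) f \<in> Arr (FTrg (NSrc \<tau>))"
    "f \<in> Arr (FSrc (NSrc \<tau>)) \<Longrightarrow> Dom (FTrg (NSrc \<tau>)) (AMap (NTrg \<tau>) f) = OMap (NTrg \<tau>) (Dom (FSrc (NSrc \<tau>)) f)"
    "f \<in> Arr (FSrc (NSrc \<tau>)) \<Longrightarrow> Cod (FTrg (NSrc \<tau>)) (AMap (NTrg \<tau>) f) = OMap (NTrg \<tau>) (Cod (FSrc (NSrc \<tau>)) f)"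
  using assms cat1D(3-6)[OF cat2D(2)[OF assms]] by simp_all

lemma cat2_natural:
  assumes "is_cat_2cell \<tau>" "f \<in> Arr (FSrc (NSrc \<tau>))"
  shows "Comp (FTrg (NSrc \<tau>)) (Component \<tau> (Cod (FSrc (NSrc \<tau>)) f)) (AMap (NSrc \<tau>) f) =
    Comp (FTrg (NSrc \<tau>)) (AMap (NTrg \<tau>) f) (Component \<tau> (Dom (FSrc (NSrc \<tau>)) f))"
  using assms unfolding is_cat_2cell_def is_nat_trans_def by blast

lemma cat2_extensional: "is_cat_2cell \<tau> \<Longrightarrow> Component \<tau> \<in> extensional (Obj (FSrc (NSrc \<tau>)))"
  unfolding is_cat_2cell_def is_nat_trans_def by (auto simp only: PiE_iff)

lemma cat2I:
  assumes "is_cat_1cell (NSrc \<tau>)" "is_cat_1cell (NTrg \<tau>)"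
    and "FSrc (NTrg \<tau>) = FSrc (NSrc \<tau>)" "FTrg (NTrg \<tau>) = FTrg (NSrc \<tau>)"
    and "Component \<tau> \<in> extensional (Obj (FSrc (NSrc \<tau>)))"
    and "\<And>x. x \<in> Obj (FSrc (NSrc \<tau>)) \<Longrightarrow> Component \<tau> x \<in> Arr (FTrg (NSrc \<tau>))"
    and "\<And>x. x \<in> Obj (FSrc (NSrc \<tau>)) \<Longrightarrow> Dom (FTrg (NSrc \<tau>)) (Component \<tau> x) = OMap (NSrc \<tau>) x"
    and "\<And>x. x \<in> Obj (FSrc (NSrc \<tau>)) \<Longrightarrow> Cod (FTrg (NSrc \<tau>)) (Component \<tau> x) = OMap (NTrg \<tau>) x"
    and "\<And>f. f \<in> Arr (FSrc (NSrc \<tau>)) \<Longrightarrow>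
      Comp (FTrg (NSrc \<tau>)) (Component \<tau> (Cod (FSrc (NSrc \<tau>)) f)) (AMap (NSrc \<tau>) f) =
      Comp (FTrg (NSrc \<tau>)) (AMap (NTrg \<tau>) f) (Component \<tau> (Dom (FSrc (NSrc \<tau>)) f))"
  shows "is_cat_2cell \<tau>"
  unfolding is_cat_2cell_def is_nat_trans_def hom_def PiE_iff
proof (intro conjI ballI)
  show "is_functor (FSrc (NSrc \<tau>)) (FTrg (NSrc \<tau>)) (NTrg \<tau>)"
    using assms(2) unfolding assms(3,4)[symmetric] is_cat_1cell_def by blast
  show "is_functor (FSrc (NSrc \<tau>)) (FTrg (NSrc \<tau>)) (NSrc \<tau>)"
    using assms(1) unfolding is_cat_1cell_def by blast
qed (simp_all add: assms)

lemma cat2_eqI: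
  assumes \<sigma>: "is_cat_2cell \<sigma>" and \<tau>: "is_cat_2cell \<tau>" and eq: "NSrc \<sigma> = NSrc \<tau>" "NTrg \<sigma> = NTrg \<tau>"
    and "\<And>x. x \<in> Obj (FSrc (NSrc \<sigma>)) \<Longrightarrow> Component \<sigma> x = Component \<tau> x"
  shows "\<sigma> = \<tau>"
  using extensionalityI[OF cat2_extensional[OF \<sigma>] cat2_extensional[OF \<tau>, folded eq(1)] assms(5)] eq by simp

lemma cat_id1_simps [simp]:
  "FSrc (cat_id1 C) = C" "FTrg (cat_id1 C) = C"
  "x \<in> Obj C \<Longrightarrow> OMap (cat_id1 C) x = x" "f \<in> Arr C \<Longrightarrow> AMap (cat_id1 C) f = f"
  by (simp_all add: cat_id1_def)

lemma cat_comp1_simps [simp]: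
  "FSrc (cat_comp1 G F) = FSrc F" "FTrg (cat_comp1 G F) = FTrg G"
  "x \<in> Obj (FSrc F) \<Longrightarrow> OMap (cat_comp1 G F) x = OMap G (OMap F x)"
  "f \<in> Arr (FSrc F) \<Longrightarrow> AMap (cat_comp1 G F) f = AMap G (AMap F f)"
  by (simp_all add: cat_comp1_def compose_def)

lemma cat_id2_simps [simp]:
  "NSrc (cat_id2 F) = F" "NTrg (cat_id2 F) = F"
  "x \<in> Obj (FSrc F) \<Longrightarrow> Component (cat_id2 F) x = Id (FTrg F) (OMap F x)"
  by (simp_all add: cat_id2_def)

lemma cat_vcomp_simps [simp]:
  "NSrc (cat_vcomp \<sigma> \<tau>) = NSrc \<tau>" "NTrg (cat_vcomp \<sigma> \<tau>) = NTrg \<sigma>"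
  "x \<in> Obj (FSrc (NSrc \<tau>)) \<Longrightarrow>
   Component (cat_vcomp \<sigma> \<tau>) x = Comp (FTrg (NSrc \<tau>)) (Component \<sigma> x) (Component \<tau> x)"
  by (simp_all add: cat_vcomp_def)

lemma cat_hcomp_simps [simp]:
  "NSrc (cat_hcomp \<sigma> \<tau>) = cat_comp1 (NSrc \<sigma>) (NSrc \<tau>)" "NTrg (cat_hcomp \<sigma> \<tau>) = cat_comp1 (NTrg \<sigma>) (NTrg \<tau>)"
  "x \<in> Obj (FSrc (NSrc \<tau>)) \<Longrightarrow> Component (cat_hcomp \<sigma> \<tau>) x =
   Comp (FTrg (NSrc \<sigma>)) (Component \<sigma> (OMap (NTrg \<tau>) x)) (AMap (NSrc \<sigma>) (Component \<tau> x))"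
  by (simp_all add: cat_hcomp_def)

lemma cat1_id [simp]: "is_small_cat C \<Longrightarrow> is_cat_1cell (cat_id1 C)"
  by (rule cat1I) (auto simp: cat_id1_def)

lemma cat1_comp [simp]:
  assumes "is_cat_1cell G" "is_cat_1cell F" "FSrc G = FTrg F"
  shows "is_cat_1cell (cat_comp1 G F)"
  using assms cat1D[OF assms(1)]
  by (intro cat1I) (simp_all add: cat_comp1_def compose_def extensional_def)

lemma cat2_id [simp]: "is_cat_1cell F \<Longrightarrow> is_cat_2cell (cat_id2 F)"
  by (rule cat2I) (auto simp: cat_id2_def)

lemma cat2_vcomp [simp]:
  assumes "is_cat_2cell \<sigma>" "is_cat_2cell \<tau>" "NSrc \<sigma> = NTrg \<tau>"
  shows "is_cat_2cell (cat_vcomp \<sigma> \<tau>)"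
proof (rule cat2I)
  fix f assume "f \<in> Arr (FSrc (NSrc (cat_vcomp \<sigma> \<tau>)))"
  then have f: "f \<in> Arr (FSrc (NSrc \<tau>))" by simp
  show "Comp (FTrg (NSrc (cat_vcomp \<sigma> \<tau>))) (Component (cat_vcomp \<sigma> \<tau>) (Cod (FSrc (NSrc (cat_vcomp \<sigma> \<tau>))) f))
      (AMap (NSrc (cat_vcomp \<sigma> \<tau>)) f) =
    Comp (FTrg (NSrc (cat_vcomp \<sigma> \<tau>))) (AMap (NTrg (cat_vcomp \<sigma> \<tau>)) f)
      (Component (cat_vcomp \<sigma> \<tau>) (Dom (FSrc (NSrc (cat_vcomp \<sigma> \<tau>))) f))"
    \<comment> \<open>The two passes reassociate in opposite directions: nesting to the right
      exposes the naturality square of \<open>\<tau>\<close>, nesting to the left that of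
      \<open>\<sigma>\<close>.\<close>
    using f assms cat2D[OF assms(1)] cat2_trg[OF assms(1)] cat2_natural[OF assms(1), of f] cat2_natural[OF assms(2) f]
    by (simp add: small_cat_assoc) (simp flip: small_cat_assoc)
qed (use assms cat2D[OF assms(1)] in \<open>simp_all add: cat_vcomp_def\<close>)

lemma cat2_hcomp [simp]:
  assumes "is_cat_2cell \<sigma>" "is_cat_2cell \<tau>" "FSrc (NSrc \<sigma>) = FTrg (NSrc \<tau>)"
  shows "is_cat_2cell (cat_hcomp \<sigma> \<tau>)"
proof (rule cat2I)
  fix f assume "f \<in> Arr (FSrc (NSrc (cat_hcomp \<sigma> \<tau>)))"
  then have f: "f \<in> Arr (FSrc (NSrc \<tau>))" by simp
  note s = cat2D[OF assms(1)] cat2_trg[OF assms(1)] cat1D[OF cat2D(1)[OF assms(1)]] cat1D[OF cat2D(2)[OF assms(1)]]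
  \<comment> \<open>The square of \<open>\<tau>\<close> is transported along the functor
    \<open>NSrc \<sigma>\<close>; the square of \<open>\<sigma>\<close> is then used at the arrow
    \<open>AMap (NTrg \<tau>) f\<close>.\<close>
  have "AMap (NSrc \<sigma>) (Comp (FTrg (NSrc \<tau>)) (Component \<tau> (Cod (FSrc (NSrc \<tau>)) f)) (AMap (NSrc \<tau>) f)) =
    AMap (NSrc \<sigma>) (Comp (FTrg (NSrc \<tau>)) (AMap (NTrg \<tau>) f) (Component \<tau> (Dom (FSrc (NSrc \<tau>)) f)))"
    using cat2_natural[OF assms(2) f] by simp
  then show "Comp (FTrg (NSrc (cat_hcomp \<sigma> \<tau>))) (Component (cat_hcomp \<sigma> \<tau>) (Cod (FSrc (NSrc (cat_hcomp \<sigma> \<tau>))) f))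
      (AMap (NSrc (cat_hcomp \<sigma> \<tau>)) f) =
    Comp (FTrg (NSrc (cat_hcomp \<sigma> \<tau>))) (AMap (NTrg (cat_hcomp \<sigma> \<tau>)) f)
      (Component (cat_hcomp \<sigma> \<tau>) (Dom (FSrc (NSrc (cat_hcomp \<sigma> \<tau>))) f))"
    using f assms s cat2_natural[OF assms(1), of "AMap (NTrg \<tau>) f"]
    by (simp add: small_cat_assoc) (simp flip: small_cat_assoc)
qed (use assms cat2D[OF assms(1)] cat2_trg[OF assms(1)] cat1D[OF cat2D(1)[OF assms(1)]] cat1D[OF cat2D(2)[OF assms(1)]]
  in \<open>simp_all add: cat_hcomp_def\<close>)

section \<open>Products of categories, functors and transformations\<close>

declare times_cat_simps [simp] is_small_cat_times [simp]

lemma width_times [simp]: "width (times_cat C D) = width C + width D"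
  by (simp add: times_cat_def Let_def)

lemma times_objE:
  assumes "z \<in> Obj (times_cat C D)"
  obtains x y where "z = x @ y" "x \<in> Obj C" "y \<in> Obj D"
  using assms by (auto simp: times_cat_def Let_def)

lemma times_arrE:
  assumes "h \<in> Arr (times_cat C D)"
  obtains f g where "h = f @ g" "f \<in> Arr C" "g \<in> Arr D"
  using assms by (auto simp: times_cat_def Let_def)

lemma times_Comp [simp]:
  assumes "is_small_cat C" "is_small_cat D" "g \<in> Arr C" "f \<in> Arr C" "g' \<in> Arr D" "f' \<in> Arr D"
    "Dom C g = Cod C f" "Dom D g' = Cod D f'"
  shows "Comp (times_cat C D) (g @ g') (f @ f') = Comp C g f @ Comp D g' f'"
  using assms by (intro times_cat_simps) (simp_all add: composable_def)

text \<open>All object tuples of a small category have the same length, so a concatenation can be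
  cut in only one way. This is the point of the field \<open>width\<close>.\<close>

lemma append_eq_iff_small:
  assumes "is_small_cat C" "x \<in> Obj C" "x' \<in> Obj C"
  shows "x @ y = x' @ y' \<longleftrightarrow> x = x' \<and> y = y'"
  using assms small_catD(2)[OF assms(1)] by simp

lemma times_arr_composableE:
  assumes "is_small_cat C" "is_small_cat D" "h \<in> Arr (times_cat C D)" "k \<in> Arr (times_cat C D)"
    "Dom (times_cat C D) h = Cod (times_cat C D) k"
  obtains f g f' g' where "h = f @ g" "f \<in> Arr C" "g \<in> Arr D" "k = f' @ g'" "f' \<in> Arr C" "g' \<in> Arr D"
    "Dom C f = Cod C f'" "Dom D g = Cod D g'"
proof -
  obtain f g f' g' where *: "h = f @ g" "f \<in> Arr C" "g \<in> Arr D" "k = f' @ g'" "f' \<in> Arr C" "g' \<in> Arr D"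
    using assms(3,4) by (metis times_arrE)
  moreover from * have "Dom C f = Cod C f'" "Dom D g = Cod D g'"
    using assms append_eq_iff_small[OF assms(1)] by auto
  ultimately show ?thesis using that by blast
qed

lemma times_1cell_FSrc [simp]:
  "FSrc (times_1cell F G) = times_cat (FSrc F) (FSrc G)" "FTrg (times_1cell F G) = times_cat (FTrg F) (FTrg G)"
  by (simp_all add: times_1cell_def Let_def)

lemma times_1cell_simps [simp]:
  assumes "is_small_cat (FSrc F)" "is_small_cat (FSrc G)"
  shows "x \<in> Obj (FSrc F) \<Longrightarrow> y \<in> Obj (FSrc G) \<Longrightarrow> OMap (times_1cell F G) (x @ y) = OMap F x @ OMap G y"
    "f \<in> Arr (FSrc F) \<Longrightarrow> g \<in> Arr (FSrc G) \<Longrightarrow> AMap (times_1cell F G) (f @ g) = AMap F f @ AMap G g"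
  using assms by (simp_all add: times_1cell_def Let_def small_catD(2,3))

lemma cat1_times [simp]:
  assumes "is_cat_1cell F" "is_cat_1cell G"
  shows "is_cat_1cell (times_1cell F G)"
proof (rule cat1I)
  fix h k assume *: "h \<in> Arr (FSrc (times_1cell F G))" "k \<in> Arr (FSrc (times_1cell F G))"
    "Dom (FSrc (times_1cell F G)) h = Cod (FSrc (times_1cell F G)) k"
  obtain f g f' g' where "h = f @ g" "f \<in> Arr (FSrc F)" "g \<in> Arr (FSrc G)"
    "k = f' @ g'" "f' \<in> Arr (FSrc F)" "g' \<in> Arr (FSrc G)"
    "Dom (FSrc F) f = Cod (FSrc F) f'" "Dom (FSrc G) g = Cod (FSrc G) g'"
    by (rule times_arr_composableE[OF cat1D(1)[OF assms(1)] cat1D(1)[OF assms(2)] *[unfolded times_1cell_FSrc]])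
  then show "AMap (times_1cell F G) (Comp (FSrc (times_1cell F G)) h k) =
      Comp (FTrg (times_1cell F G)) (AMap (times_1cell F G) h) (AMap (times_1cell F G) k)"
    using assms by simp
qed (use assms in \<open>auto elim!: times_objE times_arrE\<close>, simp_all add: times_1cell_def Let_def)

lemma times_2cell_simps [simp]:
  "NSrc (times_2cell \<sigma> \<tau>) = times_1cell (NSrc \<sigma>) (NSrc \<tau>)"
  "NTrg (times_2cell \<sigma> \<tau>) = times_1cell (NTrg \<sigma>) (NTrg \<tau>)"
  "is_small_cat (FSrc (NSrc \<sigma>)) \<Longrightarrow> is_small_cat (FSrc (NSrc \<tau>)) \<Longrightarrow>
   x \<in> Obj (FSrc (NSrc \<sigma>)) \<Longrightarrow> y \<in> Obj (FSrc (NSrc \<tau>)) \<Longrightarrow>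
   Component (times_2cell \<sigma> \<tau>) (x @ y) = Component \<sigma> x @ Component \<tau> y"
  by (simp_all add: times_2cell_def Let_def small_catD(2))

lemma cat2_times [simp]:
  assumes "is_cat_2cell \<sigma>" "is_cat_2cell \<tau>"
  shows "is_cat_2cell (times_2cell \<sigma> \<tau>)"
proof (rule cat2I)
  fix h assume "h \<in> Arr (FSrc (NSrc (times_2cell \<sigma> \<tau>)))"
  then obtain f g where "h = f @ g" "f \<in> Arr (FSrc (NSrc \<sigma>))" "g \<in> Arr (FSrc (NSrc \<tau>))"
    by (auto elim!: times_arrE)
  then show "Comp (FTrg (NSrc (times_2cell \<sigma> \<tau>)))
      (Component (times_2cell \<sigma> \<tau>) (Cod (FSrc (NSrc (times_2cell \<sigma> \<tau>))) h)) (AMap (NSrc (times_2cell \<sigma> \<tau>)) h) =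
    Comp (FTrg (NSrc (times_2cell \<sigma> \<tau>))) (AMap (NTrg (times_2cell \<sigma> \<tau>)) h)
      (Component (times_2cell \<sigma> \<tau>) (Dom (FSrc (NSrc (times_2cell \<sigma> \<tau>))) h))"
    using assms by (simp add: cat2_natural)
qed (use assms in \<open>auto elim!: times_objE\<close>, simp_all add: times_2cell_def Let_def)

section \<open>Strict associativity and units of the product\<close>

definition unit_cat :: "('o, 'm) small_cat" where
  "unit_cat = \<lparr>Obj = {[]}, Arr = {[]}, Dom = restrict (\<lambda>_. []) {[]}, Cod = restrict (\<lambda>_. []) {[]},
     Id = restrict (\<lambda>_. []) {[]}, Comp = (\<lambda>g f. if g = [] \<and> f = [] then [] else undefined), width = 0\<rparr>"

lemma unit_cat_simps [simp]:
  "Obj unit_cat = {[]}" "Arr unit_cat = {[]}" "Dom unit_cat [] = []" "Cod unit_cat [] = []"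
  "Id unit_cat [] = []" "Comp unit_cat [] [] = []" "width unit_cat = 0"
  by (simp_all add: unit_cat_def)

lemma is_small_cat_unit [simp]: "is_small_cat unit_cat"
proof -
  have "category unit_cat"
    by (rule categoryI) (auto simp: composable_def hom_def, auto simp: unit_cat_def PiE_iff)
  then show ?thesis by (simp add: is_small_cat_def)
qed

lemma times_cat_assoc:
  assumes C: "is_small_cat C" and D: "is_small_cat D" and E: "is_small_cat E"
  shows "times_cat (times_cat C D) E = times_cat C (times_cat D E)"
proof -
  \<comment> \<open>Lists are normalised to \<open>x @ y @ z\<close>, while the rules for the
    left-nested product match \<open>(x @ y) @ z\<close>; these facts restate the rules for the
    normalised form.\<close>
  have l: "x @ y @ z \<in> Obj (times_cat (times_cat C D) E)" if "x \<in> Obj C" "y \<in> Obj D" "z \<in> Obj E" for x y z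
    using assms that times_cat_simps(1)[of "times_cat C D" E "x @ y" z] by simp
  have la: "f @ g @ h \<in> Arr (times_cat (times_cat C D) E)" if "f \<in> Arr C" "g \<in> Arr D" "h \<in> Arr E" for f g h
    using assms that times_cat_simps(2)[of "times_cat C D" E "f @ g" h] by simp
  have ld: "Dom (times_cat (times_cat C D) E) (f @ g @ h) = Dom C f @ Dom D g @ Dom E h"
    "Cod (times_cat (times_cat C D) E) (f @ g @ h) = Cod C f @ Cod D g @ Cod E h"
    if "f \<in> Arr C" "g \<in> Arr D" "h \<in> Arr E" for f g h
    using assms that times_cat_simps(3,4)[of "times_cat C D" E "f @ g" h] by simp_all
  have li: "Id (times_cat (times_cat C D) E) (x @ y @ z) = Id C x @ Id D y @ Id E z"
    if "x \<in> Obj C" "y \<in> Obj D" "z \<in> Obj E" for x y z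
    using assms that times_cat_simps(5)[of "times_cat C D" E "x @ y" z] by simp
  have lc: "Comp (times_cat (times_cat C D) E) (f @ g @ h) (f' @ g' @ h') = Comp C f f' @ Comp D g g' @ Comp E h h'"
    if "f \<in> Arr C" "g \<in> Arr D" "h \<in> Arr E" "f' \<in> Arr C" "g' \<in> Arr D" "h' \<in> Arr E"
      "Dom C f = Cod C f'" "Dom D g = Cod D g'" "Dom E h = Cod E h'" for f g h f' g' h'
    using assms that times_Comp[of "times_cat C D" E "f @ g" "f' @ g'" h h'] by simp
  have o: "Obj (times_cat (times_cat C D) E) = Obj (times_cat C (times_cat D E))"
    using assms l by (auto elim!: times_objE)
  have a: "Arr (times_cat (times_cat C D) E) = Arr (times_cat C (times_cat D E))"
  proof (intro equalityI subsetI)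
    fix h assume "h \<in> Arr (times_cat (times_cat C D) E)"
    then obtain f g k where "h = (f @ g) @ k" "f \<in> Arr C" "g \<in> Arr D" "k \<in> Arr E" by (metis times_arrE)
    then show "h \<in> Arr (times_cat C (times_cat D E))" using assms by simp
  next
    fix h assume "h \<in> Arr (times_cat C (times_cat D E))"
    then obtain f g k where "h = f @ g @ k" "f \<in> Arr C" "g \<in> Arr D" "k \<in> Arr E" by (metis times_arrE)
    then show "h \<in> Arr (times_cat (times_cat C D) E)" using la by simp
  qed
  show ?thesis
  proof (rule small_cat_eqI)
    show "Obj (times_cat (times_cat C D) E) = Obj (times_cat C (times_cat D E))" by (rule o)
    show "Arr (times_cat (times_cat C D) E) = Arr (times_cat C (times_cat D E))" by (rule a)
  next
    fix f f' assume *: "f \<in> Arr (times_cat (times_cat C D) E)" "f' \<in> Arr (times_cat (times_cat C D) E)"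
      "Dom (times_cat (times_cat C D) E) f = Cod (times_cat (times_cat C D) E) f'"
    obtain p k p' k' where p: "f = p @ k" "k \<in> Arr E" "f' = p' @ k'" "k' \<in> Arr E" "Dom E k = Cod E k'"
      "p \<in> Arr (times_cat C D)" "p' \<in> Arr (times_cat C D)" "Dom (times_cat C D) p = Cod (times_cat C D) p'"
      by (rule times_arr_composableE[OF is_small_cat_times[OF C D] E *])
    obtain g h g' h' where "p = g @ h" "g \<in> Arr C" "h \<in> Arr D" "p' = g' @ h'" "g' \<in> Arr C" "h' \<in> Arr D"
      "Dom C g = Cod C g'" "Dom D h = Cod D h'"
      by (rule times_arr_composableE[OF C D p(6-8)])
    then show "Comp (times_cat (times_cat C D) E) f f' = Comp (times_cat C (times_cat D E)) f f'"
      using assms p(1-5) by (simp add: lc)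
  qed (use assms in \<open>auto elim!: times_arrE times_objE simp: ld li\<close>)
qed

lemma times_cat_unit:
  assumes C: "is_small_cat C"
  shows "times_cat unit_cat C = C" "times_cat C unit_cat = C"
proof -
  \<comment> \<open>\<open>[] @ f\<close> simplifies to \<open>f\<close>, after which the product
    rules no longer match, so they are instantiated at the empty tuple beforehand.\<close>
  have l: "x \<in> Obj C \<Longrightarrow> x \<in> Obj (times_cat unit_cat C)" "f \<in> Arr C \<Longrightarrow> f \<in> Arr (times_cat unit_cat C)"
    "f \<in> Arr C \<Longrightarrow> Dom (times_cat unit_cat C) f = Dom C f" "f \<in> Arr C \<Longrightarrow> Cod (times_cat unit_cat C) f = Cod C f"
    "x \<in> Obj C \<Longrightarrow> Id (times_cat unit_cat C) x = Id C x"
    "f \<in> Arr C \<Longrightarrow> g \<in> Arr C \<Longrightarrow> Dom C g = Cod C f \<Longrightarrow> Comp (times_cat unit_cat C) g f = Comp C g f"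
    for x f g
    using times_cat_simps(1-5)[OF is_small_cat_unit C, of "[]"] C
      times_Comp[OF is_small_cat_unit C, of "[]" "[]" g f] by simp_all
  have r: "x \<in> Obj C \<Longrightarrow> x \<in> Obj (times_cat C unit_cat)" "f \<in> Arr C \<Longrightarrow> f \<in> Arr (times_cat C unit_cat)"
    "f \<in> Arr C \<Longrightarrow> Dom (times_cat C unit_cat) f = Dom C f" "f \<in> Arr C \<Longrightarrow> Cod (times_cat C unit_cat) f = Cod C f"
    "x \<in> Obj C \<Longrightarrow> Id (times_cat C unit_cat) x = Id C x"
    "f \<in> Arr C \<Longrightarrow> g \<in> Arr C \<Longrightarrow> Dom C g = Cod C f \<Longrightarrow> Comp (times_cat C unit_cat) g f = Comp C g f"
    for x f g
    using times_cat_simps(1-5)[OF C is_small_cat_unit, of _ "[]"] C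
      times_Comp[OF C is_small_cat_unit, of g f "[]" "[]"] by simp_all
  have "Obj (times_cat unit_cat C) = Obj C" "Arr (times_cat unit_cat C) = Arr C"
    "Obj (times_cat C unit_cat) = Obj C" "Arr (times_cat C unit_cat) = Arr C"
    using l r by (auto elim!: times_objE times_arrE)
  then show "times_cat unit_cat C = C" "times_cat C unit_cat = C"
    using C l r by (auto intro!: small_cat_eqI)
qed

section \<open>Laws of composition and product\<close>

lemma cat_comp1_assoc:
  assumes "is_cat_1cell H" "is_cat_1cell G" "is_cat_1cell F" "FSrc H = FTrg G" "FSrc G = FTrg F"
  shows "cat_comp1 (cat_comp1 H G) F = cat_comp1 H (cat_comp1 G F)"
  using assms by (intro cat1_eqI) simp_all

lemma cat_comp1_id:
  assumes "is_cat_1cell F"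
  shows "cat_comp1 (cat_id1 (FTrg F)) F = F" "cat_comp1 F (cat_id1 (FSrc F)) = F"
  using assms by (auto intro!: cat1_eqI)

lemma times_1cell_assoc:
  assumes "is_cat_1cell F" "is_cat_1cell G" "is_cat_1cell H"
  shows "times_1cell (times_1cell F G) H = times_1cell F (times_1cell G H)"
proof (rule cat1_eqI)
  fix x assume "x \<in> Obj (FSrc (times_1cell (times_1cell F G) H))"
  then obtain a b c where x: "x = (a @ b) @ c" "a \<in> Obj (FSrc F)" "b \<in> Obj (FSrc G)" "c \<in> Obj (FSrc H)"
    unfolding times_1cell_FSrc by (metis times_objE)
  show "OMap (times_1cell (times_1cell F G) H) x = OMap (times_1cell F (times_1cell G H)) x"
    unfolding x using x assms times_1cell_simps(1)[of "times_1cell F G" H "a @ b" c] by simp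
next
  fix x assume "x \<in> Arr (FSrc (times_1cell (times_1cell F G) H))"
  then obtain a b c where x: "x = (a @ b) @ c" "a \<in> Arr (FSrc F)" "b \<in> Arr (FSrc G)" "c \<in> Arr (FSrc H)"
    unfolding times_1cell_FSrc by (metis times_arrE)
  show "AMap (times_1cell (times_1cell F G) H) x = AMap (times_1cell F (times_1cell G H)) x"
    unfolding x using x assms times_1cell_simps(2)[of "times_1cell F G" H "a @ b" c] by simp
qed (use assms in \<open>simp_all add: times_cat_assoc\<close>)

lemma times_1cell_unit:
  assumes "is_cat_1cell F"
  shows "times_1cell (cat_id1 unit_cat) F = F" "times_1cell F (cat_id1 unit_cat) = F"
proof -
  show "times_1cell (cat_id1 unit_cat) F = F"
    using assms times_1cell_simps[of "cat_id1 unit_cat" F "[]"]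
    by (intro cat1_eqI) (auto simp: times_cat_unit)
  have "OMap (times_1cell F (cat_id1 unit_cat)) x = OMap F x" if "x \<in> Obj (FSrc F)" for x
    using assms that times_1cell_simps(1)[of F "cat_id1 unit_cat" x "[]"] by simp
  moreover have "AMap (times_1cell F (cat_id1 unit_cat)) x = AMap F x" if "x \<in> Arr (FSrc F)" for x
    using assms that times_1cell_simps(2)[of F "cat_id1 unit_cat" x "[]"] by simp
  ultimately show "times_1cell F (cat_id1 unit_cat) = F"
    using assms by (intro cat1_eqI) (auto simp: times_cat_unit)
qed

lemma times_1cell_id:
  assumes "is_small_cat C" "is_small_cat D"
  shows "times_1cell (cat_id1 C) (cat_id1 D) = cat_id1 (times_cat C D)"
  using assms by (intro cat1_eqI) (auto elim!: times_objE times_arrE)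

lemma times_1cell_comp:
  assumes "is_cat_1cell G" "is_cat_1cell F" "is_cat_1cell G'" "is_cat_1cell F'" "FSrc G = FTrg F" "FSrc G' = FTrg F'"
  shows "times_1cell (cat_comp1 G F) (cat_comp1 G' F') = cat_comp1 (times_1cell G G') (times_1cell F F')"
proof (rule cat1_eqI)
  fix x assume "x \<in> Obj (FSrc (times_1cell (cat_comp1 G F) (cat_comp1 G' F')))"
  then obtain a b where "x = a @ b" "a \<in> Obj (FSrc F)" "b \<in> Obj (FSrc F')" by (auto elim!: times_objE)
  then show "OMap (times_1cell (cat_comp1 G F) (cat_comp1 G' F')) x =
      OMap (cat_comp1 (times_1cell G G') (times_1cell F F')) x"
    using assms by simp
next
  fix x assume "x \<in> Arr (FSrc (times_1cell (cat_comp1 G F) (cat_comp1 G' F')))"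
  then obtain a b where "x = a @ b" "a \<in> Arr (FSrc F)" "b \<in> Arr (FSrc F')" by (auto elim!: times_arrE)
  then show "AMap (times_1cell (cat_comp1 G F) (cat_comp1 G' F')) x =
      AMap (cat_comp1 (times_1cell G G') (times_1cell F F')) x"
    using assms by simp
qed (use assms in simp_all)

lemma cat_vcomp_assoc:
  assumes "is_cat_2cell \<rho>" "is_cat_2cell \<sigma>" "is_cat_2cell \<tau>" "NSrc \<rho> = NTrg \<sigma>" "NSrc \<sigma> = NTrg \<tau>"
  shows "cat_vcomp (cat_vcomp \<rho> \<sigma>) \<tau> = cat_vcomp \<rho> (cat_vcomp \<sigma> \<tau>)"
  using assms cat2D[OF assms(1)] cat2D[OF assms(2)] by (intro cat2_eqI) (simp_all add: small_cat_assoc)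

lemma cat_vcomp_id:
  assumes "is_cat_2cell \<tau>"
  shows "cat_vcomp (cat_id2 (NTrg \<tau>)) \<tau> = \<tau>" "cat_vcomp \<tau> (cat_id2 (NSrc \<tau>)) = \<tau>"
  using assms by (auto intro!: cat2_eqI)

lemma cat_hcomp_assoc:
  assumes "is_cat_2cell \<rho>" "is_cat_2cell \<sigma>" "is_cat_2cell \<tau>"
    "FSrc (NSrc \<rho>) = FTrg (NSrc \<sigma>)" "FSrc (NSrc \<sigma>) = FTrg (NSrc \<tau>)"
  shows "cat_hcomp (cat_hcomp \<rho> \<sigma>) \<tau> = cat_hcomp \<rho> (cat_hcomp \<sigma> \<tau>)"
proof (rule cat2_eqI)
  note s = cat2D[OF assms(1)] cat2_trg[OF assms(1)] cat1D[OF cat2D(1)[OF assms(1)]]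
    cat2D[OF assms(2)] cat2_trg[OF assms(2)] cat1D[OF cat2D(1)[OF assms(2)]]
  fix x assume "x \<in> Obj (FSrc (NSrc (cat_hcomp (cat_hcomp \<rho> \<sigma>) \<tau>)))"
  then show "Component (cat_hcomp (cat_hcomp \<rho> \<sigma>) \<tau>) x = Component (cat_hcomp \<rho> (cat_hcomp \<sigma> \<tau>)) x"
    using assms s by (simp add: small_cat_assoc)
qed (use assms in \<open>simp_all add: cat_comp1_assoc\<close>)

lemma cat_hcomp_id:
  assumes "is_cat_2cell \<tau>"
  shows "cat_hcomp (cat_id2 (cat_id1 (FTrg (NSrc \<tau>)))) \<tau> = \<tau>" "cat_hcomp \<tau> (cat_id2 (cat_id1 (FSrc (NSrc \<tau>)))) = \<tau>"
proof -
  have t: "cat_comp1 (cat_id1 (FTrg (NSrc \<tau>))) (NSrc \<tau>) = NSrc \<tau>" "cat_comp1 (NSrc \<tau>) (cat_id1 (FSrc (NSrc \<tau>))) = NSrc \<tau>"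
    "cat_comp1 (cat_id1 (FTrg (NSrc \<tau>))) (NTrg \<tau>) = NTrg \<tau>" "cat_comp1 (NTrg \<tau>) (cat_id1 (FSrc (NSrc \<tau>))) = NTrg \<tau>"
    using assms cat_comp1_id[of "NSrc \<tau>"] cat_comp1_id[of "NTrg \<tau>"] by simp_all
  show "cat_hcomp (cat_id2 (cat_id1 (FTrg (NSrc \<tau>)))) \<tau> = \<tau>" "cat_hcomp \<tau> (cat_id2 (cat_id1 (FSrc (NSrc \<tau>)))) = \<tau>"
    using assms t by (auto intro!: cat2_eqI)
qed

lemma cat_hcomp_id2:
  assumes "is_cat_1cell G" "is_cat_1cell F" "FSrc G = FTrg F"
  shows "cat_hcomp (cat_id2 G) (cat_id2 F) = cat_id2 (cat_comp1 G F)"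
proof (rule cat2_eqI)
  fix x assume "x \<in> Obj (FSrc (NSrc (cat_hcomp (cat_id2 G) (cat_id2 F))))"
  then show "Component (cat_hcomp (cat_id2 G) (cat_id2 F)) x = Component (cat_id2 (cat_comp1 G F)) x"
    using assms cat1D(7)[OF assms(1), of "OMap F x"] cat1D[OF assms(1)] by simp
qed (use assms in simp_all)

text \<open>After functoriality has split the images of composites, the two sides differ by the
  naturality square of \<open>\<phi>\<close> at the component of \<open>\<psi>'\<close>.\<close>

lemma cat_hcomp_vcomp:
  assumes "is_cat_2cell \<psi>" "is_cat_2cell \<phi>" "is_cat_2cell \<psi>'" "is_cat_2cell \<phi>'"
    "NSrc \<psi> = NTrg \<phi>" "NSrc \<psi>' = NTrg \<phi>'" "FSrc (NSrc \<phi>) = FTrg (NSrc \<phi>')"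
  shows "cat_hcomp (cat_vcomp \<psi> \<phi>) (cat_vcomp \<psi>' \<phi>') = cat_vcomp (cat_hcomp \<psi> \<psi>') (cat_hcomp \<phi> \<phi>')"
proof (rule cat2_eqI)
  note s = cat2D[OF assms(1)] cat2_trg[OF assms(1)] cat2D[OF assms(3)] cat2_trg[OF assms(3)]
    cat2D[OF assms(2)] cat2_trg[OF assms(2)] cat1D[OF cat2D(1)[OF assms(2)]] cat1D[OF cat2D(2)[OF assms(2)]]
  fix x assume "x \<in> Obj (FSrc (NSrc (cat_hcomp (cat_vcomp \<psi> \<phi>) (cat_vcomp \<psi>' \<phi>'))))"
  then have "x \<in> Obj (FSrc (NSrc \<phi>'))" by simp
  then show "Component (cat_hcomp (cat_vcomp \<psi> \<phi>) (cat_vcomp \<psi>' \<phi>')) x =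
      Component (cat_vcomp (cat_hcomp \<psi> \<psi>') (cat_hcomp \<phi> \<phi>')) x"
    using assms s cat2_natural[OF assms(2), of "Component \<psi>' x"]
    by (simp add: small_cat_assoc) (simp flip: small_cat_assoc)
qed (use assms cat2D[OF assms(1)] cat2D[OF assms(3)] in simp_all)

lemma times_2cell_assoc:
  assumes "is_cat_2cell \<rho>" "is_cat_2cell \<sigma>" "is_cat_2cell \<tau>"
  shows "times_2cell (times_2cell \<rho> \<sigma>) \<tau> = times_2cell \<rho> (times_2cell \<sigma> \<tau>)"
proof (rule cat2_eqI)
  fix x assume "x \<in> Obj (FSrc (NSrc (times_2cell (times_2cell \<rho> \<sigma>) \<tau>)))"
  then obtain a b c where x: "x = (a @ b) @ c" "a \<in> Obj (FSrc (NSrc \<rho>))" "b \<in> Obj (FSrc (NSrc \<sigma>))" "c \<in> Obj (FSrc (NSrc \<tau>))"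
    unfolding times_1cell_FSrc times_2cell_simps by (metis times_objE)
  show "Component (times_2cell (times_2cell \<rho> \<sigma>) \<tau>) x = Component (times_2cell \<rho> (times_2cell \<sigma> \<tau>)) x"
    unfolding x using x assms times_2cell_simps(3)[of "times_2cell \<rho> \<sigma>" \<tau> "a @ b" c] by simp
qed (use assms in \<open>simp_all add: times_1cell_assoc\<close>)

lemma times_2cell_unit:
  assumes "is_cat_2cell \<tau>"
  shows "times_2cell (cat_id2 (cat_id1 unit_cat)) \<tau> = \<tau>" "times_2cell \<tau> (cat_id2 (cat_id1 unit_cat)) = \<tau>"
proof -
  have "Component (times_2cell (cat_id2 (cat_id1 unit_cat)) \<tau>) x = Component \<tau> x" if "x \<in> Obj (FSrc (NSrc \<tau>))" for x
    using assms that times_2cell_simps(3)[of "cat_id2 (cat_id1 unit_cat)" \<tau> "[]" x] by simp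
  then show "times_2cell (cat_id2 (cat_id1 unit_cat)) \<tau> = \<tau>"
    using assms by (intro cat2_eqI) (simp_all add: times_1cell_unit times_cat_unit)
  have "Component (times_2cell \<tau> (cat_id2 (cat_id1 unit_cat))) x = Component \<tau> x" if "x \<in> Obj (FSrc (NSrc \<tau>))" for x
    using assms that times_2cell_simps(3)[of \<tau> "cat_id2 (cat_id1 unit_cat)" x "[]"] by simp
  then show "times_2cell \<tau> (cat_id2 (cat_id1 unit_cat)) = \<tau>"
    using assms by (intro cat2_eqI) (simp_all add: times_1cell_unit times_cat_unit)
qed

lemma times_2cell_id:
  assumes "is_cat_1cell F" "is_cat_1cell G"
  shows "times_2cell (cat_id2 F) (cat_id2 G) = cat_id2 (times_1cell F G)"
  using assms by (intro cat2_eqI) (auto elim!: times_objE)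

lemma times_2cell_vcomp:
  assumes "is_cat_2cell \<psi>" "is_cat_2cell \<phi>" "is_cat_2cell \<psi>'" "is_cat_2cell \<phi>'" "NSrc \<psi> = NTrg \<phi>" "NSrc \<psi>' = NTrg \<phi>'"
  shows "times_2cell (cat_vcomp \<psi> \<phi>) (cat_vcomp \<psi>' \<phi>') = cat_vcomp (times_2cell \<psi> \<psi>') (times_2cell \<phi> \<phi>')"
proof (rule cat2_eqI)
  fix x assume "x \<in> Obj (FSrc (NSrc (times_2cell (cat_vcomp \<psi> \<phi>) (cat_vcomp \<psi>' \<phi>'))))"
  then obtain a b where "x = a @ b" "a \<in> Obj (FSrc (NSrc \<phi>))" "b \<in> Obj (FSrc (NSrc \<phi>'))" by (auto elim!: times_objE)
  then show "Component (times_2cell (cat_vcomp \<psi> \<phi>) (cat_vcomp \<psi>' \<phi>')) x =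
      Component (cat_vcomp (times_2cell \<psi> \<psi>') (times_2cell \<phi> \<phi>')) x"
    using assms cat2D[OF assms(1)] cat2D[OF assms(3)] by simp
qed (use assms cat2D[OF assms(1)] cat2D[OF assms(3)] in simp_all)

lemma times_2cell_hcomp:
  assumes "is_cat_2cell \<psi>" "is_cat_2cell \<phi>" "is_cat_2cell \<psi>'" "is_cat_2cell \<phi>'"
    "FSrc (NSrc \<psi>) = FTrg (NSrc \<phi>)" "FSrc (NSrc \<psi>') = FTrg (NSrc \<phi>')"
  shows "times_2cell (cat_hcomp \<psi> \<phi>) (cat_hcomp \<psi>' \<phi>') = cat_hcomp (times_2cell \<psi> \<psi>') (times_2cell \<phi> \<phi>')"
proof (rule cat2_eqI)
  note s = cat2D[OF assms(1)] cat2_trg[OF assms(1)] cat1D[OF cat2D(1)[OF assms(1)]] cat1D[OF cat2D(2)[OF assms(1)]]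
    cat2D[OF assms(3)] cat2_trg[OF assms(3)] cat1D[OF cat2D(1)[OF assms(3)]] cat1D[OF cat2D(2)[OF assms(3)]]
  fix x assume "x \<in> Obj (FSrc (NSrc (times_2cell (cat_hcomp \<psi> \<phi>) (cat_hcomp \<psi>' \<phi>'))))"
  then obtain a b where "x = a @ b" "a \<in> Obj (FSrc (NSrc \<phi>))" "b \<in> Obj (FSrc (NSrc \<phi>'))" by (auto elim!: times_objE)
  then show "Component (times_2cell (cat_hcomp \<psi> \<phi>) (cat_hcomp \<psi>' \<phi>')) x =
      Component (cat_hcomp (times_2cell \<psi> \<psi>') (times_2cell \<phi> \<phi>')) x"
    using assms s by simp
qed (use assms in \<open>simp_all add: times_1cell_comp\<close>)

lemma cat_2cat_simps [simp]:
  "Cell0 cat_2cat = Collect is_small_cat" "Cell1 cat_2cat = Collect is_cat_1cell"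
  "Cell2 cat_2cat = Collect is_cat_2cell" "Src1 cat_2cat = FSrc" "Trg1 cat_2cat = FTrg"
  "Src2 cat_2cat = NSrc" "Trg2 cat_2cat = NTrg" "Id1 cat_2cat = cat_id1" "Id2 cat_2cat = cat_id2"
  "HComp1 cat_2cat = cat_comp1" "VComp cat_2cat = cat_vcomp" "HComp2 cat_2cat = cat_hcomp"
  "Ten0 cat_2cat = times_cat" "Ten1 cat_2cat = times_1cell" "Ten2 cat_2cat = times_2cell"
  by (simp_all add: cat_2cat_def)

lemma tensor_2category_cat: "tensor_2category cat_2cat unit_cat"
  by unfold_locales
    (auto simp: cat_comp1_assoc cat_comp1_id cat_vcomp_assoc cat_vcomp_id cat_hcomp_assoc cat_hcomp_id
      cat_hcomp_id2 cat_hcomp_vcomp times_cat_assoc times_1cell_assoc times_2cell_assoc times_cat_unit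
      times_1cell_unit times_2cell_unit times_1cell_id times_2cell_id times_1cell_comp times_2cell_vcomp
      times_2cell_hcomp)

section \<open>Isomorphisms of categories are equivalences\<close>

lemma is_nat_iso_id:
  assumes F: "is_functor C D F"
  shows "is_nat_iso C D F F (\<lambda>x \<in> Obj C. Id D (OMap F x))"
proof -
  note c = categoryD[OF is_functorD(1)[OF F]] and d = categoryD[OF is_functorD(2)[OF F]] and f = is_functorD[OF F]
  have "Comp D (Id D (OMap F (Cod C g))) (AMap F g) = Comp D (AMap F g) (Id D (OMap F (Dom C g)))"
    if "g \<in> Arr C" for g
    using that d(9,10)[OF f(6)[OF that]] f(7,8)[OF that] by simp
  moreover have "iso D (Id D x)" if "x \<in> Obj D" for x
    using that d(3-5) d(9)[of "Id D x"] by (auto simp: iso_def hom_def)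
  ultimately show ?thesis
    using F c d f(5) by (auto simp: is_nat_iso_def is_nat_trans_def hom_def)
qed

text \<open>The inverse bijections form a functor, and because all maps are restricted to their
  carriers both composites equal the identity functors on the nose. Identity transformations then
  serve as unit and counit.\<close>

lemma equivalent_categories_bij:
  fixes C :: "('o, 'm) category" and D :: "('p, 'q) category" and F :: "('o, 'm, 'p, 'q) functor_maps"
  assumes F: "is_functor C D F" and bij: "bij_betw (OMap F) (Obj C) (Obj D)" "bij_betw (AMap F) (Arr C) (Arr D)"
  shows "equivalent_categories C D"
proof -
  note c = categoryD[OF is_functorD(1)[OF F]] and d = categoryD[OF is_functorD(2)[OF F]] and f = is_functorD[OF F]
  define G :: "('p, 'q, 'o, 'm) functor_maps" where
    "G = \<lparr>OMap = restrict (inv_into (Obj C) (OMap F)) (Obj D), AMap = restrict (inv_into (Arr C) (AMap F)) (Arr D)\<rparr>"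
  have G: "y \<in> Obj D \<Longrightarrow> OMap G y \<in> Obj C" "y \<in> Obj D \<Longrightarrow> OMap F (OMap G y) = y"
    "h \<in> Arr D \<Longrightarrow> AMap G h \<in> Arr C" "h \<in> Arr D \<Longrightarrow> AMap F (AMap G h) = h"
    "x \<in> Obj C \<Longrightarrow> OMap G (OMap F x) = x" "g \<in> Arr C \<Longrightarrow> AMap G (AMap F g) = g" for x y g h
    using bij f(5,6)
    by (auto simp: G_def bij_betw_def inv_into_into f_inv_into_f)
  have injO: "x = y" if "OMap F x = OMap F y" "x \<in> Obj C" "y \<in> Obj C" for x y
    using that G(5) by metis
  have injA: "x = y" if "AMap F x = AMap F y" "x \<in> Arr C" "y \<in> Arr C" for x y
    using that G(6) by metis
  \<comment> \<open>\<open>F\<close> sends the domain of \<open>AMap G h\<close> to the domain of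
    \<open>h\<close>; applying \<open>G\<close> to both gives the claim, and codomains are treated
    alike.\<close>
  have Gd: "Dom C (AMap G h) = OMap G (Dom D h)" "Cod C (AMap G h) = OMap G (Cod D h)" if "h \<in> Arr D" for h
    using that f(7,8)[OF G(3)[OF that]] G c(1,2)[OF G(3)[OF that]] by metis+
  have "is_functor D C G"
  proof (rule is_functorI)
    fix y assume y: "y \<in> Obj D"
    show "AMap G (Id D y) = Id C (OMap G y)"
      using f(9)[OF G(1)[OF y]] G(6)[OF c(3)[OF G(1)[OF y]]] G(2)[OF y] by simp
  next
    fix k h assume kh: "composable D k h"
    then have *: "k \<in> Arr D" "h \<in> Arr D" "Dom D k = Cod D h" by (auto simp: composable_def)
    then have **: "composable C (AMap G k) (AMap G h)" using G(3) Gd by (auto simp: composable_def)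
    show "AMap G (Comp D k h) = Comp C (AMap G k) (AMap G h)"
      using f(10)[OF **] G(4)[OF *(1)] G(4)[OF *(2)] G(6)[OF c(6)[OF **]] by simp
  qed (use f(1,2) G Gd in \<open>auto simp: G_def\<close>)
  moreover have "comp_functor C G F = id_functor C" "comp_functor D F G = id_functor D"
    using G by (auto simp: comp_functor_def id_functor_def compose_def cong: restrict_cong)
  ultimately show ?thesis
    using F f(1,2) is_nat_iso_id[OF is_functor_id[OF f(1)]] is_nat_iso_id[OF is_functor_id[OF f(2)]]
    unfolding equivalent_categories_def by metis
qed

section \<open>The category of 2-functors\<close>

lemma Hom_st_simps [simp]:
  "Obj (Hom_st X Y) = {R. strict_tensor_2functor X Y R}"
  "Arr (Hom_st X Y) = {(R, S, F). strict_tensor_2nat X Y R S F}"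
  "strict_tensor_2nat X Y R S F \<Longrightarrow> Dom (Hom_st X Y) (R, S, F) = R"
  "strict_tensor_2nat X Y R S F \<Longrightarrow> Cod (Hom_st X Y) (R, S, F) = S"
  "strict_tensor_2functor X Y R \<Longrightarrow>
   Id (Hom_st X Y) R = (R, R, restrict (\<lambda>x. Id1 Y (Map0 R x)) (Cell0 X))"
  "strict_tensor_2nat X Y R S F \<Longrightarrow> strict_tensor_2nat X Y S T G \<Longrightarrow>
   Comp (Hom_st X Y) (S, T, G) (R, S, F) = (R, T, restrict (\<lambda>x. HComp1 Y (G x) (F x)) (Cell0 X))"
  by (simp_all add: Hom_st_def Let_def)

context tensor_2category
begin

lemma two_natD:
  assumes "strict_tensor_2nat catalan_2cat Y R S F"
  shows "n \<ge> Suc 0 \<Longrightarrow> F n \<in> Cell1 Y" "n \<ge> Suc 0 \<Longrightarrow> Src1 Y (F n) = Map0 R n" "n \<ge> Suc 0 \<Longrightarrow> Trg1 Y (F n) = Map0 S n"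
    "F \<in> extensional {Suc 0..}"
    "m \<ge> Suc 0 \<Longrightarrow> n \<ge> Suc 0 \<Longrightarrow> F (m + n) = F m \<otimes>\<^sub>1 F n"
    "f \<noteq> [] \<Longrightarrow> Map1 S f \<odot> F (sum_list (map leaves f)) = F (length f) \<odot> Map1 R f"
    "\<phi> \<noteq> [] \<Longrightarrow> list_all avalid \<phi> \<Longrightarrow>
     Map2 S \<phi> \<star> Id2 Y (F (sum_list (map leaves (map adom \<phi>)))) = Id2 Y (F (length \<phi>)) \<star> Map2 R \<phi>"
  using assms unfolding strict_tensor_2nat_def by (auto simp: PiE_iff)

lemma two_nat_id:
  assumes R: "strict_tensor_2functor catalan_2cat Y R"
  shows "strict_tensor_2nat catalan_2cat Y R R (restrict (\<lambda>x. Id1 Y (Map0 R x)) (Cell0 catalan_2cat))"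
proof -
  note [simp] = Map_in[OF R] Map1_type[OF R] Map2_type[OF R] Map0_pow[OF R]
  have "Map0 R (m + n) = Map0 R m \<otimes>\<^sub>0 Map0 R n" if "m \<ge> Suc 0" "n \<ge> Suc 0" for m n
    using Map0_add[OF R] that by simp
  then show ?thesis
    using R by (auto simp: strict_tensor_2nat_def Ten1_Id1)
qed

lemma two_nat_comp:
  assumes F: "strict_tensor_2nat catalan_2cat Y R S F" and G: "strict_tensor_2nat catalan_2cat Y S T G"
  shows "strict_tensor_2nat catalan_2cat Y R T (restrict (\<lambda>x. G x \<odot> F x) (Cell0 catalan_2cat))"
proof -
  note R = two_nat_data(1)[OF F] and S = two_nat_data(1)[OF G] and T = two_nat_data(2)[OF G]
  note s = Map_in[OF R] Map1_type[OF R] Map2_type[OF R] Map_in[OF S] Map1_type[OF S] Map2_type[OF S]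
    Map_in[OF T] Map1_type[OF T] Map2_type[OF T] Map0_pow[OF R] Map0_pow[OF S] Map0_pow[OF T]
    two_natD(1-3)[OF F] two_natD(1-3)[OF G]
  have "Map1 T f \<odot> (G (sum_list (map leaves f)) \<odot> F (sum_list (map leaves f))) =
      (G (length f) \<odot> F (length f)) \<odot> Map1 R f" if "f \<noteq> []" for f
  proof -
    \<comment> \<open>The naturality square of \<open>G\<close> is pasted to that of
      \<open>F\<close>; the argument for 2-cells below has the same shape.\<close>
    have "Map1 T f \<odot> (G (sum_list (map leaves f)) \<odot> F (sum_list (map leaves f))) =
        (G (length f) \<odot> Map1 S f) \<odot> F (sum_list (map leaves f))"
      using that by (simp add: s HComp1_assoc flip: two_natD(6)[OF G])
    also have "\<dots> = G (length f) \<odot> (F (length f) \<odot> Map1 R f)"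
      using that by (simp add: s HComp1_assoc two_natD(6)[OF F])
    finally show ?thesis using that by (simp add: s HComp1_assoc)
  qed
  moreover have "Map2 T \<phi> \<star> Id2 Y (G (sum_list (map leaves (map adom \<phi>))) \<odot> F (sum_list (map leaves (map adom \<phi>)))) =
      Id2 Y (G (length \<phi>) \<odot> F (length \<phi>)) \<star> Map2 R \<phi>" if "\<phi> \<noteq> []" "list_all avalid \<phi>" for \<phi>
  proof -
    let ?n = "sum_list (map leaves (map adom \<phi>))"
    have n: "?n \<ge> Suc 0" using that by simp
    have "Map2 T \<phi> \<star> Id2 Y (G ?n \<odot> F ?n) = (Map2 T \<phi> \<star> Id2 Y (G ?n)) \<star> Id2 Y (F ?n)"
      using that n by (simp add: s HComp2_assoc HComp2_Id2 del: map_map)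
    also have "\<dots> = Id2 Y (G (length \<phi>)) \<star> (Map2 S \<phi> \<star> Id2 Y (F ?n))"
      unfolding two_natD(7)[OF G that] using that n by (simp add: s HComp2_assoc del: map_map)
    also have "\<dots> = Id2 Y (G (length \<phi>) \<odot> F (length \<phi>)) \<star> Map2 R \<phi>"
      unfolding two_natD(7)[OF F that] using that by (simp add: s flip: HComp2_Id2 HComp2_assoc)
    finally show ?thesis .
  qed
  moreover have "G (m + n) \<odot> F (m + n) = (G m \<odot> F m) \<otimes>\<^sub>1 (G n \<odot> F n)" if "m \<ge> Suc 0" "n \<ge> Suc 0" for m n
    using that by (simp add: s two_natD(5)[OF F] two_natD(5)[OF G] Ten1_HComp1)
  ultimately show ?thesis
    using R T by (auto simp: strict_tensor_2nat_def s comp_def)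
qed

lemma category_Hom_st: "category (Hom_st catalan_2cat Y)"
proof (rule categoryI)
  have comp: "composable (Hom_st catalan_2cat Y) G F \<longleftrightarrow> (\<exists>R S T F' G'. F = (R, S, F') \<and> G = (S, T, G') \<and>
      strict_tensor_2nat catalan_2cat Y R S F' \<and> strict_tensor_2nat catalan_2cat Y S T G')" for F G
    by (cases F; cases G) (auto simp: composable_def)
  show "Comp (Hom_st catalan_2cat Y) G F = undefined" if "\<not> composable (Hom_st catalan_2cat Y) G F" for G F
    using that unfolding comp by (cases F; cases G) (auto simp: Hom_st_def Let_def)
  show "Comp (Hom_st catalan_2cat Y) G F \<in> hom (Hom_st catalan_2cat Y) (Dom (Hom_st catalan_2cat Y) F) (Cod (Hom_st catalan_2cat Y) G)"
    if "composable (Hom_st catalan_2cat Y) G F" for G F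
    using that two_nat_comp unfolding comp hom_def by fastforce
  show "Comp (Hom_st catalan_2cat Y) H (Comp (Hom_st catalan_2cat Y) G F) =
      Comp (Hom_st catalan_2cat Y) (Comp (Hom_st catalan_2cat Y) H G) F"
    if HG: "composable (Hom_st catalan_2cat Y) H G" and GF: "composable (Hom_st catalan_2cat Y) G F" for H G F
  proof -
    obtain R S F' T G' V H' where FGH: "F = (R, S, F')" "G = (S, T, G')" "H = (T, V, H')"
      and nat: "strict_tensor_2nat catalan_2cat Y R S F'" "strict_tensor_2nat catalan_2cat Y S T G'"
        "strict_tensor_2nat catalan_2cat Y T V H'"
      using HG GF unfolding comp by auto
    have "(H' n \<odot> G' n) \<odot> F' n = H' n \<odot> (G' n \<odot> F' n)" if "n \<ge> Suc 0" for n
      using that two_natD(1-3)[OF nat(1)] two_natD(1-3)[OF nat(2)] two_natD(1-3)[OF nat(3)] by (simp add: HComp1_assoc)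
    then show ?thesis
      using two_nat_comp[OF nat(1,2)] two_nat_comp[OF nat(2,3)] nat
      by (auto simp: FGH intro!: restrict_ext)
  qed
next
  fix F assume "F \<in> Arr (Hom_st catalan_2cat Y)"
  then obtain R S F' where F: "F = (R, S, F')" and nat: "strict_tensor_2nat catalan_2cat Y R S F'" by auto
  note RS = two_nat_data(1,2)[OF nat]
  \<comment> \<open>Composing with an identity merely restricts the family of components to positive
    integers, and it is extensional there already.\<close>
  have "restrict (\<lambda>n. F' n \<odot> restrict (\<lambda>n. Id1 Y (Map0 R n)) {Suc 0..} n) {Suc 0..} = F'"
    "restrict (\<lambda>n. restrict (\<lambda>n. Id1 Y (Map0 S n)) {Suc 0..} n \<odot> F' n) {Suc 0..} = F'"
    by (rule extensionalityI[of _ "{Suc 0..}"]; use two_natD(1-4)[OF nat] in simp)+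
  then show "Comp (Hom_st catalan_2cat Y) F (Id (Hom_st catalan_2cat Y) (Dom (Hom_st catalan_2cat Y) F)) = F"
    "Comp (Hom_st catalan_2cat Y) (Id (Hom_st catalan_2cat Y) (Cod (Hom_st catalan_2cat Y) F)) F = F"
    using nat RS two_nat_id[OF RS(1)] two_nat_id[OF RS(2)] by (simp_all add: F)
next
  show "Dom (Hom_st catalan_2cat Y) \<in> Arr (Hom_st catalan_2cat Y) \<rightarrow>\<^sub>E Obj (Hom_st catalan_2cat Y)"
    "Cod (Hom_st catalan_2cat Y) \<in> Arr (Hom_st catalan_2cat Y) \<rightarrow>\<^sub>E Obj (Hom_st catalan_2cat Y)"
    "Id (Hom_st catalan_2cat Y) \<in> Obj (Hom_st catalan_2cat Y) \<rightarrow>\<^sub>E Arr (Hom_st catalan_2cat Y)"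
    using two_nat_data(1,2) two_nat_id by (auto simp: Hom_st_def Let_def PiE_iff)
qed (use two_nat_id in auto)

end

section \<open>Associative categories as associative objects of Cat\<close>

text \<open>Interchange pushes \<open>G\<close> through the inner product and \<open>GT\<close>
  through the outer one. Both sides of the associator condition on \<open>G\<close> thereby get
  equal boundaries, as a comparison of their components requires.\<close>

lemma (in tensor_2category) natural_brackets:
  assumes "c \<in> Cell0 Y" "T \<in> Cell1 Y" "Src1 Y T = c \<otimes>\<^sub>0 c" "Trg1 Y T = c"
    and "c' \<in> Cell0 Y" "T' \<in> Cell1 Y" "Src1 Y T' = c' \<otimes>\<^sub>0 c'" "Trg1 Y T' = c'"
    and "G \<in> Cell1 Y" "Src1 Y G = c" "Trg1 Y G = c'" and GT: "T' \<odot> (G \<otimes>\<^sub>1 G) = G \<odot> T"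
  shows "(T' \<odot> (Id1 Y c' \<otimes>\<^sub>1 T')) \<odot> (G \<otimes>\<^sub>1 G \<otimes>\<^sub>1 G) = G \<odot> (T \<odot> (Id1 Y c \<otimes>\<^sub>1 T))"
    and "(T' \<odot> (T' \<otimes>\<^sub>1 Id1 Y c')) \<odot> (G \<otimes>\<^sub>1 G \<otimes>\<^sub>1 G) = G \<odot> (T \<odot> (T \<otimes>\<^sub>1 Id1 Y c))"
proof -
  have "(Id1 Y c' \<otimes>\<^sub>1 T') \<odot> (G \<otimes>\<^sub>1 G \<otimes>\<^sub>1 G) = (G \<odot> Id1 Y c) \<otimes>\<^sub>1 (G \<odot> T)"
    using assms by (simp flip: Ten1_HComp1)
  also have "\<dots> = (G \<otimes>\<^sub>1 G) \<odot> (Id1 Y c \<otimes>\<^sub>1 T)"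
    using assms by (intro Ten1_HComp1) simp_all
  finally have "(T' \<odot> (Id1 Y c' \<otimes>\<^sub>1 T')) \<odot> (G \<otimes>\<^sub>1 G \<otimes>\<^sub>1 G) = (T' \<odot> (G \<otimes>\<^sub>1 G)) \<odot> (Id1 Y c \<otimes>\<^sub>1 T)"
    using assms(1-11) by (simp add: HComp1_assoc)
  then show "(T' \<odot> (Id1 Y c' \<otimes>\<^sub>1 T')) \<odot> (G \<otimes>\<^sub>1 G \<otimes>\<^sub>1 G) = G \<odot> (T \<odot> (Id1 Y c \<otimes>\<^sub>1 T))"
    unfolding GT using assms(1-11) by (simp add: HComp1_assoc)
  have "(T' \<otimes>\<^sub>1 Id1 Y c') \<odot> ((G \<otimes>\<^sub>1 G) \<otimes>\<^sub>1 G) = (G \<odot> T) \<otimes>\<^sub>1 (G \<odot> Id1 Y c)"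
    using assms by (simp flip: Ten1_HComp1)
  also have "\<dots> = (G \<otimes>\<^sub>1 G) \<odot> (T \<otimes>\<^sub>1 Id1 Y c)"
    using assms by (intro Ten1_HComp1) simp_all
  finally have "(T' \<odot> (T' \<otimes>\<^sub>1 Id1 Y c')) \<odot> (G \<otimes>\<^sub>1 G \<otimes>\<^sub>1 G) = (T' \<odot> (G \<otimes>\<^sub>1 G)) \<odot> (T \<otimes>\<^sub>1 Id1 Y c)"
    using assms(1-11) by (simp add: HComp1_assoc Ten1_assoc Ten0_assoc)
  then show "(T' \<odot> (T' \<otimes>\<^sub>1 Id1 Y c')) \<odot> (G \<otimes>\<^sub>1 G \<otimes>\<^sub>1 G) = G \<odot> (T \<odot> (T \<otimes>\<^sub>1 Id1 Y c))"
    unfolding GT using assms(1-11) by (simp add: HComp1_assoc)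
qed

lemma cat_2cell_inverse:
  assumes t: "is_cat_2cell \<tau>" and i: "\<And>x. x \<in> Obj (FSrc (NSrc \<tau>)) \<Longrightarrow> iso (FTrg (NSrc \<tau>)) (Component \<tau> x)"
  obtains \<tau>' where "is_cat_2cell \<tau>'" "NSrc \<tau>' = NTrg \<tau>" "NTrg \<tau>' = NSrc \<tau>"
    "cat_vcomp \<tau>' \<tau> = cat_id2 (NSrc \<tau>)" "cat_vcomp \<tau> \<tau>' = cat_id2 (NTrg \<tau>)"
proof -
  let ?C = "FSrc (NSrc \<tau>)" and ?D = "FTrg (NSrc \<tau>)"
  have "\<exists>g. g \<in> Arr ?D \<and> Dom ?D g = OMap (NTrg \<tau>) x \<and> Cod ?D g = OMap (NSrc \<tau>) x \<and>
      Comp ?D g (Component \<tau> x) = Id ?D (OMap (NSrc \<tau>) x) \<and> Comp ?D (Component \<tau> x) g = Id ?D (OMap (NTrg \<tau>) x)"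
    if "x \<in> Obj ?C" for x
    using i[OF that] that t by (auto simp: iso_def hom_def)
  then obtain g where g: "x \<in> Obj ?C \<Longrightarrow> g x \<in> Arr ?D" "x \<in> Obj ?C \<Longrightarrow> Dom ?D (g x) = OMap (NTrg \<tau>) x"
    "x \<in> Obj ?C \<Longrightarrow> Cod ?D (g x) = OMap (NSrc \<tau>) x"
    "x \<in> Obj ?C \<Longrightarrow> Comp ?D (g x) (Component \<tau> x) = Id ?D (OMap (NSrc \<tau>) x)"
    "x \<in> Obj ?C \<Longrightarrow> Comp ?D (Component \<tau> x) (g x) = Id ?D (OMap (NTrg \<tau>) x)" for x
    by metis
  define \<tau>' where "\<tau>' = \<lparr>NSrc = NTrg \<tau>, NTrg = NSrc \<tau>, Component = restrict g (Obj ?C)\<rparr>"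
  have nat: "Comp ?D (g (Cod ?C f)) (AMap (NTrg \<tau>) f) = Comp ?D (AMap (NSrc \<tau>) f) (g (Dom ?C f))"
    if f: "f \<in> Arr ?C" for f
  proof -
    \<comment> \<open>A component of \<open>\<tau>\<close> followed by its inverse is inserted at
      the domain; naturality of \<open>\<tau>\<close> moves the component to the codomain, where it
      cancels.\<close>
    have "Comp ?D (g (Cod ?C f)) (AMap (NTrg \<tau>) f) =
        Comp ?D (g (Cod ?C f)) (Comp ?D (Comp ?D (AMap (NTrg \<tau>) f) (Component \<tau> (Dom ?C f))) (g (Dom ?C f)))"
      using f t g by (simp add: small_cat_assoc)
    also have "\<dots> = Comp ?D (Comp ?D (g (Cod ?C f)) (Component \<tau> (Cod ?C f))) (Comp ?D (AMap (NSrc \<tau>) f) (g (Dom ?C f)))"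
      unfolding cat2_natural[OF t f, symmetric] using f t g(1-3) by (simp add: small_cat_assoc)
    also have "\<dots> = Comp ?D (AMap (NSrc \<tau>) f) (g (Dom ?C f))"
      using f t g by simp
    finally show ?thesis .
  qed
  have t': "is_cat_2cell \<tau>'"
    using t g nat by (intro cat2I) (simp_all add: \<tau>'_def)
  have [simp]: "NSrc \<tau>' = NTrg \<tau>" "NTrg \<tau>' = NSrc \<tau>" "x \<in> Obj ?C \<Longrightarrow> Component \<tau>' x = g x" for x
    by (simp_all add: \<tau>'_def)
  have "cat_vcomp \<tau>' \<tau> = cat_id2 (NSrc \<tau>)" "cat_vcomp \<tau> \<tau>' = cat_id2 (NTrg \<tau>)"
    using t t' g by (auto intro!: cat2_eqI)
  then show ?thesis using that t' by simp
qed

interpretation Cat: tensor_2category "cat_2cat :: (('o, 'm) small_cat, _, _) tensor_2cat" unit_cat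
  by (rule tensor_2category_cat)

text \<open>A natural transformation with invertible components has a natural inverse by
  \<open>cat_2cell_inverse\<close>; conversely, the vertical composites with an inverse are
  evaluated at an object.\<close>

lemma is_assoc_cat_iff:
  "is_assoc_cat B \<longleftrightarrow> (\<exists>\<beta>'. assoc_object cat_2cat unit_cat (Base B) (Tensor B) (Assoc B) \<beta>')"
proof
  let ?C = "Base B" and ?T = "Tensor B"
  assume "is_assoc_cat B"
  then have B: "is_small_cat ?C" "is_cat_1cell ?T" "FSrc ?T = times_cat ?C ?C" "FTrg ?T = ?C" "is_cat_2cell (Assoc B)"
    "NSrc (Assoc B) = cat_comp1 ?T (times_1cell (cat_id1 ?C) ?T)"
    "NTrg (Assoc B) = cat_comp1 ?T (times_1cell ?T (cat_id1 ?C))"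
    "\<And>x y z. x \<in> Obj ?C \<Longrightarrow> y \<in> Obj ?C \<Longrightarrow> z \<in> Obj ?C \<Longrightarrow> iso ?C (Component (Assoc B) (x @ y @ z))"
    by (auto simp: is_assoc_cat_def Let_def)
  have "iso (FTrg (NSrc (Assoc B))) (Component (Assoc B) x)" if "x \<in> Obj (FSrc (NSrc (Assoc B)))" for x
    using that B(4,6,8) B(3) by (auto elim!: times_objE)
  then obtain \<beta>' where "is_cat_2cell \<beta>'" "NSrc \<beta>' = NTrg (Assoc B)" "NTrg \<beta>' = NSrc (Assoc B)"
    "cat_vcomp \<beta>' (Assoc B) = cat_id2 (NSrc (Assoc B))" "cat_vcomp (Assoc B) \<beta>' = cat_id2 (NTrg (Assoc B))"
    using cat_2cell_inverse[OF B(5)] by blast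
  then show "\<exists>\<beta>'. assoc_object cat_2cat unit_cat ?C ?T (Assoc B) \<beta>'"
    using B(1-7) by (intro exI[of _ \<beta>']) (unfold_locales; simp)
next
  assume "\<exists>\<beta>'. assoc_object cat_2cat unit_cat (Base B) (Tensor B) (Assoc B) \<beta>'"
  then obtain \<beta>' where "assoc_object cat_2cat unit_cat (Base B) (Tensor B) (Assoc B) \<beta>'" ..
  then interpret assoc_object cat_2cat unit_cat "Base B" "Tensor B" "Assoc B" \<beta>' .
  note t = c_in T_type beta_type beta'_type beta_inverse
  note t' = t[simplified]
  have "iso (Base B) (Component (Assoc B) w)" if w: "w \<in> Obj (FSrc (NSrc (Assoc B)))" for w
  proof -
    have "Component (cat_vcomp \<beta>' (Assoc B)) w = Comp (Base B) (Component \<beta>' w) (Component (Assoc B) w)"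
      "Component (cat_vcomp (Assoc B) \<beta>') w = Comp (Base B) (Component (Assoc B) w) (Component \<beta>' w)"
      using t'(1-10) w by (simp_all add: times_cat_assoc)
    then have "Comp (Base B) (Component \<beta>' w) (Component (Assoc B) w) = Id (Base B) (OMap (NSrc (Assoc B)) w)"
      "Comp (Base B) (Component (Assoc B) w) (Component \<beta>' w) = Id (Base B) (OMap (NTrg (Assoc B)) w)"
      unfolding t'(11,12) using t'(1-10) w by (simp_all add: times_cat_assoc)
    moreover have "Component \<beta>' w \<in> hom (Base B) (OMap (NTrg (Assoc B)) w) (OMap (NSrc (Assoc B)) w)"
      "Component (Assoc B) w \<in> hom (Base B) (OMap (NSrc (Assoc B)) w) (OMap (NTrg (Assoc B)) w)"
      using w t'(1-10) cat2D(5-7)[of "Assoc B" w] cat2D(5-7)[of \<beta>' w] by (simp_all add: hom_def times_cat_assoc)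
    ultimately show ?thesis unfolding iso_def hom_def by auto
  qed
  then show "is_assoc_cat B"
    using t' by (auto simp: is_assoc_cat_def Let_def)
qed

text \<open>Turns the elementwise definition into the two equations of cells, \<open>GT\<close> and
  \<open>Gb\<close>, from which naturality was propagated. Every object of a product is a
  concatenation, so equations of cells can be tested on tuples.\<close>

lemma is_strict_tensor_functor_iff:
  "is_strict_tensor_functor B B' F \<longleftrightarrow>
     is_assoc_cat B \<and> is_assoc_cat B' \<and> is_cat_1cell F \<and> FSrc F = Base B \<and> FTrg F = Base B' \<and>
     cat_comp1 (Tensor B') (times_1cell F F) = cat_comp1 F (Tensor B) \<and>
     cat_hcomp (Assoc B') (cat_id2 (times_1cell F (times_1cell F F))) = cat_hcomp (cat_id2 F) (Assoc B)"
  (is "?l \<longleftrightarrow> ?r")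
proof (cases "is_assoc_cat B \<and> is_assoc_cat B' \<and> is_cat_1cell F \<and> FSrc F = Base B \<and> FTrg F = Base B'")
  case True
  let ?C = "Base B" and ?T = "Tensor B" and ?C' = "Base B'" and ?T' = "Tensor B'"
  let ?FFF = "times_1cell F (times_1cell F F)"
  have F: "is_cat_1cell F" "FSrc F = ?C" "FTrg F = ?C'" using True by auto
  have B: "is_small_cat ?C" "is_cat_1cell ?T" "FSrc ?T = times_cat ?C ?C" "FTrg ?T = ?C" "is_cat_2cell (Assoc B)"
    "NSrc (Assoc B) = cat_comp1 ?T (times_1cell (cat_id1 ?C) ?T)"
    "NTrg (Assoc B) = cat_comp1 ?T (times_1cell ?T (cat_id1 ?C))"
    and B': "is_small_cat ?C'" "is_cat_1cell ?T'" "FSrc ?T' = times_cat ?C' ?C'" "FTrg ?T' = ?C'" "is_cat_2cell (Assoc B')"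
    "NSrc (Assoc B') = cat_comp1 ?T' (times_1cell (cat_id1 ?C') ?T')"
    "NTrg (Assoc B') = cat_comp1 ?T' (times_1cell ?T' (cat_id1 ?C'))"
    using True by (auto simp: is_assoc_cat_def Let_def)
  note FC = cat1D[OF F(1), unfolded F(2,3)]
  have T: "(cat_comp1 ?T' (times_1cell F F) = cat_comp1 F ?T) \<longleftrightarrow>
     (\<forall>x \<in> Obj ?C. \<forall>y \<in> Obj ?C. OMap F (OMap ?T (x @ y)) = OMap ?T' (OMap F x @ OMap F y)) \<and>
     (\<forall>f \<in> Arr ?C. \<forall>g \<in> Arr ?C. AMap F (AMap ?T (f @ g)) = AMap ?T' (AMap F f @ AMap F g))" (is "?a \<longleftrightarrow> ?b")
  proof -
    have o: "OMap (cat_comp1 ?T' (times_1cell F F)) (x @ y) = OMap ?T' (OMap F x @ OMap F y)"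
      "OMap (cat_comp1 F ?T) (x @ y) = OMap F (OMap ?T (x @ y))" if "x \<in> Obj ?C" "y \<in> Obj ?C" for x y
      using that F B by simp_all
    have m: "AMap (cat_comp1 ?T' (times_1cell F F)) (f @ g) = AMap ?T' (AMap F f @ AMap F g)"
      "AMap (cat_comp1 F ?T) (f @ g) = AMap F (AMap ?T (f @ g))" if "f \<in> Arr ?C" "g \<in> Arr ?C" for f g
      using that F B by simp_all
    show ?thesis
    proof
      assume ?a
      then show ?b using o m by metis
    next
      assume b: ?b
      show ?a
      proof (rule cat1_eqI)
        fix w assume "w \<in> Obj (FSrc (cat_comp1 ?T' (times_1cell F F)))"
        then obtain x y where "w = x @ y" "x \<in> Obj ?C" "y \<in> Obj ?C" using F by (auto elim!: times_objE)
        then show "OMap (cat_comp1 ?T' (times_1cell F F)) w = OMap (cat_comp1 F ?T) w"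
          using b o by simp
      next
        fix w assume "w \<in> Arr (FSrc (cat_comp1 ?T' (times_1cell F F)))"
        then obtain f g where "w = f @ g" "f \<in> Arr ?C" "g \<in> Arr ?C" using F by (auto elim!: times_arrE)
        then show "AMap (cat_comp1 ?T' (times_1cell F F)) w = AMap (cat_comp1 F ?T) w"
          using b m by simp
      qed (use F B B' in simp_all)
    qed
  qed
  \<comment> \<open>Given the tensor equation, \<open>natural_brackets\<close> provides equal
    sources and targets, so components can be compared. Whiskering contributes only identity arrows,
    which vanish.\<close>
  have A: "(cat_hcomp (Assoc B') (cat_id2 ?FFF) = cat_hcomp (cat_id2 F) (Assoc B)) \<longleftrightarrow>
     (\<forall>x \<in> Obj ?C. \<forall>y \<in> Obj ?C. \<forall>z \<in> Obj ?C.
        AMap F (Component (Assoc B) (x @ y @ z)) = Component (Assoc B') (OMap F x @ OMap F y @ OMap F z))"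
    (is "?a \<longleftrightarrow> ?b") if FT: "cat_comp1 ?T' (times_1cell F F) = cat_comp1 F ?T"
  proof -
    have n: "cat_comp1 (NSrc (Assoc B')) ?FFF = cat_comp1 F (NSrc (Assoc B))"
      "cat_comp1 (NTrg (Assoc B')) ?FFF = cat_comp1 F (NTrg (Assoc B))"
      using Cat.natural_brackets[of ?C ?T ?C' ?T' F] F B B' FT by simp_all
    have S: "FSrc (NSrc (Assoc B)) = times_cat ?C (times_cat ?C ?C)" "FTrg (NSrc (Assoc B)) = ?C"
      "FSrc (NSrc (Assoc B')) = times_cat ?C' (times_cat ?C' ?C')" "FTrg (NSrc (Assoc B')) = ?C'"
      using B B' by simp_all
    note c = cat2D[OF B(5), unfolded S] and c' = cat2D[OF B'(5), unfolded S]
    have l: "Component (cat_hcomp (Assoc B') (cat_id2 ?FFF)) (x @ y @ z) =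
        Component (Assoc B') (OMap F x @ OMap F y @ OMap F z)"
      and r: "Component (cat_hcomp (cat_id2 F) (Assoc B)) (x @ y @ z) = AMap F (Component (Assoc B) (x @ y @ z))"
      if xyz: "x \<in> Obj ?C" "y \<in> Obj ?C" "z \<in> Obj ?C" for x y z
    proof -
      have o: "x @ y @ z \<in> Obj (times_cat ?C (times_cat ?C ?C))"
        "OMap F x @ OMap F y @ OMap F z \<in> Obj (times_cat ?C' (times_cat ?C' ?C'))"
        using xyz F B(1) B'(1) FC(3) by simp_all
      have f: "OMap ?FFF (x @ y @ z) = OMap F x @ OMap F y @ OMap F z" using xyz F B(1) by simp
      show "Component (cat_hcomp (Assoc B') (cat_id2 ?FFF)) (x @ y @ z) =
          Component (Assoc B') (OMap F x @ OMap F y @ OMap F z)"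
        using o F S c'(5-7)[OF o(2)] cat1D(7)[OF c'(1), unfolded S, OF o(2)] B'(1) f by simp
      show "Component (cat_hcomp (cat_id2 F) (Assoc B)) (x @ y @ z) = AMap F (Component (Assoc B) (x @ y @ z))"
        using o F S c(5-7)[OF o(1)] cat2_trg(1)[OF B(5), unfolded S, OF o(1)] FC B'(1) by (simp add: c(3,4) B(1))
    qed
    show ?thesis
    proof
      assume ?a
      then show ?b using l r by metis
    next
      assume b: ?b
      show ?a
      proof (rule cat2_eqI)
        fix w assume "w \<in> Obj (FSrc (NSrc (cat_hcomp (Assoc B') (cat_id2 ?FFF))))"
        then obtain x y z where "w = x @ y @ z" "x \<in> Obj ?C" "y \<in> Obj ?C" "z \<in> Obj ?C"
          using F by (auto elim!: times_objE)
        then show "Component (cat_hcomp (Assoc B') (cat_id2 ?FFF)) w = Component (cat_hcomp (cat_id2 F) (Assoc B)) w"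
          using b l r by simp
      qed (use F B(5) B'(5) S n in simp_all)
    qed
  qed
  show ?thesis using True T A unfolding is_strict_tensor_functor_def by blast
qed (auto simp: is_strict_tensor_functor_def)

section \<open>The category of associative categories\<close>

lemma Assoc_Cat_st_simps [simp]:
  "Obj Assoc_Cat_st = {B. is_assoc_cat B}"
  "Arr Assoc_Cat_st = {(B, B', F). is_strict_tensor_functor B B' F}"
  "is_strict_tensor_functor B B' F \<Longrightarrow> Dom Assoc_Cat_st (B, B', F) = B"
  "is_strict_tensor_functor B B' F \<Longrightarrow> Cod Assoc_Cat_st (B, B', F) = B'"
  "is_assoc_cat B \<Longrightarrow> Id Assoc_Cat_st B = (B, B, cat_id1 (Base B))"
  "is_strict_tensor_functor B B' F \<Longrightarrow> is_strict_tensor_functor B' B'' G \<Longrightarrow>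
   Comp Assoc_Cat_st (B', B'', G) (B, B', F) = (B, B'', cat_comp1 G F)"
  by (simp_all add: Assoc_Cat_st_def Let_def)

lemma strict_tensor_functorD:
  assumes "is_strict_tensor_functor B B' F"
  shows "is_assoc_cat B" "is_assoc_cat B'" "is_cat_1cell F" "FSrc F = Base B" "FTrg F = Base B'"
  using assms by (auto simp: is_strict_tensor_functor_def)

lemma is_small_cat_Base: "is_assoc_cat B \<Longrightarrow> is_small_cat (Base B)"
  by (simp add: is_assoc_cat_def Let_def)

text \<open>\<open>cat_id1\<close> and \<open>cat_comp1\<close> can be evaluated only inside their
  carriers. This and the next two lemmas keep tensor products and associators there.\<close>

lemma assoc_cat_closed:
  assumes "is_assoc_cat B" "x \<in> Obj (Base B)" "y \<in> Obj (Base B)"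
  shows "OMap (Tensor B) (x @ y) \<in> Obj (Base B)"
  using assms cat1D(3)[of "Tensor B" "x @ y"] by (auto simp: is_assoc_cat_def Let_def)

lemma assoc_cat_closed_arr:
  assumes "is_assoc_cat B" "f \<in> Arr (Base B)" "g \<in> Arr (Base B)"
  shows "AMap (Tensor B) (f @ g) \<in> Arr (Base B)"
  using assms cat1D(4)[of "Tensor B" "f @ g"] by (auto simp: is_assoc_cat_def Let_def)

lemma assoc_cat_component:
  assumes "is_assoc_cat B" "x \<in> Obj (Base B)" "y \<in> Obj (Base B)" "z \<in> Obj (Base B)"
  shows "Component (Assoc B) (x @ y @ z) \<in> Arr (Base B)"
  using assms cat2D(5)[of "Assoc B" "x @ y @ z"] by (auto simp: is_assoc_cat_def Let_def)

lemma strict_tensor_functor_id: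
  assumes "is_assoc_cat B"
  shows "is_strict_tensor_functor B B (cat_id1 (Base B))"
  using assms is_small_cat_Base[OF assms]
  by (simp add: is_strict_tensor_functor_def assoc_cat_closed assoc_cat_closed_arr assoc_cat_component)

lemma strict_tensor_functor_comp:
  assumes "is_strict_tensor_functor B B' F" "is_strict_tensor_functor B' B'' G"
  shows "is_strict_tensor_functor B B'' (cat_comp1 G F)"
proof -
  note d = strict_tensor_functorD[OF assms(1)] and d' = strict_tensor_functorD[OF assms(2)]
  note F = cat1D[OF d(3), unfolded d(4,5)] and G = cat1D[OF d'(3), unfolded d'(4,5)]
  show ?thesis
    using assms d d' F(3,4) unfolding is_strict_tensor_functor_def
    by (simp add: assoc_cat_closed assoc_cat_closed_arr assoc_cat_component)
qed

lemma category_Assoc_Cat_st: "category Assoc_Cat_st"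
proof (rule categoryI)
  have comp: "composable Assoc_Cat_st G F \<longleftrightarrow> (\<exists>B B' B'' F' G'. F = (B, B', F') \<and> G = (B', B'', G') \<and>
      is_strict_tensor_functor B B' F' \<and> is_strict_tensor_functor B' B'' G')" for F G
    by (cases F; cases G) (auto simp: composable_def)
  show "Comp Assoc_Cat_st G F = undefined" if "\<not> composable Assoc_Cat_st G F" for G F
    using that unfolding comp by (cases F; cases G) (auto simp: Assoc_Cat_st_def Let_def)
  show "Comp Assoc_Cat_st G F \<in> hom Assoc_Cat_st (Dom Assoc_Cat_st F) (Cod Assoc_Cat_st G)"
    if "composable Assoc_Cat_st G F" for G F
    using that strict_tensor_functor_comp unfolding comp hom_def by fastforce
  show "Comp Assoc_Cat_st H (Comp Assoc_Cat_st G F) = Comp Assoc_Cat_st (Comp Assoc_Cat_st H G) F"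
    if HG: "composable Assoc_Cat_st H G" and GF: "composable Assoc_Cat_st G F" for H G F
  proof -
    obtain B B' F' B'' G' V H' where FGH: "F = (B, B', F')" "G = (B', B'', G')" "H = (B'', V, H')"
      and st: "is_strict_tensor_functor B B' F'" "is_strict_tensor_functor B' B'' G'" "is_strict_tensor_functor B'' V H'"
      using HG GF unfolding comp by auto
    show ?thesis
      using st strict_tensor_functor_comp[OF st(1,2)] strict_tensor_functor_comp[OF st(2,3)]
        strict_tensor_functorD[OF st(1)] strict_tensor_functorD[OF st(2)] strict_tensor_functorD[OF st(3)]
      by (simp add: FGH cat_comp1_assoc)
  qed
next
  fix F assume "F \<in> Arr (Assoc_Cat_st :: (('a, 'b) assoc_cat, _) category)"
  then obtain B B' F' where F: "F = (B, B', F')" and st: "is_strict_tensor_functor B B' F'" by auto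
  note d = strict_tensor_functorD[OF st]
  show "Comp Assoc_Cat_st F (Id Assoc_Cat_st (Dom Assoc_Cat_st F)) = F"
    "Comp Assoc_Cat_st (Id Assoc_Cat_st (Cod Assoc_Cat_st F)) F = F"
    using st d strict_tensor_functor_id[OF d(1)] strict_tensor_functor_id[OF d(2)] cat_comp1_id[OF d(3)]
    by (simp_all add: F)
next
  show "Dom Assoc_Cat_st \<in> Arr Assoc_Cat_st \<rightarrow>\<^sub>E Obj Assoc_Cat_st"
    "Cod Assoc_Cat_st \<in> Arr Assoc_Cat_st \<rightarrow>\<^sub>E Obj Assoc_Cat_st"
    "Id Assoc_Cat_st \<in> Obj Assoc_Cat_st \<rightarrow>\<^sub>E Arr Assoc_Cat_st"
    using strict_tensor_functorD(1,2) strict_tensor_functor_id by (auto simp: Assoc_Cat_st_def Let_def PiE_iff)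
qed (simp_all add: strict_tensor_functor_id)

section \<open>The equivalence\<close>

definition assoc_cat_of ::
  "(nat, tree list, catalan_arrow list, ('o, 'm) small_cat, ('o, 'm) cat_1cell, ('o, 'm) cat_2cell) two_functor
   \<Rightarrow> ('o, 'm) assoc_cat" where
  "assoc_cat_of R = \<lparr>Base = Map0 R 1, Tensor = Map1 R [cherry], Assoc = Map2 R [assoc_arrow (False, True)]\<rparr>"

lemma assoc_cat_of_simps [simp]:
  "Base (assoc_cat_of R) = Map0 R (Suc 0)" "Tensor (assoc_cat_of R) = Map1 R [cherry]"
  "Assoc (assoc_cat_of R) = Map2 R [assoc_arrow (False, True)]"
  by (simp_all add: assoc_cat_of_def)

lemma is_assoc_cat_of:
  "strict_tensor_2functor catalan_2cat cat_2cat R \<Longrightarrow> is_assoc_cat (assoc_cat_of R)"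
  using Cat.assoc_object_data[of R] by (auto simp: is_assoc_cat_iff)

lemma assoc_cat_of_inj:
  assumes "strict_tensor_2functor catalan_2cat cat_2cat R" "strict_tensor_2functor catalan_2cat cat_2cat S"
    "assoc_cat_of R = assoc_cat_of S"
  shows "R = S"
  using assms by (intro Cat.two_functor_eqI) (simp_all add: assoc_cat_of_def)

text \<open>Any inverse of the associator may be used to generate the 2-functor, as it leaves no
  trace in \<open>assoc_cat_of\<close>.\<close>

lemma assoc_cat_of_surj:
  assumes "is_assoc_cat B"
  obtains R where "strict_tensor_2functor catalan_2cat cat_2cat R" "assoc_cat_of R = B"
proof -
  obtain \<beta>' where "assoc_object cat_2cat unit_cat (Base B) (Tensor B) (Assoc B) \<beta>'"
    using assms by (auto simp: is_assoc_cat_iff)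
  then interpret assoc_object cat_2cat unit_cat "Base B" "Tensor B" "Assoc B" \<beta>' .
  show ?thesis
    using that[OF generated_2functor] generated_data by (simp add: assoc_cat_of_def)
qed

lemma strict_tensor_functor_of:
  assumes "strict_tensor_2nat catalan_2cat cat_2cat R S F"
  shows "is_strict_tensor_functor (assoc_cat_of R) (assoc_cat_of S) (F 1)"
  using Cat.two_nat_data[OF assms] by (simp add: is_strict_tensor_functor_iff is_assoc_cat_of)

lemma two_nat_of:
  assumes R: "strict_tensor_2functor catalan_2cat cat_2cat R" and S: "strict_tensor_2functor catalan_2cat cat_2cat S"
    and G: "is_strict_tensor_functor (assoc_cat_of R) (assoc_cat_of S) G"
  obtains F where "strict_tensor_2nat catalan_2cat cat_2cat R S F" "F 1 = G"
proof -
  have "strict_tensor_2nat catalan_2cat cat_2cat R S (restrict (Cat.pow1 G) {1..})"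
    using G by (intro Cat.pow1_2nat R S) (simp_all add: is_strict_tensor_functor_iff)
  \<comment> \<open>\<open>pow1 G 1\<close> is \<open>G\<close> times the identity of the unit
    category, hence \<open>G\<close> itself.\<close>
  moreover have "restrict (Cat.pow1 G) {1..} 1 = G"
    using strict_tensor_functorD(3)[OF G] Cat.Ten1_unit(2)[of G] by simp
  ultimately show ?thesis using that by blast
qed

definition assoc_cat_functor where
  "assoc_cat_functor =
     \<lparr>OMap = restrict assoc_cat_of (Obj (Hom_st catalan_2cat cat_2cat)),
      AMap = restrict (\<lambda>(R, S, F). (assoc_cat_of R, assoc_cat_of S, F 1)) (Arr (Hom_st catalan_2cat cat_2cat))\<rparr>"

lemma assoc_cat_functor_simps [simp]:
  "strict_tensor_2functor catalan_2cat cat_2cat R \<Longrightarrow> OMap assoc_cat_functor R = assoc_cat_of R"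
  "strict_tensor_2nat catalan_2cat cat_2cat R S F \<Longrightarrow>
   AMap assoc_cat_functor (R, S, F) = (assoc_cat_of R, assoc_cat_of S, F 1)"
  by (simp_all add: assoc_cat_functor_def)

lemma is_functor_assoc_cat: "is_functor (Hom_st catalan_2cat cat_2cat) Assoc_Cat_st assoc_cat_functor"
proof (rule is_functorI)
  fix G F
  assume "composable (Hom_st catalan_2cat (cat_2cat :: (('a, 'b) small_cat, _, _) tensor_2cat)) G F"
  then obtain R S T F' G' where FG: "F = (R, S, F')" "G = (S, T, G')"
    and nat: "strict_tensor_2nat catalan_2cat cat_2cat R S F'" "strict_tensor_2nat catalan_2cat cat_2cat S T G'"
    by (cases F; cases G) (auto simp: composable_def)
  then show "AMap assoc_cat_functor (Comp (Hom_st catalan_2cat cat_2cat) G F) =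
      Comp Assoc_Cat_st (AMap assoc_cat_functor G) (AMap assoc_cat_functor F)"
    using Cat.two_nat_comp[OF nat] strict_tensor_functor_of[OF nat(1)] strict_tensor_functor_of[OF nat(2)] by simp
next
  fix R assume "R \<in> Obj (Hom_st catalan_2cat (cat_2cat :: (('a, 'b) small_cat, _, _) tensor_2cat))"
  then have R: "strict_tensor_2functor catalan_2cat cat_2cat R" by simp
  then show "AMap assoc_cat_functor (Id (Hom_st catalan_2cat cat_2cat) R) = Id Assoc_Cat_st (OMap assoc_cat_functor R)"
    using Cat.two_nat_id[OF R] is_assoc_cat_of[OF R] by simp
next
  show "category (Hom_st catalan_2cat cat_2cat)" by (rule Cat.category_Hom_st)
  show "category Assoc_Cat_st" by (rule category_Assoc_Cat_st)
next
  fix F assume "F \<in> Arr (Hom_st catalan_2cat (cat_2cat :: (('a, 'b) small_cat, _, _) tensor_2cat))"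
  then obtain R S F' where F: "F = (R, S, F')" and nat: "strict_tensor_2nat catalan_2cat cat_2cat R S F'" by auto
  show "AMap assoc_cat_functor F \<in> Arr Assoc_Cat_st"
    "Dom Assoc_Cat_st (AMap assoc_cat_functor F) = OMap assoc_cat_functor (Dom (Hom_st catalan_2cat cat_2cat) F)"
    "Cod Assoc_Cat_st (AMap assoc_cat_functor F) = OMap assoc_cat_functor (Cod (Hom_st catalan_2cat cat_2cat) F)"
    using nat strict_tensor_functor_of[OF nat] Cat.two_nat_data(1,2)[OF nat] by (simp_all add: F)
qed (simp_all add: is_assoc_cat_of, simp_all add: assoc_cat_functor_def)

theorem proposition4:
  shows "equivalent_categories
    (Hom_st catalan_2cat (cat_2cat :: (('o, 'm) small_cat, ('o, 'm) cat_1cell, ('o, 'm) cat_2cell) tensor_2cat))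
    (Assoc_Cat_st :: (('o, 'm) assoc_cat, ('o, 'm) assoc_cat \<times> ('o, 'm) assoc_cat \<times> ('o, 'm) cat_1cell) category)"
proof (rule equivalent_categories_bij[OF is_functor_assoc_cat])
  let ?H = "Hom_st catalan_2cat (cat_2cat :: (('o, 'm) small_cat, ('o, 'm) cat_1cell, ('o, 'm) cat_2cell) tensor_2cat)"
  show "bij_betw (OMap assoc_cat_functor) (Obj ?H) (Obj Assoc_Cat_st)"
    unfolding bij_betw_def inj_on_def
  proof (intro conjI ballI impI equalityI subsetI)
    fix B :: "('o, 'm) assoc_cat" assume "B \<in> Obj Assoc_Cat_st"
    then have "is_assoc_cat B" by simp
    then obtain R where "strict_tensor_2functor catalan_2cat cat_2cat R" "assoc_cat_of R = B"
      by (rule assoc_cat_of_surj)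
    then show "B \<in> OMap assoc_cat_functor ` Obj ?H" by (intro image_eqI[of _ _ R]) simp_all
  qed (auto simp: is_assoc_cat_of intro: assoc_cat_of_inj)
  show "bij_betw (AMap assoc_cat_functor) (Arr ?H) (Arr Assoc_Cat_st)"
    unfolding bij_betw_def inj_on_def
  proof (intro conjI ballI impI equalityI subsetI)
    \<comment> \<open>An arrow is a triple that contains its end points: these are recovered by
      \<open>assoc_cat_of_inj\<close>, and the components from the one at 1.\<close>
    fix x y assume "x \<in> Arr ?H" "y \<in> Arr ?H" and eq: "AMap assoc_cat_functor x = AMap assoc_cat_functor y"
    then obtain R S F R' S' F' where xy: "x = (R, S, F)" "y = (R', S', F')"
      and nat: "strict_tensor_2nat catalan_2cat cat_2cat R S F" "strict_tensor_2nat catalan_2cat cat_2cat R' S' F'"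
      by (cases x; cases y) auto
    have eq': "assoc_cat_of R = assoc_cat_of R'" "assoc_cat_of S = assoc_cat_of S'" "F 1 = F' 1"
      using eq nat by (simp_all add: xy)
    then have "R = R'" "S = S'"
      using assoc_cat_of_inj Cat.two_nat_data(1,2)[OF nat(1)] Cat.two_nat_data(1,2)[OF nat(2)] by blast+
    moreover have "F = F'"
      using eq'(3) Cat.two_nat_pow[OF nat(1)] Cat.two_nat_pow[OF nat(2)] by simp
    ultimately show "x = y" by (simp add: xy)
  next
    fix y :: "('o, 'm) assoc_cat \<times> ('o, 'm) assoc_cat \<times> ('o, 'm) cat_1cell"
    assume "y \<in> Arr Assoc_Cat_st"
    then obtain B B' G where y: "y = (B, B', G)" and G: "is_strict_tensor_functor B B' G" by auto
    \<comment> \<open>Both end points are lifted first, because \<open>two_nat_of\<close> extends a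
      tensor functor only between given 2-functors.\<close>
    obtain R where R: "strict_tensor_2functor catalan_2cat cat_2cat R" "assoc_cat_of R = B"
      using assoc_cat_of_surj[OF strict_tensor_functorD(1)[OF G]] by blast
    obtain S where S: "strict_tensor_2functor catalan_2cat cat_2cat S" "assoc_cat_of S = B'"
      using assoc_cat_of_surj[OF strict_tensor_functorD(2)[OF G]] by blast
    obtain F where "strict_tensor_2nat catalan_2cat cat_2cat R S F" "F 1 = G"
      using two_nat_of[OF R(1) S(1)] G R(2) S(2) by blast
    then show "y \<in> AMap assoc_cat_functor ` Arr ?H"
      using R S by (intro image_eqI[of _ _ "(R, S, F)"]) (simp_all add: y)
  qed (auto simp: strict_tensor_functor_of[unfolded One_nat_def])
qed

end
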